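(* Let $k$ be a field. Let $\mathfrak{a}$ be a Lie algebra over $k$ with a linear basis $A$ and multiplication table $[aa']=[aa']_{\mathfrak{a}}$, $a,a'\in A$, and let $\mathfrak{b}=Lie(B\mid R)$, where $R$ is a minimal Gröbner-Shirshov basis in $Lie(B)$. Then the following two statements hold. (I) A Lie algebra $\mathfrak{e}$ is an extension of $\mathfrak{a}$ by $\mathfrak{b}$ if and only if $$\mathfrak{e}\cong LieE_{(\mathfrak{a},\mathfrak{b},\lfloor\ \rfloor,\cdot)}=Lie\left(A\cup B\ \left|\ \begin{array}{ll}[aa']-[aa']_{\mathfrak{a}}, & a,a'\in A\\ {[ba]}-b\cdot a, & b\in B,\ a\in A\\ f-\lfloor f\rfloor, & f\in R\end{array}\right.\right)$$ for some compatible $Lie(B)$-module structure on $\mathfrak{a}$ (with module operation denoted by $\cdot$) and some factor set $\lfloor\ \rfloor:R\to\mathfrak{a}$ such that (a) for any $a\in A$, $f\in R$, one has $f\cdot a=[\lfloor f\rfloor a]_{\mathfrak{a}}$ in $\mathfrak{a}$; (b) for any intersection composition $\langle f_1,f_2\rangle_w$, where $f_1,f_2\in R$, $w=\overline{f_1}c=d\overline{f_2}$, $c,d\in B^*$ and $|\overline{f_1}|+|\overline{f_2}|>|w|$: if $$\langle f_1,f_2\rangle_w=[f_1c]_{\overline{f_1}}-[df_2]_{\overline{f_2}}=\sum\alpha_i[c_ig_id_i]_{\overline{g_i}},$$ where each $\alpha_i\in k$, $c_i,d_i\in B^*$, $g_i\in R$ and $c_i\overline{g_i}d_i<w$, then in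 $\mathfrak{a}$ $$Red_{S_{(\cdot)}}\big([\lfloor f_1\rfloor c]_{\overline{f_1}}-[d\lfloor f_2\rfloor]_{\overline{f_2}}\big)=\sum\alpha_i\,Red_{S_{(\cdot)}}\big([c_i\lfloor g_i\rfloor d_i]_{\overline{g_i}}\big).$$ (II) Let $\mathfrak{e}$ and $\mathfrak{e}'$ be two extensions of $\mathfrak{a}$ by $\mathfrak{b}$, and let $(\lfloor\ \rfloor,\cdot)$ (resp. $(\lfloor\ \rfloor',\cdot')$) be a special extension pair associated to $\mathfrak{e}$ (resp. $\mathfrak{e}'$). Then $\mathfrak{e}$ and $\mathfrak{e}'$ are equivalent if and only if there exists a map $\eta:B\to\mathfrak{a}$ such that $$b\cdot' a-b\cdot a=[\eta(b)a]_{\mathfrak{a}},\qquad \lfloor f\rfloor'-\lfloor f\rfloor=Red_{LieR_{(\lfloor\ \rfloor',\cdot')}}\big(f-\Gamma_\eta(f)\big)$$ in $\mathfrak{a}$ for any $a\in A$, $b\in B$ and $f\in R$.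
   Context: Words and brackets. For a well-ordered set $X$, $X^*$ is the free monoid, $X^{**}$ the set of non-associative words, $|u|$ is length, $\succ$ is the lex order on $X^*$ (with the convention that a proper prefix is larger: $u\succ uv$ for $v\neq1$) and $>$ the deg-lex order (length first, then lexicographic). A nonempty $w\in X^*$ is an associative Lyndon-Shirshov word if $w=uv$, $u,v\ne1$ implies $w\succ vu$; $ALSW(X)$ is the set of these. A non-associative word $(u)$ is a non-associative Lyndon-Shirshov word, written $[u]$, if (1) $u\in ALSW(X)$; (2) if $(u)=((u_1)(u_2))$ then $(u_1),(u_2)$ are non-associative Lyndon-Shirshov words; (3) if moreover $(u_1)=((u_1')(u_1''))$ then $u_1''\preceq u_2$. Each $w\in ALSW(X)$ has exactly one such bracketing $[w]$. $Lie(X)$ is the Lie subalgebra of the free associative algebra $k\langle X\rangle$ generated by $X$ under $(uv)=uv-vu$; it is the free Lie algebra on $X$, with linear basis $\{[w]: w\in ALSW(X)\}$. $Lie(X\mid S)=Lie(X)/Id(S)$, with $Id(S)$ the Lie ideal generated by $S$. For $f\ne0$, $\bar f$ is the leading word of $f\in k\langle X\rangle$ in deg-lex order; $f$ is monic if the coefficient of $\bar f$ is $1$. If $w=avb$ with $w,v\in ALSW(X)$, then $[w]=[a[vc]d]$ with $b=cd$; $[w]_v$ is obtained from $[w]$ by replacing $[vc]$ with $[\cdots[[[v][c_1]][c_2]]\cdots[c_n]]$, where $c=c_1\cdots c_n$, $c_i\in ALSW(X)$, $c_1\preceq\cdots\preceq c_n$. For monic $s\in Lie(X)$ with $a\bar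 sb\in ALSW(X)$, $[asb]_{\bar s}$ is obtained from $[a\bar sb]_{\bar s}$ by replacing $[\bar s]$ with $s$. Similarly, for $x\in\mathfrak{a}$, the expression $[axb]_{\bar s}$ (e.g. $[\lfloor f_1\rfloor c]_{\overline{f_1}}$, $[d\lfloor f_2\rfloor]_{\overline{f_2}}$, $[c_i\lfloor g_i\rfloor d_i]_{\overline{g_i}}$) is obtained from $[a\bar sb]_{\bar s}$ by replacing $[\bar s]$ with $x$. Compositions of monic $f,g\in Lie(X)$: (i) if $w=\bar fa=b\bar g$ with $|\bar f|+|\bar g|>|w|$, the intersection composition is $\langle f,g\rangle_w=[fa]_{\bar f}-[bg]_{\bar g}$; (ii) if $w=\bar f=a\bar gb$, the inclusion composition is $\langle f,g\rangle_w=f-[agb]_{\bar g}$. It is trivial modulo $(S,w)$ if it equals $\sum\alpha_i[a_is_ib_i]_{\overline{s_i}}$ with $\alpha_i\in k$, $a_i,b_i\in X^*$, $s_i\in S$, $a_i\overline{s_i}b_i\in ALSW(X)$, $a_i\overline{s_i}b_i<w$. A monic set $S\subseteq Lie(X)$ is a Gröbner-Shirshov basis if all compositions of its elements are trivial, and minimal if there is no inclusion composition in $S$. For a Gröbner-Shirshov basis $S$, $Irr(S)=\{[w]: w\in ALSW(X),\ w\ne a\bar sb,\ s\in S,\ a,b\in X^*\}$ is a linear basis of $Lie(X\mid S)$, and $Red_S(f)$ is the unique element of the span of $Irr(S)$ equal to $f$ in $Lie(X\mid S)$. Compatible module: for Lie algebras $\mathfrak{c},\mathfrak{d}$, $\mathfrak{c}$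 is a compatible $\mathfrak{d}$-module if it is a $\mathfrak{d}$-module (operation $\cdot$) with $d\cdot[cc']=[(d\cdot c)c']+[c(d\cdot c')]$ for all $c,c'\in\mathfrak{c}$, $d\in\mathfrak{d}$. Setting. $A\cup B$ (disjoint union) is well-ordered with $b>a$ for all $b\in B,a\in A$; deg-lex orders on $B^*$ and $(A\cup B)^*$ are the induced ones; $R$ is a Gröbner-Shirshov basis with respect to deg-lex on $B^*$. $[xy]_{\mathfrak{a}}$ is the bracket of $\mathfrak{a}$, and elements of $\mathfrak{a}$ are regarded as linear combinations of letters in $A$. A factor set of $\mathfrak{b}$ in $\mathfrak{a}$ is any map $\lfloor\ \rfloor:R\to\mathfrak{a}$. Given a compatible $Lie(B)$-module structure $\cdot$ on $\mathfrak{a}$: $S_{(\cdot)}=\{[ba]-b\cdot a: a\in A,b\in B\}$, which is a Gröbner-Shirshov basis in $Lie(A\cup B)$; $Red_{S_{(\cdot)}}$ sends linear combinations of bracketed words having exactly one letter from $A$ and all others from $B$ into $\mathfrak{a}$. $LieR_{(\lfloor\ \rfloor,\cdot)}$ is the set of polynomials $[aa']-[aa']_{\mathfrak{a}}$ ($a,a'\in A$, $a>a'$), $[ba]-b\cdot a$ ($b\in B,a\in A$), $f-\lfloor f\rfloor$ ($f\in R$), and $LieE_{(\mathfrak{a},\mathfrak{b},\lfloor\ \rfloor,\cdot)}=Lie(A\cup B\mid LieR_{(\lfloor\ \rfloor,\cdot)})$. Extension: $\mathfrak{e}$ is an extension of $\mathfrak{a}$ by $\mathfrak{b}$ if there is a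 short exact sequence of Lie algebras $0\to\mathfrak{a}\xrightarrow{i}\mathfrak{e}\xrightarrow{\pi}\mathfrak{b}\to0$. Two extensions $(\mathfrak{e},i,\pi)$, $(\mathfrak{e}',i',\pi')$ are equivalent if there is a homomorphism $\varphi:\mathfrak{e}\to\mathfrak{e}'$ with $\varphi i=i'$, $\pi'\varphi=\pi$. Special extension pair: if $\cdot$ is a compatible $Lie(B)$-module operation on $\mathfrak{a}$ and $\lfloor\ \rfloor$ a factor set satisfying (a) and (b), then $0\to\mathfrak{a}\to LieE_{(\mathfrak{a},\mathfrak{b},\lfloor\ \rfloor,\cdot)}\to\mathfrak{b}\to0$ is an extension, the first map being $a\mapsto a$ and the second the homomorphism with $a\mapsto0$ ($a\in A$), $b\mapsto b$ ($b\in B$). The pair $(\lfloor\ \rfloor,\cdot)$ is a special extension pair associated to an extension $0\to\mathfrak{a}\to\mathfrak{e}\to\mathfrak{b}\to0$ if that extension is equivalent to this one; every extension has such a pair. For $\eta:B\to\mathfrak{a}$, $\Gamma_\eta:Lie(A\cup B)\to Lie(A\cup B)$ is the unique homomorphism with $\Gamma_\eta(b)=b-\eta(b)$ ($b\in B$) and $\Gamma_\eta(a)=a$ ($a\in A$). When $LieR_{(\lfloor\ \rfloor',\cdot')}$ is a Gröbner-Shirshov basis in $Lie(A\cup B)$, $Red_{LieR_{(\lfloor\ \rfloor',\cdot')}}(g-\Gamma_\eta(g))\in\mathfrak{a}$ for all $g\in Lie(B)$. *)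

theory Defs
  imports
    Complex_Main
    "HOL-Library.Poly_Mapping"
    "HOL-Library.List_Lenlexorder"
    "HOL-Library.FuncSet"
    "HOL-Algebra.Module"
    "HOL-Algebra.QuotRing"
begin

section \<open>Lie algebras over a field\<close>

definition scalars :: "'k::field ring" where
  "scalars = \<lparr>carrier = UNIV, mult = (*), one = 1, zero = 0, add = (+)\<rparr>"

text \<open>
  A Lie algebra is carried by the record type \<^type>\<open>module\<close>; the field \<open>\<otimes>\<close> is the Lie bracket, and
  the field \<open>\<one>\<close> of the record is not used.
\<close>

locale lie_algebra = module "scalars :: 'k::field ring" L for L :: "('k::field, 'v) module" (structure) +
  assumes bracket_closed: "\<lbrakk>x \<in> carrier L; y \<in> carrier L\<rbrakk> \<Longrightarrow> x \<otimes> y \<in> carrier L"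
    and bracket_add_left: "\<lbrakk>x \<in> carrier L; y \<in> carrier L; z \<in> carrier L\<rbrakk>
      \<Longrightarrow> (x \<oplus> y) \<otimes> z = x \<otimes> z \<oplus> y \<otimes> z"
    and bracket_add_right: "\<lbrakk>x \<in> carrier L; y \<in> carrier L; z \<in> carrier L\<rbrakk>
      \<Longrightarrow> x \<otimes> (y \<oplus> z) = x \<otimes> y \<oplus> x \<otimes> z"
    and bracket_smult_left: "\<lbrakk>x \<in> carrier L; y \<in> carrier L\<rbrakk>
      \<Longrightarrow> (\<alpha> \<odot> x) \<otimes> y = \<alpha> \<odot> (x \<otimes> y)"
    and bracket_smult_right: "\<lbrakk>x \<in> carrier L; y \<in> carrier L\<rbrakk>
      \<Longrightarrow> x \<otimes> (\<alpha> \<odot> y) = \<alpha> \<odot> (x \<otimes> y)"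
    and bracket_self: "x \<in> carrier L \<Longrightarrow> x \<otimes> x = \<zero>"
    and jacobi: "\<lbrakk>x \<in> carrier L; y \<in> carrier L; z \<in> carrier L\<rbrakk>
      \<Longrightarrow> x \<otimes> (y \<otimes> z) \<oplus> y \<otimes> (z \<otimes> x) \<oplus> z \<otimes> (x \<otimes> y) = \<zero>"

definition lie_hom :: "('k::field, 'v) module \<Rightarrow> ('k, 'w) module \<Rightarrow> ('v \<Rightarrow> 'w) set" where
  "lie_hom L M = {h \<in> carrier L \<rightarrow> carrier M.
     (\<forall>x\<in>carrier L. \<forall>y\<in>carrier L. h (x \<oplus>\<^bsub>L\<^esub> y) = h x \<oplus>\<^bsub>M\<^esub> h y) \<and>
     (\<forall>\<alpha>. \<forall>x\<in>carrier L. h (\<alpha> \<odot>\<^bsub>L\<^esub> x) = \<alpha> \<odot>\<^bsub>M\<^esub> h x) \<and>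
     (\<forall>x\<in>carrier L. \<forall>y\<in>carrier L. h (x \<otimes>\<^bsub>L\<^esub> y) = h x \<otimes>\<^bsub>M\<^esub> h y)}"

definition lie_isomorphic :: "('k::field, 'v) module \<Rightarrow> ('k, 'w) module \<Rightarrow> bool" where
  "lie_isomorphic L M \<longleftrightarrow> (\<exists>h\<in>lie_hom L M. bij_betw h (carrier L) (carrier M))"

definition lie_quotient :: "('k::field, 'v) module \<Rightarrow> 'v set \<Rightarrow> ('k, 'v set) module" where
  "lie_quotient L I =
     \<lparr>carrier = a_rcosets\<^bsub>L\<^esub> I, mult = rcoset_mult L I, one = undefined,
      zero = I, add = set_add L,
      smult = (\<lambda>\<alpha> C. \<Union>x\<in>C. I +>\<^bsub>L\<^esub> (\<alpha> \<odot>\<^bsub>L\<^esub> x))\<rparr>"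

definition compatible_module ::
  "('k::field, 'd) module \<Rightarrow> ('k, 'c) module \<Rightarrow> ('d \<Rightarrow> 'c \<Rightarrow> 'c) \<Rightarrow> bool" where
  "compatible_module D C act \<longleftrightarrow>
     (\<forall>d\<in>carrier D. \<forall>c\<in>carrier C. act d c \<in> carrier C) \<and>
     (\<forall>d\<in>carrier D. \<forall>d'\<in>carrier D. \<forall>c\<in>carrier C.
        act (d \<oplus>\<^bsub>D\<^esub> d') c = act d c \<oplus>\<^bsub>C\<^esub> act d' c) \<and>
     (\<forall>\<alpha>. \<forall>d\<in>carrier D. \<forall>c\<in>carrier C. act (\<alpha> \<odot>\<^bsub>D\<^esub> d) c = \<alpha> \<odot>\<^bsub>C\<^esub> act d c) \<and>
     (\<forall>d\<in>carrier D. \<forall>c\<in>carrier C. \<forall>c'\<in>carrier C.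
        act d (c \<oplus>\<^bsub>C\<^esub> c') = act d c \<oplus>\<^bsub>C\<^esub> act d c') \<and>
     (\<forall>\<alpha>. \<forall>d\<in>carrier D. \<forall>c\<in>carrier C. act d (\<alpha> \<odot>\<^bsub>C\<^esub> c) = \<alpha> \<odot>\<^bsub>C\<^esub> act d c) \<and>
     (\<forall>d\<in>carrier D. \<forall>d'\<in>carrier D. \<forall>c\<in>carrier C.
        act (d \<otimes>\<^bsub>D\<^esub> d') c = act d (act d' c) \<ominus>\<^bsub>C\<^esub> act d' (act d c)) \<and>
     (\<forall>d\<in>carrier D. \<forall>c\<in>carrier C. \<forall>c'\<in>carrier C.
        act d (c \<otimes>\<^bsub>C\<^esub> c') = act d c \<otimes>\<^bsub>C\<^esub> c' \<oplus>\<^bsub>C\<^esub> c \<otimes>\<^bsub>C\<^esub> act d c')"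

definition extension ::
  "('k::field, 'v) module \<Rightarrow> ('k, 'w) module \<Rightarrow> ('k, 'e) module \<Rightarrow> ('v \<Rightarrow> 'e) \<Rightarrow> ('e \<Rightarrow> 'w) \<Rightarrow> bool"
  where
  "extension \<aa> \<bb> \<ee> i \<pi> \<longleftrightarrow>
     lie_algebra \<ee> \<and> i \<in> lie_hom \<aa> \<ee> \<and> \<pi> \<in> lie_hom \<ee> \<bb> \<and>
     inj_on i (carrier \<aa>) \<and>
     i ` carrier \<aa> = {x \<in> carrier \<ee>. \<pi> x = \<zero>\<^bsub>\<bb>\<^esub>} \<and>
     \<pi> ` carrier \<ee> = carrier \<bb>"

definition equivalent_extensions ::
  "('k::field, 'v) module \<Rightarrow> ('k, 'e) module \<Rightarrow> ('v \<Rightarrow> 'e) \<Rightarrow> ('e \<Rightarrow> 'w) \<Rightarrow>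
   ('k, 'f) module \<Rightarrow> ('v \<Rightarrow> 'f) \<Rightarrow> ('f \<Rightarrow> 'w) \<Rightarrow> bool" where
  "equivalent_extensions \<aa> \<ee> i \<pi> \<ee>' i' \<pi>' \<longleftrightarrow>
     (\<exists>\<phi>\<in>lie_hom \<ee> \<ee>'. (\<forall>x\<in>carrier \<aa>. \<phi> (i x) = i' x) \<and> (\<forall>y\<in>carrier \<ee>. \<pi>' (\<phi> y) = \<pi> y))"

text \<open>\<open>\<epsilon> x\<close> is the basis vector named by the letter \<open>x\<close> of \<open>A\<close>.\<close>

definition lin_comb :: "('k::field, 'v) module \<Rightarrow> ('x \<Rightarrow> 'v) \<Rightarrow> ('x \<Rightarrow>\<^sub>0 'k) \<Rightarrow> 'v" where
  "lin_comb L \<epsilon> c = (\<Oplus>\<^bsub>L\<^esub>x\<in>Poly_Mapping.keys c. Poly_Mapping.lookup c x \<odot>\<^bsub>L\<^esub> \<epsilon> x)"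

definition linear_basis :: "('k::field, 'v) module \<Rightarrow> 'x set \<Rightarrow> ('x \<Rightarrow> 'v) \<Rightarrow> bool" where
  "linear_basis L A \<epsilon> \<longleftrightarrow>
     \<epsilon> \<in> A \<rightarrow> carrier L \<and> bij_betw (lin_comb L \<epsilon>) {c. Poly_Mapping.keys c \<subseteq> A} (carrier L)"


section \<open>The free associative algebra and its free Lie subalgebra\<close>

text \<open>
  With concatenation as the monoid operation on lists, the free associative algebra over \<open>k\<close> is
  the monoid ring \<open>'x list \<Rightarrow>\<^sub>0 'k\<close>.  The order \<open><\<close> on lists is the deg-lex order.
\<close>

instantiation list :: (type) monoid_add
begin

definition zero_list_def: "0 = []"

definition plus_list_def: "xs + ys = xs @ ys"

instance
  by standard (simp_all add: zero_list_def plus_list_def)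

end

type_synonym ('x, 'k) ncpoly = "'x list \<Rightarrow>\<^sub>0 'k"

definition letter :: "'x \<Rightarrow> ('x, 'k::field) ncpoly" where
  "letter x = Poly_Mapping.single [x] 1"

definition pscale :: "'k::field \<Rightarrow> ('x, 'k) ncpoly \<Rightarrow> ('x, 'k) ncpoly" where
  "pscale \<alpha> p = Poly_Mapping.single [] \<alpha> * p"

lemma pscale_vector_space: "Vector_Spaces.vector_space (pscale :: 'k::field \<Rightarrow> ('x, 'k) ncpoly \<Rightarrow> _)"
proof -
  have one: "Poly_Mapping.single [] 1 = (1 :: ('x, 'k) ncpoly)"
    using single_one[where ?'a = "'x list" and ?'b = 'k] by (simp add: zero_list_def)
  show ?thesis
    by standard (simp_all add: pscale_def one distrib_left distrib_right single_add
        mult.assoc[symmetric] mult_single plus_list_def)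
qed

global_interpretation ncpoly: Vector_Spaces.vector_space "pscale :: 'k::field \<Rightarrow> ('x, 'k) ncpoly \<Rightarrow> _"
  by (rule pscale_vector_space)

definition comm :: "('x, 'k::field) ncpoly \<Rightarrow> ('x, 'k) ncpoly \<Rightarrow> ('x, 'k) ncpoly" where
  "comm p q = p * q - q * p"

inductive_set Lie :: "'x set \<Rightarrow> ('x, 'k::field) ncpoly set" for X where
  zero: "0 \<in> Lie X"
| letter: "x \<in> X \<Longrightarrow> letter x \<in> Lie X"
| add: "\<lbrakk>p \<in> Lie X; q \<in> Lie X\<rbrakk> \<Longrightarrow> p + q \<in> Lie X"
| scale: "p \<in> Lie X \<Longrightarrow> pscale \<alpha> p \<in> Lie X"
| comm: "\<lbrakk>p \<in> Lie X; q \<in> Lie X\<rbrakk> \<Longrightarrow> comm p q \<in> Lie X"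

definition free_lie :: "'x set \<Rightarrow> ('k::field, ('x, 'k) ncpoly) module" where
  "free_lie X = \<lparr>carrier = Lie X, mult = comm, one = undefined, zero = 0, add = (+), smult = pscale\<rparr>"

inductive_set lie_ideal :: "'x set \<Rightarrow> ('x, 'k::field) ncpoly set \<Rightarrow> ('x, 'k) ncpoly set"
  for X S where
  zero: "0 \<in> lie_ideal X S"
| gen: "s \<in> S \<Longrightarrow> s \<in> lie_ideal X S"
| add: "\<lbrakk>p \<in> lie_ideal X S; q \<in> lie_ideal X S\<rbrakk> \<Longrightarrow> p + q \<in> lie_ideal X S"
| scale: "p \<in> lie_ideal X S \<Longrightarrow> pscale \<alpha> p \<in> lie_ideal X S"
| comm: "\<lbrakk>p \<in> lie_ideal X S; q \<in> Lie X\<rbrakk> \<Longrightarrow> comm p q \<in> lie_ideal X S"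

definition presented_lie ::
  "'x set \<Rightarrow> ('x, 'k::field) ncpoly set \<Rightarrow> ('k, ('x, 'k) ncpoly set) module" where
  "presented_lie X S = lie_quotient (free_lie X) (lie_ideal X S)"

text \<open>
  The homomorphism of associative algebras sending each letter \<open>x\<close> to \<open>\<phi> x\<close>; it maps commutators
  to commutators.
\<close>

definition free_hom :: "('x \<Rightarrow> ('x, 'k::field) ncpoly) \<Rightarrow> ('x, 'k) ncpoly \<Rightarrow> ('x, 'k) ncpoly" where
  "free_hom \<phi> p =
     (\<Sum>w\<in>Poly_Mapping.keys p. pscale (Poly_Mapping.lookup p w) (prod_list (map \<phi> w)))"


section \<open>Lyndon-Shirshov words\<close>

text \<open>
  \<^const>\<open>lexord\<close> puts a proper prefix before the longer word, so over the reversed order of the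
  letters it is the relation \<open>\<succ>\<close>, for which a proper prefix is the larger word.
\<close>

definition lex_greater :: "'x::wellorder list \<Rightarrow> 'x list \<Rightarrow> bool" (infix "\<succ>" 50) where
  "u \<succ> v \<longleftrightarrow> (u, v) \<in> lexord {(x, y). y < x}"

definition lex_le :: "'x::wellorder list \<Rightarrow> 'x list \<Rightarrow> bool" (infix "\<preceq>" 50) where
  "u \<preceq> v \<longleftrightarrow> u = v \<or> v \<succ> u"

definition alsw :: "'x::wellorder list \<Rightarrow> bool" where
  "alsw w \<longleftrightarrow> w \<noteq> [] \<and> (\<forall>u v. u \<noteq> [] \<and> v \<noteq> [] \<and> w = u @ v \<longrightarrow> w \<succ> v @ u)"

definition ALSW :: "'x::wellorder set \<Rightarrow> 'x list set" where
  "ALSW X = {w \<in> lists X. alsw w}"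

datatype 'x naword = Single 'x | Bracket "'x naword" "'x naword"

primrec word :: "'x naword \<Rightarrow> 'x list" where
  "word (Single x) = [x]"
| "word (Bracket s t) = word s @ word t"

primrec lie_eval :: "'x naword \<Rightarrow> ('x, 'k::field) ncpoly" where
  "lie_eval (Single x) = letter x"
| "lie_eval (Bracket s t) = comm (lie_eval s) (lie_eval t)"

primrec nlsw :: "'x::wellorder naword \<Rightarrow> bool" where
  "nlsw (Single x) \<longleftrightarrow> alsw [x]"
| "nlsw (Bracket s t) \<longleftrightarrow> alsw (word s @ word t) \<and> nlsw s \<and> nlsw t \<and>
     (case s of Single _ \<Rightarrow> True | Bracket s' s'' \<Rightarrow> word s'' \<preceq> word t)"

definition bracketing :: "'x::wellorder list \<Rightarrow> 'x naword" where
  "bracketing w = (THE t. nlsw t \<and> word t = w)"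

text \<open>Non-associative words with one hole; \<open>plug\<close> evaluates them in the free associative algebra.\<close>

datatype 'x nactx = Hole | HoleL "'x nactx" "'x naword" | HoleR "'x naword" "'x nactx"

primrec fill :: "'x nactx \<Rightarrow> 'x naword \<Rightarrow> 'x naword" where
  "fill Hole s = s"
| "fill (HoleL C t) s = Bracket (fill C s) t"
| "fill (HoleR t C) s = Bracket t (fill C s)"

primrec ctx_comp :: "'x nactx \<Rightarrow> 'x nactx \<Rightarrow> 'x nactx" where
  "ctx_comp Hole D = D"
| "ctx_comp (HoleL C t) D = HoleL (ctx_comp C D) t"
| "ctx_comp (HoleR t C) D = HoleR t (ctx_comp C D)"

primrec plug :: "'x nactx \<Rightarrow> ('x, 'k::field) ncpoly \<Rightarrow> ('x, 'k) ncpoly" where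
  "plug Hole p = p"
| "plug (HoleL C t) p = comm (plug C p) (lie_eval t)"
| "plug (HoleR t C) p = comm (lie_eval t) (plug C p)"

primrec left_word :: "'x nactx \<Rightarrow> 'x list" where
  "left_word Hole = []"
| "left_word (HoleL C t) = left_word C"
| "left_word (HoleR t C) = word t @ left_word C"

primrec right_word :: "'x nactx \<Rightarrow> 'x list" where
  "right_word Hole = []"
| "right_word (HoleL C t) = right_word C @ word t"
| "right_word (HoleR t C) = right_word C"

text \<open>
  The special bracketing \<open>[avb]\<^sub>v\<close> with a hole in place of \<open>[v]\<close>.  The subword \<open>[vc]\<close> of \<open>[avb]\<close> need
  not be unique, but the result does not depend on it: if \<open>[vc]\<close> and \<open>[[vc]t]\<close> both occur, then
  every Lyndon-Shirshov factor of \<open>c\<close> is \<open>\<preceq> word t\<close>, so \<open>t\<close> is just appended to the chain.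
\<close>

definition special_ctx :: "'x::wellorder list \<Rightarrow> 'x list \<Rightarrow> 'x list \<Rightarrow> 'x nactx" where
  "special_ctx a v b = (SOME D. \<exists>C c d cs.
     b = c @ d \<and> alsw (v @ c) \<and>
     bracketing (a @ v @ b) = fill C (bracketing (v @ c)) \<and> left_word C = a \<and> right_word C = d \<and>
     c = concat cs \<and> (\<forall>u\<in>set cs. alsw u) \<and> sorted_wrt (\<preceq>) cs \<and>
     D = ctx_comp C (foldl (\<lambda>E u. HoleL E (bracketing u)) Hole cs))"

text \<open>\<open>special a v b p\<close> is \<open>[apb]\<^sub>v\<close>: the special bracketing with \<open>[v]\<close> replaced by \<open>p\<close>.\<close>

definition special ::
  "'x::wellorder list \<Rightarrow> 'x list \<Rightarrow> 'x list \<Rightarrow> ('x, 'k::field) ncpoly \<Rightarrow> ('x, 'k) ncpoly" where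
  "special a v b p = plug (special_ctx a v b) p"


section \<open>Groebner-Shirshov bases\<close>

definition lead :: "('x::wellorder, 'k::field) ncpoly \<Rightarrow> 'x list" where
  "lead f = Max (Poly_Mapping.keys f)"

definition monic :: "('x::wellorder, 'k::field) ncpoly \<Rightarrow> bool" where
  "monic f \<longleftrightarrow> f \<noteq> 0 \<and> Poly_Mapping.lookup f (lead f) = 1"

text \<open>A linear combination \<open>\<Sum> \<alpha>\<^sub>i [c\<^sub>i g\<^sub>i d\<^sub>i]\<close> is given by the list of the \<open>(\<alpha>\<^sub>i, c\<^sub>i, g\<^sub>i, d\<^sub>i)\<close>.\<close>

definition below_terms ::
  "'x::wellorder set \<Rightarrow> ('x, 'k::field) ncpoly set \<Rightarrow> 'x list \<Rightarrow>
   ('k \<times> 'x list \<times> ('x, 'k) ncpoly \<times> 'x list) list \<Rightarrow> bool" where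
  "below_terms X S w ts \<longleftrightarrow> (\<forall>(\<alpha>, c, g, d)\<in>set ts.
     c \<in> lists X \<and> d \<in> lists X \<and> g \<in> S \<and> c @ lead g @ d \<in> ALSW X \<and> c @ lead g @ d < w)"

definition special_sum ::
  "('k::field \<times> 'x::wellorder list \<times> ('x, 'k) ncpoly \<times> 'x list) list \<Rightarrow> ('x, 'k) ncpoly" where
  "special_sum ts = (\<Sum>(\<alpha>, c, g, d)\<leftarrow>ts. pscale \<alpha> (special c (lead g) d g))"

definition trivial_mod ::
  "'x::wellorder set \<Rightarrow> ('x, 'k::field) ncpoly set \<Rightarrow> 'x list \<Rightarrow> ('x, 'k) ncpoly \<Rightarrow> bool" where
  "trivial_mod X S w h \<longleftrightarrow> (\<exists>ts. below_terms X S w ts \<and> h = special_sum ts)"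

definition overlap ::
  "('x::wellorder, 'k::field) ncpoly \<Rightarrow> 'x list \<Rightarrow> 'x list \<Rightarrow> ('x, 'k) ncpoly \<Rightarrow> 'x list \<Rightarrow> bool" where
  "overlap f a b g w \<longleftrightarrow>
     w = lead f @ a \<and> w = b @ lead g \<and> length (lead f) + length (lead g) > length w"

definition intersection_composition ::
  "('x::wellorder, 'k::field) ncpoly \<Rightarrow> 'x list \<Rightarrow> 'x list \<Rightarrow> ('x, 'k) ncpoly \<Rightarrow> ('x, 'k) ncpoly" where
  "intersection_composition f a b g = special [] (lead f) a f - special b (lead g) [] g"

definition inclusion_composition ::
  "('x::wellorder, 'k::field) ncpoly \<Rightarrow> 'x list \<Rightarrow> ('x, 'k) ncpoly \<Rightarrow> 'x list \<Rightarrow> ('x, 'k) ncpoly" where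
  "inclusion_composition f a g b = f - special a (lead g) b g"

definition GS_basis :: "'x::wellorder set \<Rightarrow> ('x, 'k::field) ncpoly set \<Rightarrow> bool" where
  "GS_basis X S \<longleftrightarrow>
     S \<subseteq> Lie X \<and> (\<forall>s\<in>S. monic s) \<and>
     (\<forall>f\<in>S. \<forall>g\<in>S. \<forall>a\<in>lists X. \<forall>b\<in>lists X. \<forall>w.
        overlap f a b g w \<longrightarrow> trivial_mod X S w (intersection_composition f a b g)) \<and>
     (\<forall>f\<in>S. \<forall>g\<in>S. \<forall>a\<in>lists X. \<forall>b\<in>lists X.
        lead f = a @ lead g @ b \<longrightarrow> trivial_mod X S (lead f) (inclusion_composition f a g b))"

text \<open>The inclusion \<open>lead f = 1 (lead f) 1\<close> of \<open>f\<close> in itself does not count.\<close>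

definition minimal_GS_basis :: "'x::wellorder set \<Rightarrow> ('x, 'k::field) ncpoly set \<Rightarrow> bool" where
  "minimal_GS_basis X S \<longleftrightarrow> GS_basis X S \<and>
     \<not> (\<exists>f\<in>S. \<exists>g\<in>S. \<exists>a\<in>lists X. \<exists>b\<in>lists X. f \<noteq> g \<and> lead f = a @ lead g @ b)"

definition Irr :: "'x::wellorder set \<Rightarrow> ('x, 'k::field) ncpoly set \<Rightarrow> ('x, 'k) ncpoly set" where
  "Irr X S = {lie_eval (bracketing w) | w. w \<in> ALSW X \<and>
     \<not> (\<exists>s\<in>S. \<exists>a\<in>lists X. \<exists>b\<in>lists X. w = a @ lead s @ b)}"

definition Red ::
  "'x::wellorder set \<Rightarrow> ('x, 'k::field) ncpoly set \<Rightarrow> ('x, 'k) ncpoly \<Rightarrow> ('x, 'k) ncpoly" where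
  "Red X S f = (THE g. g \<in> ncpoly.span (Irr X S) \<and> f - g \<in> lie_ideal X S)"


section \<open>Extensions given by generators and relations\<close>

text \<open>
  \<open>A\<close> and \<open>B\<close> are sets of letters of one well-ordered type, with every letter of \<open>A\<close> below every
  letter of \<open>B\<close>; thus \<open>Lie B\<close> is literally a subset of \<open>Lie (A \<union> B)\<close>.
\<close>

text \<open>An element of \<open>\<aa>\<close> regarded as a linear combination of letters in \<open>A\<close>.\<close>

definition as_letters ::
  "('k::field, 'v) module \<Rightarrow> 'x set \<Rightarrow> ('x \<Rightarrow> 'v) \<Rightarrow> 'v \<Rightarrow> ('x, 'k) ncpoly" where
  "as_letters \<aa> A \<epsilon> v =
     (let c = inv_into {c. Poly_Mapping.keys c \<subseteq> A} (lin_comb \<aa> \<epsilon>) v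
      in \<Sum>x\<in>Poly_Mapping.keys c. pscale (Poly_Mapping.lookup c x) (letter x))"

definition action_relations ::
  "('k::field, 'v) module \<Rightarrow> 'x set \<Rightarrow> ('x \<Rightarrow> 'v) \<Rightarrow> 'x set \<Rightarrow> (('x, 'k) ncpoly \<Rightarrow> 'v \<Rightarrow> 'v) \<Rightarrow>
   ('x, 'k) ncpoly set" where
  "action_relations \<aa> A \<epsilon> B act =
     {comm (letter b) (letter a) - as_letters \<aa> A \<epsilon> (act (letter b) (\<epsilon> a)) | a b. a \<in> A \<and> b \<in> B}"

definition LieR ::
  "('k::field, 'v) module \<Rightarrow> 'x::wellorder set \<Rightarrow> ('x \<Rightarrow> 'v) \<Rightarrow> 'x set \<Rightarrow> ('x, 'k) ncpoly set \<Rightarrow>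
   (('x, 'k) ncpoly \<Rightarrow> 'v) \<Rightarrow> (('x, 'k) ncpoly \<Rightarrow> 'v \<Rightarrow> 'v) \<Rightarrow> ('x, 'k) ncpoly set" where
  "LieR \<aa> A \<epsilon> B R fs act =
     {comm (letter a) (letter a') - as_letters \<aa> A \<epsilon> (\<epsilon> a \<otimes>\<^bsub>\<aa>\<^esub> \<epsilon> a') | a a'. a \<in> A \<and> a' \<in> A \<and> a > a'}
     \<union> action_relations \<aa> A \<epsilon> B act
     \<union> {f - as_letters \<aa> A \<epsilon> (fs f) | f. f \<in> R}"

definition LieE ::
  "('k::field, 'v) module \<Rightarrow> 'x::wellorder set \<Rightarrow> ('x \<Rightarrow> 'v) \<Rightarrow> 'x set \<Rightarrow> ('x, 'k) ncpoly set \<Rightarrow>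
   (('x, 'k) ncpoly \<Rightarrow> 'v) \<Rightarrow> (('x, 'k) ncpoly \<Rightarrow> 'v \<Rightarrow> 'v) \<Rightarrow> ('k, ('x, 'k) ncpoly set) module" where
  "LieE \<aa> A \<epsilon> B R fs act = presented_lie (A \<union> B) (LieR \<aa> A \<epsilon> B R fs act)"

definition LieE_incl ::
  "('k::field, 'v) module \<Rightarrow> 'x::wellorder set \<Rightarrow> ('x \<Rightarrow> 'v) \<Rightarrow> 'x set \<Rightarrow> ('x, 'k) ncpoly set \<Rightarrow>
   (('x, 'k) ncpoly \<Rightarrow> 'v) \<Rightarrow> (('x, 'k) ncpoly \<Rightarrow> 'v \<Rightarrow> 'v) \<Rightarrow> 'v \<Rightarrow> ('x, 'k) ncpoly set" where
  "LieE_incl \<aa> A \<epsilon> B R fs act v =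
     lie_ideal (A \<union> B) (LieR \<aa> A \<epsilon> B R fs act) +>\<^bsub>free_lie (A \<union> B)\<^esub> as_letters \<aa> A \<epsilon> v"

text \<open>The homomorphism induced by \<open>a \<mapsto> 0\<close>, \<open>b \<mapsto> b\<close>, applied to the representatives of a coset.\<close>

definition LieE_proj ::
  "'x set \<Rightarrow> 'x set \<Rightarrow> ('x, 'k::field) ncpoly set \<Rightarrow> ('x, 'k) ncpoly set \<Rightarrow> ('x, 'k) ncpoly set" where
  "LieE_proj A B R C =
     (\<Union>p\<in>C. lie_ideal B R +>\<^bsub>free_lie B\<^esub> free_hom (\<lambda>x. if x \<in> A then 0 else letter x) p)"

definition condition_a ::
  "('k::field, 'v) module \<Rightarrow> 'x set \<Rightarrow> ('x \<Rightarrow> 'v) \<Rightarrow> ('x, 'k) ncpoly set \<Rightarrow>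
   (('x, 'k) ncpoly \<Rightarrow> 'v) \<Rightarrow> (('x, 'k) ncpoly \<Rightarrow> 'v \<Rightarrow> 'v) \<Rightarrow> bool" where
  "condition_a \<aa> A \<epsilon> R fs act \<longleftrightarrow> (\<forall>a\<in>A. \<forall>f\<in>R. act f (\<epsilon> a) = fs f \<otimes>\<^bsub>\<aa>\<^esub> \<epsilon> a)"

definition condition_b ::
  "('k::field, 'v) module \<Rightarrow> 'x::wellorder set \<Rightarrow> ('x \<Rightarrow> 'v) \<Rightarrow> 'x set \<Rightarrow> ('x, 'k) ncpoly set \<Rightarrow>
   (('x, 'k) ncpoly \<Rightarrow> 'v) \<Rightarrow> (('x, 'k) ncpoly \<Rightarrow> 'v \<Rightarrow> 'v) \<Rightarrow> bool" where
  "condition_b \<aa> A \<epsilon> B R fs act \<longleftrightarrow>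
     (let red = Red (A \<union> B) (action_relations \<aa> A \<epsilon> B act);
          fl = (\<lambda>f. as_letters \<aa> A \<epsilon> (fs f))
      in \<forall>f\<^sub>1\<in>R. \<forall>f\<^sub>2\<in>R. \<forall>c\<in>lists B. \<forall>d\<in>lists B. \<forall>w ts.
           overlap f\<^sub>1 c d f\<^sub>2 w \<and> below_terms B R w ts \<and>
           intersection_composition f\<^sub>1 c d f\<^sub>2 = special_sum ts \<longrightarrow>
           red (special [] (lead f\<^sub>1) c (fl f\<^sub>1) - special d (lead f\<^sub>2) [] (fl f\<^sub>2)) =
           (\<Sum>(\<alpha>, c', g, d')\<leftarrow>ts. pscale \<alpha> (red (special c' (lead g) d' (fl g)))))"

definition extension_pair ::
  "('k::field, 'v) module \<Rightarrow> 'x::wellorder set \<Rightarrow> ('x \<Rightarrow> 'v) \<Rightarrow> 'x set \<Rightarrow> ('x, 'k) ncpoly set \<Rightarrow>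
   (('x, 'k) ncpoly \<Rightarrow> 'v) \<Rightarrow> (('x, 'k) ncpoly \<Rightarrow> 'v \<Rightarrow> 'v) \<Rightarrow> bool" where
  "extension_pair \<aa> A \<epsilon> B R fs act \<longleftrightarrow>
     compatible_module (free_lie B) \<aa> act \<and> fs \<in> R \<rightarrow> carrier \<aa> \<and>
     condition_a \<aa> A \<epsilon> R fs act \<and> condition_b \<aa> A \<epsilon> B R fs act"

definition special_extension_pair ::
  "('k::field, 'v) module \<Rightarrow> 'x::wellorder set \<Rightarrow> ('x \<Rightarrow> 'v) \<Rightarrow> 'x set \<Rightarrow> ('x, 'k) ncpoly set \<Rightarrow>
   ('k, 'e) module \<Rightarrow> ('v \<Rightarrow> 'e) \<Rightarrow> ('e \<Rightarrow> ('x, 'k) ncpoly set) \<Rightarrow>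
   (('x, 'k) ncpoly \<Rightarrow> 'v) \<Rightarrow> (('x, 'k) ncpoly \<Rightarrow> 'v \<Rightarrow> 'v) \<Rightarrow> bool" where
  "special_extension_pair \<aa> A \<epsilon> B R \<ee> i \<pi> fs act \<longleftrightarrow>
     extension_pair \<aa> A \<epsilon> B R fs act \<and>
     equivalent_extensions \<aa> \<ee> i \<pi>
       (LieE \<aa> A \<epsilon> B R fs act) (LieE_incl \<aa> A \<epsilon> B R fs act) (LieE_proj A B R)"

definition Gamma ::
  "('k::field, 'v) module \<Rightarrow> 'x set \<Rightarrow> ('x \<Rightarrow> 'v) \<Rightarrow> 'x set \<Rightarrow> ('x \<Rightarrow> 'v) \<Rightarrow>
   ('x, 'k) ncpoly \<Rightarrow> ('x, 'k) ncpoly" where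
  "Gamma \<aa> A \<epsilon> B \<eta> =
     free_hom (\<lambda>x. if x \<in> B then letter x - as_letters \<aa> A \<epsilon> (\<eta> x) else letter x)"

end

theory Submission
  imports Defs
begin

text \<open>
  The whole proof takes place in the free associative algebra on \<open>A \<union> B\<close>.  The leading words of the
  relations \<open>LieR\<close> are \<open>aa'\<close> with \<open>a > a'\<close>, \<open>ba\<close>, and the leading words of \<open>R\<close>.  If every overlap of two of them
  resolves, the diamond lemma says that a nonzero element of the associative ideal, hence of the Lie
  ideal, has a leading word that contains one of these words (\<open>diamond_lemma\<close>, \<open>diamond_lemma_lead\<close>).  A
  linear combination of letters of \<open>A\<close> does not, so \<open>\<aa>\<close> embeds into \<open>LieE\<close>.  Since the relations also
  reduce every Lie polynomial in which a letter of \<open>A\<close> occurs to an element of \<open>\<aa>\<close>, and every element of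
  \<open>Id(R)\<close> likewise, the kernel of the projection to \<open>\<bb>\<close> is \<open>\<aa>\<close> and nothing more (\<open>LieE_extension\<close>).

  The overlaps resolve for one reason each (\<open>confluent_LR\<close>).  For \<open>aa'a''\<close> it is the Jacobi identity of
  \<open>\<aa>\<close>, for \<open>baa'\<close> it is that \<open>b\<close> acts by a derivation, for the leading word of some \<open>f \<in> R\<close> followed by \<open>a\<close> it
  is condition (a), and for two elements of \<open>R\<close> it is condition (b).  The last case needs the link
  between Lie and associative compositions: the special bracketing \<open>[apb]\<close> is \<open>apb\<close> plus terms \<open>upz\<close> in
  which \<open>p\<close> sits in smaller words (\<open>special_top\<close>).  This rests on the combinatorics of Lyndon-Shirshov
  words, which also guarantees that special bracketings exist, and on the fact that leading words of
  Lie polynomials are Lyndon-Shirshov words (\<open>Lie_lead_ALSW\<close>).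

  Conversely, an extension \<open>\<ee>\<close> receives a homomorphism \<open>\<sigma>\<close> from \<open>Lie(A \<union> B)\<close> that is the inclusion on \<open>A\<close> and
  any lift of the projection on \<open>B\<close>; it exists because \<open>Lie(A \<union> B)\<close> is free (\<open>free_lie_universal\<close>).  The action
  is \<open>b \<cdot> a = [\<sigma>(b) a]\<close> and the factor set is \<open>\<sigma>\<close> on \<open>R\<close>.  Both sides of (b) become the image of one
  and the same composition under \<open>\<sigma>\<close>, and the short five lemma identifies \<open>LieE\<close> with \<open>\<ee>\<close>.

  For the second statement the given extensions may be replaced by two algebras \<open>LieE\<close>.  An
  equivalence moves every \<open>b\<close> by an element \<open>- \<eta>(b)\<close> of \<open>\<aa>\<close>, so it is induced by \<open>\<Gamma> \<eta>\<close>; the two equations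
  express that \<open>\<Gamma> \<eta>\<close> maps the relations of the first algebra into the ideal of the second one
  (\<open>LieE_equivalent_iff\<close>).
\<close>

section \<open>Lyndon-Shirshov words\<close>

subsection \<open>The two orders on words\<close>

lemma lex_greater_Nil_left [simp]: "[] \<succ> v \<longleftrightarrow> v \<noteq> []"
  by (cases v) (auto simp: lex_greater_def)

lemma lex_greater_Nil_right [simp]: "\<not> u \<succ> []"
  by (simp add: lex_greater_def)

lemma lex_greater_Cons [simp]: "a # u \<succ> b # v \<longleftrightarrow> b < a \<or> a = b \<and> u \<succ> v"
  by (simp add: lex_greater_def)

lemma lex_greater_irrefl [simp]: "\<not> u \<succ> u"
  by (induction u) auto

lemma lex_greater_trans: "u \<succ> v \<Longrightarrow> v \<succ> w \<Longrightarrow> u \<succ> w"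
  unfolding lex_greater_def by (rule lexord_trans) (auto simp: trans_def)

lemma lex_greater_total: "u \<noteq> v \<Longrightarrow> u \<succ> v \<or> v \<succ> u"
  by (induction u arbitrary: v) (metis lex_greater_Nil_left, metis lex_greater_Cons lex_greater_Nil_left
      list.exhaust linorder_neqE)

lemma lex_greater_prefix: "v \<noteq> [] \<Longrightarrow> u \<succ> u @ v"
  by (induction u) auto

lemma lex_greater_append_cancel [simp]: "x @ u \<succ> x @ v \<longleftrightarrow> u \<succ> v"
  by (induction x) auto

text \<open>
  Unless \<open>u\<close> is a proper prefix of \<open>v\<close>, the words differ at some position, and then the comparison
  survives arbitrary continuations.
\<close>

lemma lex_greater_extend: "u \<succ> v \<Longrightarrow> length v \<le> length u \<Longrightarrow> u @ x \<succ> v @ y"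
  by (induction u arbitrary: v) (metis Nil_is_append_conv lex_greater_Nil_left le_zero_eq list.size(3) length_0_conv,
      case_tac v, auto)

lemma lex_greater_cases:
  assumes "u \<succ> v"
  obtains (prefix) z where "z \<noteq> []" "v = u @ z" | (differ) "\<And>x y. u @ x \<succ> v @ y"
proof -
  have "(\<exists>z. z \<noteq> [] \<and> v = u @ z) \<or> (\<forall>x y. u @ x \<succ> v @ y)"
    using assms
  proof (induction u arbitrary: v)
    case (Cons a u)
    then show ?case by (cases v) auto
  qed auto
  then show ?thesis using that by blast
qed

lemma lex_le_refl [simp]: "u \<preceq> u"
  by (simp add: lex_le_def)

lemma lex_le_iff: "u \<preceq> v \<longleftrightarrow> \<not> u \<succ> v"
  unfolding lex_le_def by (metis lex_greater_irrefl lex_greater_total lex_greater_trans)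

lemma lex_le_trans: "u \<preceq> v \<Longrightarrow> v \<preceq> w \<Longrightarrow> u \<preceq> w"
  unfolding lex_le_def using lex_greater_trans by blast

lemma less_imp_length_le: "(u :: 'x::wellorder list) < v \<Longrightarrow> length u \<le> length v"
  by (cases u; cases v) (auto simp: Cons_less_Cons)

lemma shorter_imp_less: "length u < length v \<Longrightarrow> (u :: 'x::wellorder list) < v"
  by (cases u; cases v) (auto simp: Cons_less_Cons)

lemma same_length_less_iff: "length u = length v \<Longrightarrow> (u :: 'x::wellorder list) < v \<longleftrightarrow> v \<succ> u"
  by (induction u v rule: list_induct2) (auto simp: Cons_less_Cons)

lemma less_append_left: "(u :: 'x::wellorder list) < v \<Longrightarrow> x @ u < x @ v"
  by (induction x) (auto simp: Cons_less_Cons dest: less_imp_length_le)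

lemma less_append_right:
  assumes "(u :: 'x::wellorder list) < v"
  shows "u @ y < v @ y"
proof (cases "length u = length v")
  case True
  then show ?thesis
    using assms lex_greater_extend[of v u y y] by (simp add: same_length_less_iff)
next
  case False
  then show ?thesis
    using less_imp_length_le[OF assms] by (intro shorter_imp_less) simp
qed

lemma sandwich_less: "(u :: 'x::wellorder list) < v \<Longrightarrow> x @ u @ y < x @ v @ y"
  by (intro less_append_left less_append_right)

lemma sandwich_le: "(u :: 'x::wellorder list) \<le> v \<Longrightarrow> x @ u @ y \<le> x @ v @ y"
  by (metis order_le_less sandwich_less)

lemma append_le_less: "(u :: 'x::wellorder list) \<le> u' \<Longrightarrow> v < v' \<Longrightarrow> u @ v < u' @ v'"
  by (metis less_append_left less_append_right order_le_less order_less_trans)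

lemma append_less_le: "(u :: 'x::wellorder list) < u' \<Longrightarrow> v \<le> v' \<Longrightarrow> u @ v < u' @ v'"
  by (metis less_append_left less_append_right order_le_less order_less_trans)

lemma append_le_le: "(u :: 'x::wellorder list) \<le> u' \<Longrightarrow> v \<le> v' \<Longrightarrow> u @ v \<le> u' @ v'"
  by (metis append_le_less append_less_le order_le_less)


subsection \<open>Closure properties and factorization\<close>

text \<open>
  A word beats all its rotations iff it beats all its proper suffixes: a proper suffix that is not
  smaller would be a border, and cancelling the border from two rotations yields contradictory
  comparisons.
\<close>

lemma alsw_iff_suffix:
  "alsw w \<longleftrightarrow> w \<noteq> [] \<and> (\<forall>u v. u \<noteq> [] \<and> v \<noteq> [] \<and> w = u @ v \<longrightarrow> w \<succ> v)"
proof (intro iffI conjI allI impI)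
  fix u v
  assume w: "alsw w" and uv: "u \<noteq> [] \<and> v \<noteq> [] \<and> w = u @ v"
  then have rot: "w \<succ> v @ u" by (auto simp: alsw_def)
  show "w \<succ> v"
  proof (rule ccontr)
    assume "\<not> w \<succ> v"
    with uv have "v \<succ> w" using lex_greater_total[of v w] by auto
    then show False
    proof (cases rule: lex_greater_cases)
      case (prefix x)
      with uv have len: "length x = length u" by (metis add_left_imp_eq add.commute length_append)
      have "x \<succ> u" using rot prefix by simp
      moreover have "u @ v \<succ> x @ v" using w prefix uv by (metis alsw_def)
      then have "u \<succ> x" using len lex_greater_extend[of x u v v] lex_greater_total[of u x]
        by (metis lex_greater_irrefl lex_greater_trans order_refl)
      ultimately show False using lex_greater_trans by fastforce
    next
      case differ
      then show False using rot lex_greater_trans[OF rot] by (metis append_Nil2 lex_greater_irrefl)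
    qed
  qed
next
  assume r: "w \<noteq> [] \<and> (\<forall>u v. u \<noteq> [] \<and> v \<noteq> [] \<and> w = u @ v \<longrightarrow> w \<succ> v)"
  show "alsw w"
    unfolding alsw_def
  proof (intro conjI allI impI)
    fix u v assume uv: "u \<noteq> [] \<and> v \<noteq> [] \<and> w = u @ v"
    then have "w \<succ> v" using r by blast
    then show "w \<succ> v @ u"
      using uv lex_greater_extend[of w v "[]" u] by simp
  qed (use r in blast)
qed (auto simp: alsw_def)

lemma alsw_nonempty: "alsw w \<Longrightarrow> w \<noteq> []"
  by (simp add: alsw_def)

lemma alsw_single [simp]: "alsw [x]"
  by (auto simp: alsw_def Cons_eq_append_conv)

lemma alsw_suffix: "alsw (u @ v) \<Longrightarrow> u \<noteq> [] \<Longrightarrow> v \<noteq> [] \<Longrightarrow> u @ v \<succ> v"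
  using alsw_iff_suffix by blast

lemma alsw_suffix_extend: "alsw (u @ v) \<Longrightarrow> u \<noteq> [] \<Longrightarrow> v \<noteq> [] \<Longrightarrow> (u @ v) @ x \<succ> v @ y"
  using lex_greater_extend[OF alsw_suffix] by simp

text \<open>
  The suffix \<open>v\<close> of \<open>uv\<close> is the one that needs \<open>u \<succ> v\<close>, and the shorter suffixes are below \<open>v\<close>.  If \<open>u\<close> is not
  a prefix of \<open>v\<close>, the words differ early and \<open>uv \<succ> v\<close> is immediate.  If \<open>v = uz\<close>, then
  \<open>v \<succ> z\<close> gives \<open>uv \<succ> uz\<close>.
\<close>

lemma alsw_append:
  assumes "alsw u" "alsw v" "u \<succ> v"
  shows "alsw (u @ v)"
  unfolding alsw_iff_suffix
proof (intro conjI allI impI)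
  have uv: "u @ v \<succ> v"
    using \<open>u \<succ> v\<close>
  proof (cases rule: lex_greater_cases)
    case (prefix z)
    then show ?thesis
      using alsw_suffix[of u z] assms(1,2) alsw_nonempty by auto
  next
    case differ
    then show ?thesis by (metis append_Nil2)
  qed
  fix x y
  assume xy: "x \<noteq> [] \<and> y \<noteq> [] \<and> u @ v = x @ y"
  then consider (left) z where "x = u @ z" "v = z @ y" | (right) z where "u = x @ z" "y = z @ v" "z \<noteq> []"
    by (metis append_eq_append_conv2 append_Nil2 self_append_conv2)
  then show "u @ v \<succ> y"
  proof cases
    case left
    then show ?thesis using uv alsw_suffix[of z y] assms(2) xy lex_greater_trans by (cases "z = []") auto
  next
    case right
    then show ?thesis using alsw_suffix_extend[of x z v v] assms(1) xy by auto
  qed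
qed (use assms alsw_nonempty in auto)

text \<open>
  A suffix of \<open>xyz\<close> that starts inside \<open>x\<close> loses against \<open>xy\<close> already before \<open>z\<close> is reached; one that starts
  later is a suffix of \<open>yz\<close>, which itself is such a suffix.
\<close>

lemma alsw_overlap:
  assumes xy: "alsw (x @ y)" and yz: "alsw (y @ z)" and "y \<noteq> []"
  shows "alsw (x @ y @ z)"
proof (cases "x = []")
  case False
  have top: "x @ y @ z \<succ> y @ z"
    using alsw_suffix_extend[OF xy False \<open>y \<noteq> []\<close>, of z z] by simp
  show ?thesis
    unfolding alsw_iff_suffix
  proof (intro conjI allI impI)
    fix u v
    assume uv: "u \<noteq> [] \<and> v \<noteq> [] \<and> x @ y @ z = u @ v"
    then consider (inner) s where "x = u @ s" "v = s @ y @ z" | (outer) s where "u = x @ s" "y @ z = s @ v"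
      by (auto simp: append_eq_append_conv2)
    then show "x @ y @ z \<succ> v"
    proof cases
      case inner
      then show ?thesis
        using alsw_suffix_extend[of u "s @ y" z z] xy uv \<open>y \<noteq> []\<close> by simp
    next
      case outer
      then show ?thesis
        using alsw_suffix[of s v] yz uv top lex_greater_trans by (cases "s = []") auto
    qed
  qed (use \<open>y \<noteq> []\<close> in auto)
qed (use yz in simp)

definition sorted_alsws :: "'x::wellorder list list \<Rightarrow> bool" where
  "sorted_alsws cs \<longleftrightarrow> (\<forall>u\<in>set cs. alsw u) \<and> sorted_wrt (\<preceq>) cs"

text \<open>
  A new factor that violates the order is merged with its neighbour.
\<close>

lemma sorted_alsws_prepend:
  "alsw u \<Longrightarrow> sorted_alsws cs \<Longrightarrow> \<exists>ds. sorted_alsws ds \<and> concat ds = u @ concat cs"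
proof (induction cs arbitrary: u)
  case Nil
  then show ?case by (intro exI[of _ "[u]"]) (auto simp: sorted_alsws_def)
next
  case (Cons c cs)
  show ?case
  proof (cases "u \<preceq> c")
    case True
    then show ?thesis using Cons.prems lex_le_trans
      by (intro exI[of _ "u # c # cs"]) (fastforce simp: sorted_alsws_def)
  next
    case False
    then have "alsw (u @ c)" using Cons.prems by (auto simp: lex_le_iff sorted_alsws_def intro: alsw_append)
    with Cons.IH[of "u @ c"] Cons.prems show ?thesis by (auto simp: sorted_alsws_def)
  qed
qed

lemma sorted_alsws_exist: "\<exists>cs. sorted_alsws cs \<and> concat cs = w"
proof (induction w)
  case Nil
  then show ?case by (intro exI[of _ "[]"]) (simp add: sorted_alsws_def)
next
  case (Cons x w)
  then show ?case using sorted_alsws_prepend[of "[x]"] by fastforce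
qed

text \<open>
  With two or more factors, the first factor would beat the whole word, being a prefix, and the whole
  word would beat the last factor, being a suffix, against the order of the factors.
\<close>

lemma sorted_alsws_single:
  assumes "sorted_alsws cs" "alsw (concat cs)"
  shows "cs = [concat cs]"
proof -
  obtain c ds where cs: "cs = c # ds" using assms alsw_nonempty by (cases cs) auto
  have "ds = []"
  proof (rule ccontr)
    assume "ds \<noteq> []"
    then obtain es d where ds: "ds = es @ [d]" by (metis rev_exhaust)
    have ne: "c \<noteq> []" "d \<noteq> []" using assms(1) alsw_nonempty by (auto simp: sorted_alsws_def cs ds)
    then have "concat cs \<succ> d" using alsw_suffix[of "c @ concat es" d] assms(2) by (auto simp: cs ds)
    moreover have "c \<succ> concat cs" using lex_greater_prefix[of "concat es @ d" c] ne by (simp add: cs ds)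
    moreover have "c \<preceq> d" using assms(1) by (auto simp: sorted_alsws_def cs ds)
    ultimately show False using lex_greater_trans lex_le_iff by blast
  qed
  then show ?thesis by (simp add: cs)
qed


subsection \<open>The bracketing of a Lyndon-Shirshov word\<close>

lemma word_nonempty [simp]: "word t \<noteq> []"
  by (induction t) auto

lemma nlsw_alsw: "nlsw t \<Longrightarrow> alsw (word t)"
  by (cases t) auto

text \<open>
  If \<open>x (word t)\<close> were a Lyndon-Shirshov word, the last factor of \<open>x\<close> would be a suffix of \<open>s\<close>, hence by induction at most its
  right factor and so at most \<open>word t\<close>; the factors of \<open>x\<close> followed by \<open>word t\<close> would be nondecreasing.
  Hence the right factor of a bracketing is the longest proper Lyndon-Shirshov suffix.
\<close>

lemma nlsw_longest_suffix:
  "nlsw (Bracket s t) \<Longrightarrow> word s = y @ x \<Longrightarrow> y \<noteq> [] \<Longrightarrow> x \<noteq> [] \<Longrightarrow> \<not> alsw (x @ word t)"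
proof (induction s arbitrary: t y x)
  case (Single a)
  then show ?case by (auto simp: Cons_eq_append_conv)
next
  case (Bracket s1 s2)
  show ?case
  proof
    assume xt: "alsw (x @ word t)"
    obtain cs where cs: "sorted_alsws cs" "concat cs = x" using sorted_alsws_exist by blast
    then have "cs \<noteq> []" using Bracket.prems by auto
    then obtain ds d where ds: "cs = ds @ [d]" by (metis rev_exhaust)
    have d: "alsw d" using cs by (auto simp: sorted_alsws_def ds)
    have s: "word s1 @ word s2 = (y @ concat ds) @ d" using Bracket.prems cs by (simp add: ds)
    have "\<exists>z. word s2 = z @ d"
    proof (rule ccontr)
      assume no: "\<nexists>z. word s2 = z @ d"
      then obtain z where z: "word s1 = (y @ concat ds) @ z" "d = z @ word s2"
        using s by (metis append_eq_append_conv2)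
      then have "z \<noteq> []" using no by (metis append_Nil)
      then show False using Bracket.IH(1)[of s2 "y @ concat ds" z] Bracket.prems z d by auto
    qed
    then obtain z where "word s2 = z @ d" by blast
    then have "d \<preceq> word s2"
      using alsw_suffix[of z d] nlsw_alsw[of s2] Bracket.prems alsw_nonempty[OF d]
      by (cases "z = []") (auto simp: lex_le_def)
    then have dt: "d \<preceq> word t" using Bracket.prems lex_le_trans by auto
    have "sorted_alsws (cs @ [word t])"
      using cs(1) dt nlsw_alsw[of t] Bracket.prems
      by (auto simp: sorted_alsws_def ds sorted_wrt_append intro: lex_le_trans)
    with sorted_alsws_single[OF this] xt cs \<open>cs \<noteq> []\<close> show False by auto
  qed
qed

lemma nlsw_unique: "nlsw s \<Longrightarrow> nlsw t \<Longrightarrow> word s = word t \<Longrightarrow> s = t"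
proof (induction s arbitrary: t)
  case (Single a)
  then show ?case by (cases t) (auto simp: Cons_eq_append_conv)
next
  case (Bracket s1 s2)
  then obtain t1 t2 where t: "t = Bracket t1 t2"
    by (cases t) (auto simp: append_eq_Cons_conv)
  have eq: "word s1 @ word s2 = word t1 @ word t2" using Bracket.prems t by simp
  have False if "word s1 = word t1 @ x" "x @ word s2 = word t2" "x \<noteq> []" for x
    using nlsw_longest_suffix[of s1 s2 "word t1" x] that Bracket.prems nlsw_alsw[of t2] t by auto
  moreover have False if "word t1 = word s1 @ x" "x @ word t2 = word s2" "x \<noteq> []" for x
    using nlsw_longest_suffix[of t1 t2 "word s1" x] that Bracket.prems nlsw_alsw[of s2] t by auto
  moreover obtain x where "word s1 = word t1 @ x \<and> x @ word s2 = word t2 \<or>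
      word t1 = word s1 @ x \<and> x @ word t2 = word s2"
    using eq unfolding append_eq_append_conv2 by metis
  ultimately have "word s1 = word t1" "word s2 = word t2"
    by (cases "x = []"; auto)+
  then show ?case using Bracket t by auto
qed

text \<open>
  Split off the longest proper Lyndon-Shirshov suffix \<open>v\<close>.  By maximality none of the factors of the
  remaining prefix \<open>u\<close> can be merged with \<open>v\<close>, so \<open>u\<close> is a single Lyndon-Shirshov word, and for the same
  reason its bracketing satisfies the last condition on bracketings with respect to \<open>v\<close>.
\<close>

lemma nlsw_exists: "alsw w \<Longrightarrow> \<exists>t. nlsw t \<and> word t = w"
proof (induction "length w" arbitrary: w rule: less_induct)
  case less
  show ?case
  proof (cases "length w \<le> 1")
    case True
    then obtain x where "w = [x]" using alsw_nonempty[OF less.prems]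
      by (cases w) auto
    then show ?thesis by (intro exI[of _ "Single x"]) auto
  next
    case False
    define P where "P u \<longleftrightarrow> (\<exists>v. u \<noteq> [] \<and> w = u @ v \<and> alsw v)" for u
    have "w = butlast w @ [last w]" "butlast w \<noteq> []"
      using False by (cases w; simp)+
    then have "P (butlast w)" unfolding P_def using alsw_single by blast
    then obtain u where "P u" and least: "\<And>x. length x < length u \<Longrightarrow> \<not> P x"
      using exists_least_iff[of "\<lambda>n. \<exists>u. length u = n \<and> P u"] by blast
    then obtain v where u: "u \<noteq> []" "w = u @ v" and v: "alsw v" unfolding P_def by blast
    have long: "\<not> alsw (y @ v)" if "u = x @ y" "x \<noteq> []" "y \<noteq> []" for x y
      using least[of x] that u(2) by (auto simp: P_def)
    \<comment> \<open>The last factor of \<open>u\<close> is not above \<open>v\<close>, so the factors of \<open>u\<close> and \<open>v\<close> are in order.\<close>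
    obtain cs where cs: "sorted_alsws cs" "concat cs = u" using sorted_alsws_exist by blast
    then obtain ds d where ds: "cs = ds @ [d]" using u by (metis concat.simps(1) rev_exhaust)
    have d: "alsw d" using cs by (auto simp: sorted_alsws_def ds)
    have "ds = []"
    proof (rule ccontr)
      assume "ds \<noteq> []"
      then have ne: "concat ds \<noteq> []" using cs(1) alsw_nonempty by (cases ds) (auto simp: sorted_alsws_def ds)
      have dv: "d \<preceq> v"
        using long[of "concat ds" d] cs(2) ne d v alsw_nonempty[OF d] alsw_append by (auto simp: ds lex_le_iff)
      have "sorted_alsws (cs @ [v])"
        using cs(1) dv v by (auto simp: sorted_alsws_def ds sorted_wrt_append intro: lex_le_trans)
      from sorted_alsws_single[OF this] less.prems u(2) cs(2) ds show False by auto
    qed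
    then have "alsw u" using cs ds d by auto
    then obtain s t where st: "nlsw s" "word s = u" "nlsw t" "word t = v"
      using less.hyps u v alsw_nonempty[OF v] by (metis length_append less_add_same_cancel1 less_add_same_cancel2 length_greater_0_conv)
    have "nlsw (Bracket s t)"
    proof (cases s)
      case (Bracket s1 s2)
      have "\<not> alsw (word s2 @ v)" using long[of "word s1" "word s2"] st Bracket by auto
      then have "word s2 \<preceq> word t" using alsw_append[of "word s2" v] st v nlsw_alsw Bracket by (auto simp: lex_le_iff)
      then show ?thesis using st less.prems u Bracket by auto
    qed (use st less.prems u in auto)
    then show ?thesis using st u by (intro exI[of _ "Bracket s t"]) auto
  qed
qed

lemma bracketing: "alsw w \<Longrightarrow> nlsw (bracketing w) \<and> word (bracketing w) = w"
  unfolding bracketing_def by (rule theI') (metis nlsw_exists nlsw_unique)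

lemma bracketing_word: "nlsw t \<Longrightarrow> bracketing (word t) = t"
  using bracketing nlsw_alsw nlsw_unique by blast


subsection \<open>Special bracketings\<close>

text \<open>
  An occurrence of a Lyndon-Shirshov word \<open>v\<close> cannot straddle the two factors of a bracketing unless
  it starts at the left end: overlapping with the right factor it would produce a longer proper
  Lyndon-Shirshov suffix.
\<close>

lemma nlsw_subword:
  assumes "nlsw t" "word t = a @ v @ b" "alsw v"
  shows "\<exists>C c d. b = c @ d \<and> alsw (v @ c) \<and> t = fill C (bracketing (v @ c)) \<and> left_word C = a \<and> right_word C = d"
  using assms
proof (induction t arbitrary: a b)
  case (Single x)
  then have "a = []" "b = []" "v = [x]" using alsw_nonempty[of v] by (auto simp: Cons_eq_append_conv)
  then show ?case using bracketing_word[of "Single x"] by (intro exI[of _ Hole] exI[of _ "[]"]) auto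
next
  case (Bracket s t)
  have v: "v \<noteq> []" using Bracket.prems alsw_nonempty by blast
  show ?case
  proof (cases "a = []")
    case True
    then show ?thesis using Bracket.prems bracketing_word[of "Bracket s t"] nlsw_alsw[of "Bracket s t"]
      by (intro exI[of _ Hole] exI[of _ b] exI[of _ "[]"]) auto
  next
    case a: False
    have eq: "word s @ word t = a @ v @ b" using Bracket.prems by simp
    then consider (right) z where "a = word s @ z" "word t = z @ v @ b"
      | (left) z where "word s = a @ v @ z" "b = z @ word t"
      | (straddle) x y where "word s = a @ x" "v = x @ y" "word t = y @ b" "x \<noteq> []" "y \<noteq> []"
    proof -
      from eq consider z where "word s = a @ z" "z @ word t = v @ b" | z where "a = word s @ z" "word t = z @ v @ b"
        by (auto simp: append_eq_append_conv2)
      then show ?thesis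
      proof cases
        case (1 z)
        then consider y where "z = v @ y" "y @ word t = b" | y where "v = z @ y" "word t = y @ b"
          by (auto simp: append_eq_append_conv2)
        then show ?thesis
        proof cases
          case (1 y)
          then show ?thesis using \<open>word s = a @ z\<close> left[of y] by simp
        next
          case (2 y)
          then show ?thesis
            using \<open>word s = a @ z\<close> right[of "[]"] straddle[of z y] left[of "[]"] by (cases "z = []"; cases "y = []") auto
        qed
      qed (use right in blast)
    qed
    then show ?thesis
    proof cases
      case (right z)
      then obtain C c d where "b = c @ d" "alsw (v @ c)" "t = fill C (bracketing (v @ c))" "left_word C = z" "right_word C = d"
        using Bracket.IH(2)[of z b] Bracket.prems by auto
      then show ?thesis using right by (intro exI[of _ "HoleR s C"] exI[of _ c] exI[of _ d]) auto
    next
      case (left z)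
      then obtain C c d where "z = c @ d" "alsw (v @ c)" "s = fill C (bracketing (v @ c))" "left_word C = a" "right_word C = d"
        using Bracket.IH(1)[of a z] Bracket.prems by auto
      then show ?thesis using left by (intro exI[of _ "HoleL C t"] exI[of _ c] exI[of _ "d @ word t"]) auto
    next
      case (straddle x y)
      then have "alsw (x @ word t)"
        using alsw_overlap[of x y b] Bracket.prems nlsw_alsw[of t] by auto
      then show ?thesis using nlsw_longest_suffix[of s t a x] straddle a Bracket.prems by auto
    qed
  qed
qed

definition alsw_chain :: "'x::wellorder list list \<Rightarrow> 'x nactx" where
  "alsw_chain cs = foldl (\<lambda>E u. HoleL E (bracketing u)) Hole cs"

text \<open>
  The choice in the definition of \<^const>\<open>special_ctx\<close> is not vacuous.
\<close>

lemma special_ctx_decompose: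
  assumes "alsw (a @ v @ b)" "alsw v"
  obtains C c d cs where "b = c @ d" "alsw (v @ c)" "bracketing (a @ v @ b) = fill C (bracketing (v @ c))"
    "left_word C = a" "right_word C = d" "c = concat cs" "sorted_alsws cs"
    "special_ctx a v b = ctx_comp C (alsw_chain cs)"
proof -
  obtain C c d where 1: "b = c @ d" "alsw (v @ c)" "bracketing (a @ v @ b) = fill C (bracketing (v @ c))"
    "left_word C = a" "right_word C = d"
    using nlsw_subword[of "bracketing (a @ v @ b)" a v b] bracketing[of "a @ v @ b"] assms by auto
  obtain cs where cs: "sorted_alsws cs" "concat cs = c" using sorted_alsws_exist by blast
  have "\<exists>C c d cs. b = c @ d \<and> alsw (v @ c) \<and> bracketing (a @ v @ b) = fill C (bracketing (v @ c)) \<and>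
     left_word C = a \<and> right_word C = d \<and> c = concat cs \<and> (\<forall>u\<in>set cs. alsw u) \<and> sorted_wrt (\<preceq>) cs \<and>
     special_ctx a v b = ctx_comp C (foldl (\<lambda>E u. HoleL E (bracketing u)) Hole cs)"
    unfolding special_ctx_def by (rule someI_ex) (use 1 cs in \<open>unfold sorted_alsws_def, blast\<close>)
  then show ?thesis using that unfolding sorted_alsws_def alsw_chain_def by blast
qed

section \<open>The diamond lemma for the free associative algebra\<close>

subsection \<open>Monomials and leading words\<close>

definition mon :: "'x list \<Rightarrow> ('x, 'k::field) ncpoly" where
  "mon w = Poly_Mapping.single w 1"

lemma mon_mult: "mon u * mon v = mon (u @ v)"
  by (simp add: mon_def mult_single plus_list_def)

lemma mon_Nil [simp]: "mon [] = 1"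
  using single_one[where ?'a = "'a list"] by (simp add: mon_def zero_list_def)

lemma letter_mon: "letter x = mon [x]"
  by (simp add: letter_def mon_def)

lemma mon_mult_left: "mon u * (mon v * p) = mon (u @ v) * p"
  by (simp add: mon_mult mult.assoc[symmetric])

lemma lookup_mon: "Poly_Mapping.lookup (mon w) k = (if k = w then 1 else 0)"
  by (simp add: mon_def lookup_single when_def)

lemma keys_mon [simp]: "Poly_Mapping.keys (mon w :: ('x, 'k::field) ncpoly) = {w}"
  by (simp add: mon_def)

lemma lookup_pscale [simp]: "Poly_Mapping.lookup (pscale \<alpha> p) w = \<alpha> * Poly_Mapping.lookup p w"
  unfolding pscale_def zero_list_def[symmetric] mult_map_scale_conv_mult[symmetric]
  by (simp add: Poly_Mapping.map.rep_eq when_def)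

lemma ncpoly_eq_sum: "p = (\<Sum>w\<in>Poly_Mapping.keys p. pscale (Poly_Mapping.lookup p w) (mon w))"
  by (rule poly_mapping_eqI)
    (simp add: lookup_sum lookup_mon if_distrib in_keys_iff cong: if_cong)

lemma pscale_mult_left: "pscale \<alpha> p * q = pscale \<alpha> (p * q)"
  by (simp add: pscale_def mult.assoc)

lemma pscale_mult_right: "p * pscale \<alpha> q = pscale \<alpha> (p * q)"
proof -
  have "p * Poly_Mapping.single [] \<alpha> = Poly_Mapping.single [] \<alpha> * p"
    by (subst (1 2) ncpoly_eq_sum[of p])
      (simp add: sum_distrib_left sum_distrib_right pscale_def mon_def mult_single plus_list_def mult.commute)
  then show ?thesis by (simp add: pscale_def mult.assoc[symmetric])
qed

lemma span_map:
  assumes "p \<in> ncpoly.span G" "\<And>g. g \<in> G \<Longrightarrow> f g \<in> ncpoly.span H"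
    and "\<And>p q. f (p + q) = f p + f q" "\<And>\<alpha> p. f (pscale \<alpha> p) = pscale \<alpha> (f p)"
  shows "f p \<in> ncpoly.span H"
  using assms(1)
proof (induction rule: ncpoly.span_induct_alt)
  case base
  have "f 0 = 0" using assms(3)[of 0 0] by simp
  then show ?case by (simp add: ncpoly.span_zero)
qed (simp add: assms ncpoly.span_add ncpoly.span_scale)

definition below :: "'x::wellorder list \<Rightarrow> ('x, 'k::field) ncpoly set" where
  "below w = {p. \<forall>k\<in>Poly_Mapping.keys p. k < w}"

lemma below_iff: "p \<in> below w \<longleftrightarrow> (\<forall>k. w \<le> k \<longrightarrow> Poly_Mapping.lookup p k = 0)"
  unfolding below_def mem_Collect_eq by (metis in_keys_iff not_less)

lemma below_zero [simp]: "0 \<in> below w"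
  by (simp add: below_iff)

lemma below_add: "p \<in> below w \<Longrightarrow> q \<in> below w \<Longrightarrow> p + q \<in> below w"
  by (simp add: below_iff lookup_add)

lemma below_minus: "p \<in> below w \<Longrightarrow> - p \<in> below w"
  by (simp add: below_iff)

lemma below_diff: "p \<in> below w \<Longrightarrow> q \<in> below w \<Longrightarrow> p - q \<in> below w"
  by (simp add: below_iff lookup_minus)

lemma below_pscale: "p \<in> below w \<Longrightarrow> pscale \<alpha> p \<in> below w"
  by (simp add: below_iff)

lemma below_mono: "p \<in> below v \<Longrightarrow> v \<le> w \<Longrightarrow> p \<in> below w"
  by (force simp: below_def)

lemma below_span: "p \<in> ncpoly.span G \<Longrightarrow> G \<subseteq> below w \<Longrightarrow> p \<in> below w"
  by (induction rule: ncpoly.span_induct_alt) (auto intro: below_add below_pscale)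

lemma below_mon [simp]: "mon u \<in> below w \<longleftrightarrow> u < w"
  by (simp add: below_def)

lemma below_mult_keys:
  assumes "\<And>j k. j \<in> Poly_Mapping.keys p \<Longrightarrow> k \<in> Poly_Mapping.keys q \<Longrightarrow> j @ k < w"
  shows "p * q \<in> below w"
  using keys_mult[of p q] assms by (force simp: below_def plus_list_def)

definition monic_at :: "'x::wellorder list \<Rightarrow> ('x, 'k::field) ncpoly \<Rightarrow> bool" where
  "monic_at w p \<longleftrightarrow> p - mon w \<in> below w"

lemma monic_at_iff: "monic_at w p \<longleftrightarrow> Poly_Mapping.lookup p w = 1 \<and> (\<forall>k. w < k \<longrightarrow> Poly_Mapping.lookup p k = 0)"
  unfolding monic_at_def below_iff
  by (auto simp: lookup_minus lookup_mon order_le_less split: if_splits)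

lemma monic_at_keys: "monic_at w p \<Longrightarrow> k \<in> Poly_Mapping.keys p \<Longrightarrow> k \<le> w"
  by (auto simp: monic_at_iff in_keys_iff not_less[symmetric])

lemma monic_at_lead: "monic_at w p \<Longrightarrow> lead p = w"
  unfolding lead_def by (rule Max_eqI) (auto intro: monic_at_keys simp: monic_at_iff in_keys_iff)

lemma monic_monic_at: "monic p \<Longrightarrow> monic_at (lead p) p"
  unfolding monic_def monic_at_iff
  by (metis Max_ge finite_keys in_keys_iff lead_def not_less)

lemma monic_at_mult:
  assumes "monic_at u p" "monic_at v q"
  shows "monic_at (u @ v) (p * q)"
proof -
  have "p * q - mon (u @ v) = (p - mon u) * q + mon u * (q - mon v)"
    by (simp add: algebra_simps mon_mult)
  moreover have "(p - mon u) * q \<in> below (u @ v)"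
    using assms by (intro below_mult_keys append_less_le) (auto simp: monic_at_def[of u] below_def intro: monic_at_keys)
  moreover have "mon u * (q - mon v) \<in> below (u @ v)"
    using assms by (intro below_mult_keys append_le_less) (auto simp: monic_at_def below_def)
  ultimately show ?thesis by (simp add: monic_at_def below_add)
qed

lemma monic_at_mon [simp]: "monic_at w (mon w)"
  by (simp add: monic_at_def)

lemma monic_at_add: "monic_at w p \<Longrightarrow> q \<in> below w \<Longrightarrow> monic_at w (p + q)"
  unfolding monic_at_def using below_add by (fastforce simp: algebra_simps)

lemma monic_at_diff: "monic_at w p \<Longrightarrow> q \<in> below w \<Longrightarrow> monic_at w (p - q)"
  using monic_at_add[of w p "- q"] below_minus[of q w] by simp

lemma monic_at_below: "monic_at w p \<Longrightarrow> w < v \<Longrightarrow> p \<in> below v"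
  by (force simp: below_def dest: monic_at_keys)

lemma nonzero_lead: "p \<noteq> 0 \<Longrightarrow> lead p \<in> Poly_Mapping.keys p"
  unfolding lead_def by (intro Max_in) auto

lemma lead_less_below: "lead p < w \<Longrightarrow> p \<in> below w"
  unfolding below_def lead_def using Max_ge[OF finite_keys[of p]] order_le_less_trans by blast


subsection \<open>Ideals filtered by leading words\<close>

text \<open>
  Terms \<open>apb\<close> with a fixed polynomial \<open>p\<close>, measured as if \<open>p\<close> had the leading word \<open>v\<close>.  The same bounds can
  thus be used for a relation and for a smaller polynomial that is put in its place.
\<close>

definition hole_span :: "'x::wellorder list \<Rightarrow> 'x list \<Rightarrow> ('x, 'k::field) ncpoly \<Rightarrow> ('x, 'k) ncpoly set" where
  "hole_span v w p = ncpoly.span {mon a * p * mon b | a b. a @ v @ b < w}"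

definition ideal_gens :: "('x::wellorder, 'k::field) ncpoly set \<Rightarrow> ('x list \<Rightarrow> bool) \<Rightarrow> ('x, 'k) ncpoly set" where
  "ideal_gens S P = {mon a * s * mon b | a s b. s \<in> S \<and> P (a @ lead s @ b)}"

lemma ideal_gensI: "s \<in> S \<Longrightarrow> P (a @ lead s @ b) \<Longrightarrow> mon a * s * mon b \<in> ideal_gens S P"
  unfolding ideal_gens_def by blast

lemma ideal_gensE:
  assumes "g \<in> ideal_gens S P"
  obtains a s b where "g = mon a * s * mon b" "s \<in> S" "P (a @ lead s @ b)"
  using assms unfolding ideal_gens_def by blast

lemma ideal_gens_mono: "S \<subseteq> S' \<Longrightarrow> (\<And>v. P v \<Longrightarrow> P' v) \<Longrightarrow> ideal_gens S P \<subseteq> ideal_gens S' P'"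
  unfolding ideal_gens_def by blast

definition ideal_below :: "('x::wellorder, 'k::field) ncpoly set \<Rightarrow> 'x list \<Rightarrow> ('x, 'k) ncpoly set" where
  "ideal_below S w = ncpoly.span (ideal_gens S (\<lambda>v. v < w))"

definition assoc_ideal :: "('x::wellorder, 'k::field) ncpoly set \<Rightarrow> ('x, 'k) ncpoly set" where
  "assoc_ideal S = ncpoly.span (ideal_gens S (\<lambda>_. True))"

lemma mult_expand:
  "q * p * r = (\<Sum>j\<in>Poly_Mapping.keys q. \<Sum>k\<in>Poly_Mapping.keys r.
    pscale (Poly_Mapping.lookup q j) (pscale (Poly_Mapping.lookup r k) (mon j * p * mon k)))"
proof -
  have "q * p * r = (\<Sum>j\<in>Poly_Mapping.keys q. pscale (Poly_Mapping.lookup q j) (mon j)) * p *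
      (\<Sum>k\<in>Poly_Mapping.keys r. pscale (Poly_Mapping.lookup r k) (mon k))"
    by (simp add: ncpoly_eq_sum[symmetric])
  also have "\<dots> = (\<Sum>j\<in>Poly_Mapping.keys q. \<Sum>k\<in>Poly_Mapping.keys r.
      pscale (Poly_Mapping.lookup q j) (mon j) * p * pscale (Poly_Mapping.lookup r k) (mon k))"
    by (simp only: sum_distrib_left sum_distrib_right) (rule sum.swap)
  finally show ?thesis by (simp add: pscale_mult_left pscale_mult_right mult.commute)
qed

lemma hole_span_mult:
  assumes "\<And>j k. j \<in> Poly_Mapping.keys q \<Longrightarrow> k \<in> Poly_Mapping.keys r \<Longrightarrow> j @ v @ k < w"
  shows "q * p * r \<in> hole_span v w p"
proof -
  have "q * p * r = (\<Sum>j\<in>Poly_Mapping.keys q. \<Sum>k\<in>Poly_Mapping.keys r.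
      pscale (Poly_Mapping.lookup q j) (pscale (Poly_Mapping.lookup r k) (mon j * p * mon k)))"
    by (rule mult_expand)
  also have "\<dots> \<in> hole_span v w p"
    unfolding hole_span_def
    by (intro ncpoly.span_sum ncpoly.span_scale ncpoly.span_base) (use assms in blast)
  finally show ?thesis .
qed

lemma hole_span_closed:
  "0 \<in> hole_span v w p"
  "x \<in> hole_span v w p \<Longrightarrow> y \<in> hole_span v w p \<Longrightarrow> x + y \<in> hole_span v w p"
  "x \<in> hole_span v w p \<Longrightarrow> y \<in> hole_span v w p \<Longrightarrow> x - y \<in> hole_span v w p"
  unfolding hole_span_def by (auto intro: ncpoly.span_zero ncpoly.span_add ncpoly.span_diff)

lemma hole_span_context:
  assumes "x \<in> hole_span v w p" and "\<And>j k. j \<in> Poly_Mapping.keys q \<Longrightarrow> k \<in> Poly_Mapping.keys r \<Longrightarrow> j @ w @ k \<le> w'"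
  shows "q * x * r \<in> hole_span v w' p"
  unfolding hole_span_def
proof (rule span_map[OF assms(1)[unfolded hole_span_def]])
  fix g assume "g \<in> {mon a * p * mon b | a b. a @ v @ b < w}"
  then obtain a b where g: "g = mon a * p * mon b" and ab: "a @ v @ b < w" by blast
  have "(q * mon a) * p * (mon b * r) \<in> hole_span v w' p"
  proof (rule hole_span_mult)
    fix j k assume "j \<in> Poly_Mapping.keys (q * mon a)" "k \<in> Poly_Mapping.keys (mon b * r)"
    then obtain j' k' where "j' \<in> Poly_Mapping.keys q" "j = j' @ a" "k' \<in> Poly_Mapping.keys r" "k = b @ k'"
      using keys_mult[of q "mon a"] keys_mult[of "mon b" r] by (fastforce simp: plus_list_def)
    then show "j @ v @ k < w'"
      using sandwich_less[OF ab, of j' k'] assms(2)[of j' k'] by auto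
  qed
  then show "q * g * r \<in> ncpoly.span {mon a * p * mon b |a b. a @ v @ b < w'}"
    by (simp add: g hole_span_def mult.assoc)
qed (simp_all add: algebra_simps pscale_mult_left pscale_mult_right)

lemma hole_span_mono: "w \<le> w' \<Longrightarrow> hole_span v w p \<subseteq> hole_span v w' p"
  unfolding hole_span_def by (rule ncpoly.span_mono) (blast intro: order_less_le_trans)

lemma hole_span_below:
  assumes "x \<in> hole_span v w p" "\<And>k. k \<in> Poly_Mapping.keys p \<Longrightarrow> k \<le> v"
  shows "x \<in> below w"
proof (rule below_span[OF assms(1)[unfolded hole_span_def]], clarify)
  fix a b assume ab: "a @ v @ b < w"
  have "mon a * p * mon b = mon a * (p * mon b)" by (simp add: mult.assoc)
  also have "\<dots> \<in> below w"
  proof (rule below_mult_keys)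
    fix j k assume "j \<in> Poly_Mapping.keys (mon a :: ('a, 'b) ncpoly)" "k \<in> Poly_Mapping.keys (p * mon b)"
    then obtain k' where "k' \<in> Poly_Mapping.keys p" "j = a" "k = k' @ b"
      using keys_mult[of p "mon b"] by (auto simp: plus_list_def)
    then show "j @ k < w" using sandwich_le[OF assms(2)[of k'], of a b] ab by auto
  qed
  finally show "mon a * p * mon b \<in> below w" .
qed

lemma hole_span_ideal: "s \<in> S \<Longrightarrow> hole_span (lead s) w s \<subseteq> ideal_below S w"
  unfolding hole_span_def ideal_below_def ideal_gens_def by (rule ncpoly.span_mono) auto

lemma ideal_below_mult:
  assumes "s \<in> S" "\<And>j k. j \<in> Poly_Mapping.keys q \<Longrightarrow> k \<in> Poly_Mapping.keys r \<Longrightarrow> j @ lead s @ k < w"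
  shows "q * s * r \<in> ideal_below S w"
  using hole_span_mult[OF assms(2)] hole_span_ideal[OF assms(1)] by blast

lemma ideal_below_closed:
  "0 \<in> ideal_below S w"
  "x \<in> ideal_below S w \<Longrightarrow> y \<in> ideal_below S w \<Longrightarrow> x + y \<in> ideal_below S w"
  "x \<in> ideal_below S w \<Longrightarrow> y \<in> ideal_below S w \<Longrightarrow> x - y \<in> ideal_below S w"
  "x \<in> ideal_below S w \<Longrightarrow> - x \<in> ideal_below S w"
  "x \<in> ideal_below S w \<Longrightarrow> pscale \<alpha> x \<in> ideal_below S w"
  unfolding ideal_below_def
  by (auto intro: ncpoly.span_zero ncpoly.span_add ncpoly.span_diff ncpoly.span_neg ncpoly.span_scale)

lemma ideal_below_mono: "w \<le> w' \<Longrightarrow> S \<subseteq> S' \<Longrightarrow> ideal_below S w \<subseteq> ideal_below S' w'"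
  unfolding ideal_below_def by (intro ncpoly.span_mono ideal_gens_mono) auto

lemma ideal_below_sandwich:
  assumes "p \<in> ideal_below S w"
  shows "mon x * p * mon y \<in> ideal_below S (x @ w @ y)"
  unfolding ideal_below_def
proof (rule span_map[OF assms[unfolded ideal_below_def]])
  fix g assume "g \<in> ideal_gens S (\<lambda>v. v < w)"
  then obtain a s b where g: "g = mon a * s * mon b" "s \<in> S" "a @ lead s @ b < w"
    by (rule ideal_gensE)
  have "mon x * g * mon y = mon (x @ a) * s * mon (b @ y)"
    by (simp add: g mult.assoc mon_mult mon_mult_left)
  then show "mon x * g * mon y \<in> ncpoly.span (ideal_gens S (\<lambda>v. v < x @ w @ y))"
    using g sandwich_less[of "a @ lead s @ b" w x y] ideal_gensI[of s S "\<lambda>v. v < x @ w @ y" "x @ a" "b @ y"]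
    by (simp add: ncpoly.span_base)
qed (simp_all add: algebra_simps pscale_mult_left pscale_mult_right)

lemma assoc_ideal_closed:
  "0 \<in> assoc_ideal S"
  "x \<in> assoc_ideal S \<Longrightarrow> y \<in> assoc_ideal S \<Longrightarrow> x + y \<in> assoc_ideal S"
  "x \<in> assoc_ideal S \<Longrightarrow> y \<in> assoc_ideal S \<Longrightarrow> x - y \<in> assoc_ideal S"
  "x \<in> assoc_ideal S \<Longrightarrow> pscale \<alpha> x \<in> assoc_ideal S"
  unfolding assoc_ideal_def
  by (auto intro: ncpoly.span_zero ncpoly.span_add ncpoly.span_diff ncpoly.span_scale)

lemma assoc_ideal_mult:
  assumes "p \<in> assoc_ideal S"
  shows "q * p * r \<in> assoc_ideal S"
  unfolding assoc_ideal_def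
proof (rule span_map[OF assms[unfolded assoc_ideal_def]])
  fix g assume "g \<in> ideal_gens S (\<lambda>_. True)"
  then obtain a s b where g: "g = mon a * s * mon b" "s \<in> S"
    unfolding ideal_gens_def by blast
  have "mon j * g * mon k \<in> ideal_gens S (\<lambda>_. True)" for j k
    using ideal_gensI[OF g(2), of "\<lambda>_. True" "j @ a" "b @ k"] by (simp add: g mult.assoc mon_mult mon_mult_left)
  then show "q * g * r \<in> ncpoly.span (ideal_gens S (\<lambda>_. True))"
    unfolding mult_expand[of q g r] by (intro ncpoly.span_sum ncpoly.span_scale ncpoly.span_base)
qed (simp_all add: algebra_simps pscale_mult_left pscale_mult_right)

lemma assoc_ideal_base: "s \<in> S \<Longrightarrow> s \<in> assoc_ideal S"
  unfolding assoc_ideal_def ideal_gens_def by (intro ncpoly.span_base) (auto intro!: exI[of _ "[]"])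

lemma lie_ideal_assoc_ideal: "p \<in> lie_ideal X S \<Longrightarrow> p \<in> assoc_ideal S"
proof (induction rule: lie_ideal.induct)
  case (comm p q)
  then show ?case using assoc_ideal_mult[of p S 1 q] assoc_ideal_mult[of p S q 1]
    by (simp add: comm_def assoc_ideal_closed)
qed (auto intro: assoc_ideal_closed assoc_ideal_base)


subsection \<open>Confluence\<close>

definition confluent :: "('x::wellorder, 'k::field) ncpoly set \<Rightarrow> bool" where
  "confluent S \<longleftrightarrow> (\<forall>s\<in>S. monic_at (lead s) s) \<and>
     (\<forall>s\<in>S. \<forall>t\<in>S. \<forall>a b c d. a @ lead s @ b = c @ lead t @ d \<longrightarrow>
        mon a * s * mon b - mon c * t * mon d \<in> ideal_below S (a @ lead s @ b))"

text \<open>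
  Disjoint occurrences of leading words resolve by themselves: replacing one leading word by the
  corresponding lower terms, and then the other, gives the same result in either order.
\<close>

lemma confluentI:
  assumes monic: "\<And>s. s \<in> S \<Longrightarrow> monic_at (lead s) s"
    and inclusions: "\<And>s t a b. s \<in> S \<Longrightarrow> t \<in> S \<Longrightarrow> lead s = a @ lead t @ b
      \<Longrightarrow> s - mon a * t * mon b \<in> ideal_below S (lead s)"
    and overlaps: "\<And>s t c d. s \<in> S \<Longrightarrow> t \<in> S \<Longrightarrow> lead s @ c = d @ lead t \<Longrightarrow> length c < length (lead t)
      \<Longrightarrow> s * mon c - mon d * t \<in> ideal_below S (lead s @ c)"
  shows "confluent S"
proof -
  have main: "mon a * s * mon b - mon c * t * mon d \<in> ideal_below S (a @ lead s @ b)"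
    if st: "s \<in> S" "t \<in> S" and eq: "a @ lead s @ b = c @ lead t @ d" and len: "length a \<le> length c" for s t a b c d
  proof -
    have "take (length a) c = a"
      using arg_cong[OF eq, of "take (length a)"] len by simp
    then obtain x where c: "c = a @ x"
      by (metis append_take_drop_id)
    then have x: "lead s @ b = x @ lead t @ d"
      using eq by simp
    have disjoint: ?thesis if b: "x = lead s @ m" "b = m @ lead t @ d" for m
    proof -
      have "s * (mon m * (mon (lead t) - t)) \<in> ideal_below S (lead s @ m @ lead t)"
      proof -
        have "1 * s * (mon m * (mon (lead t) - t)) \<in> ideal_below S (lead s @ m @ lead t)"
        proof (rule ideal_below_mult[OF st(1)])
          fix j k assume "j \<in> Poly_Mapping.keys (1 :: ('a, 'b) ncpoly)" "k \<in> Poly_Mapping.keys (mon m * (mon (lead t) - t))"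
          moreover have "mon m * (mon (lead t) - t) \<in> below (m @ lead t)"
            using monic[OF st(2)] below_minus[of "t - mon (lead t)"]
            by (intro below_mult_keys) (auto simp: below_def monic_at_def intro: less_append_left)
          ultimately show "j @ lead s @ k < lead s @ m @ lead t"
            by (auto simp: below_def zero_list_def intro: less_append_left)
        qed
        then show ?thesis by simp
      qed
      moreover have "(mon (lead s) - s) * mon m * t \<in> ideal_below S (lead s @ m @ lead t)"
      proof -
        have "((mon (lead s) - s) * mon m) * t * 1 \<in> ideal_below S (lead s @ m @ lead t)"
        proof (rule ideal_below_mult[OF st(2)])
          fix j k assume "k \<in> Poly_Mapping.keys (1 :: ('a, 'b) ncpoly)" "j \<in> Poly_Mapping.keys ((mon (lead s) - s) * mon m)"
          moreover have "(mon (lead s) - s) * mon m \<in> below (lead s @ m)"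
            using monic[OF st(1)] below_minus[of "s - mon (lead s)"]
            by (intro below_mult_keys) (auto simp: below_def monic_at_def intro: less_append_right)
          ultimately show "j @ lead t @ k < lead s @ m @ lead t"
            using less_append_right[of j "lead s @ m" "lead t"] by (auto simp: below_def zero_list_def)
        qed
        then show ?thesis by simp
      qed
      ultimately have "s * (mon m * (mon (lead t) - t)) - (mon (lead s) - s) * mon m * t \<in> ideal_below S (lead s @ m @ lead t)"
        by (rule ideal_below_closed)
      also have "s * (mon m * (mon (lead t) - t)) - (mon (lead s) - s) * mon m * t =
          s * mon (m @ lead t) - mon (lead s @ m) * t"
        by (simp add: algebra_simps mon_mult[symmetric])
      finally show ?thesis
        using ideal_below_sandwich[of "s * mon (m @ lead t) - mon (lead s @ m) * t" S "lead s @ m @ lead t" a d]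
        by (simp add: c b algebra_simps mon_mult mon_mult_left)
    qed
    from x consider m where "x = lead s @ m" "b = m @ lead t @ d" | y where "lead s = x @ y" "y @ b = lead t @ d"
      by (metis append_eq_append_conv2)
    then show ?thesis
    proof cases
      case (1 m)
      then show ?thesis by (rule disjoint)
    next
      case (2 y)
      then consider z where "y = lead t @ z" "d = z @ b" | z where "lead t = y @ z" "b = z @ d"
        by (metis append_eq_append_conv2)
      then show ?thesis
      proof cases
        case (1 z)
        then have "lead s = x @ lead t @ z" using 2 by simp
        from ideal_below_sandwich[OF inclusions[OF st this], of a b] show ?thesis
          using 1 by (simp add: c algebra_simps mon_mult mon_mult_left)
      next
        case (2 z)
        show ?thesis
        proof (cases "y = []")
          case True
          then show ?thesis using \<open>lead s = x @ y\<close> 2 by (intro disjoint[of "[]"]) auto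
        next
          case False
          then have "s * mon z - mon x * t \<in> ideal_below S (lead s @ z)"
            using 2 \<open>lead s = x @ y\<close> by (intro overlaps[OF st]) auto
          from ideal_below_sandwich[OF this, of a d] show ?thesis
            using 2 by (simp add: c algebra_simps mon_mult mon_mult_left)
        qed
      qed
    qed
  qed
  show ?thesis
    unfolding confluent_def
  proof (intro conjI ballI allI impI)
    fix s t a b c d
    assume h: "s \<in> S" "t \<in> S" "a @ lead s @ b = c @ lead t @ d"
    show "mon a * s * mon b - mon c * t * mon d \<in> ideal_below S (a @ lead s @ b)"
    proof (cases "length a \<le> length c")
      case False
      then have "- (mon c * t * mon d - mon a * s * mon b) \<in> ideal_below S (c @ lead t @ d)"
        using main[of t s c d a b] h by (intro ideal_below_closed(4)) auto
      then show ?thesis using h by simp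
    qed (use main h in blast)
  qed (use monic in blast)
qed

text \<open>
  Take a representation of \<open>f\<close> by terms \<open>a s b\<close> whose largest leading word \<open>v\<close> is not below \<open>w\<close>.  As
  \<open>v\<close> does not occur in \<open>f\<close>, the coefficients of the terms at \<open>v\<close> add up to zero, and these terms are
  all congruent modulo smaller ones.
\<close>

theorem diamond_lemma:
  assumes S: "confluent S" and "f \<in> assoc_ideal S" "f \<in> below w"
  shows "f \<in> ideal_below S w"
proof -
  have lower: "f \<in> ideal_below S v \<Longrightarrow> f \<in> ideal_below S w" for v
  proof (induction v rule: less_induct)
    case (less v)
    have "f = 0 \<or> (\<exists>x<v. f \<in> ncpoly.span (ideal_gens S (\<lambda>y. y \<le> x)))"
      using less.prems unfolding ideal_below_def
    proof (induction rule: ncpoly.span_induct_alt)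
      case (step c g y)
      obtain a s b where g: "g = mon a * s * mon b" "s \<in> S" "a @ lead s @ b < v"
        using step(1) unfolding ideal_gens_def by blast
      have mono: "p \<in> ncpoly.span (ideal_gens S (\<lambda>y. y \<le> x)) \<Longrightarrow> x \<le> x' \<Longrightarrow> p \<in> ncpoly.span (ideal_gens S (\<lambda>y. y \<le> x'))" for p x x'
        using ncpoly.span_mono[OF ideal_gens_mono[of S S "\<lambda>y. y \<le> x" "\<lambda>y. y \<le> x'"]] order_trans by blast
      have "pscale c g \<in> ncpoly.span (ideal_gens S (\<lambda>y. y \<le> a @ lead s @ b))"
        using g by (intro ncpoly.span_scale ncpoly.span_base) (auto simp: ideal_gens_def)
      then show ?case
      proof (cases "y = 0")
        case False
        then obtain x where x: "x < v" "y \<in> ncpoly.span (ideal_gens S (\<lambda>y. y \<le> x))" using step by blast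
        let ?m = "max x (a @ lead s @ b)"
        have "pscale c g + y \<in> ncpoly.span (ideal_gens S (\<lambda>y. y \<le> ?m))"
          using x \<open>pscale c g \<in> _\<close> by (intro ncpoly.span_add) (auto elim: mono)
        moreover have "?m < v" using x g by simp
        ultimately show ?thesis by blast
      qed (use g in auto)
    qed simp
    then show ?case
    proof
      assume "\<exists>x<v. f \<in> ncpoly.span (ideal_gens S (\<lambda>y. y \<le> x))"
      then obtain x where x: "x < v" "f \<in> ncpoly.span (ideal_gens S (\<lambda>y. y \<le> x))" by blast
      show ?thesis
      proof (cases "x < w")
        case True
        then have "ncpoly.span (ideal_gens S (\<lambda>y. y \<le> x)) \<subseteq> ideal_below S w"
          unfolding ideal_below_def by (intro ncpoly.span_mono ideal_gens_mono) auto
        then show ?thesis using x by blast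
      next
        case False
        have "ideal_gens S (\<lambda>y. y \<le> x) = ideal_gens S (\<lambda>y. y < x) \<union> ideal_gens S (\<lambda>y. y = x)"
          unfolding ideal_gens_def order_le_less by blast
        then obtain g h where f: "f = g + h" and g: "g \<in> ideal_below S x"
          and h: "h \<in> ncpoly.span (ideal_gens S (\<lambda>y. y = x))"
          using x(2) ncpoly.span_Un[of "ideal_gens S (\<lambda>y. y < x)" "ideal_gens S (\<lambda>y. y = x)"]
          unfolding ideal_below_def by auto
        have top: "monic_at x e" if "e \<in> ideal_gens S (\<lambda>y. y = x)" for e
          using that S monic_at_mult[OF monic_at_mult[OF monic_at_mon]] monic_at_mon
          unfolding ideal_gens_def confluent_def by fastforce
        have "h \<in> ideal_below S x"
        proof (cases "ideal_gens S (\<lambda>y. y = x) = {}")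
          case True
          then show ?thesis using h by (simp add: ideal_below_closed)
        next
          case ne: False
          then obtain e where e: "e \<in> ideal_gens S (\<lambda>y. y = x)" by blast
          have "h - pscale (Poly_Mapping.lookup h x) e \<in> ideal_below S x"
            using h
          proof (induction rule: ncpoly.span_induct_alt)
            case (step c e' y)
            obtain a s b where e': "e' = mon a * s * mon b" "s \<in> S" "a @ lead s @ b = x"
              using step(1) by (rule ideal_gensE)
            obtain a' t b' where t: "e = mon a' * t * mon b'" "t \<in> S" "a' @ lead t @ b' = x"
              using e by (rule ideal_gensE)
            have "e' - e \<in> ideal_below S x"
              using S e' t unfolding confluent_def by metis
            then have "pscale c (e' - e) + (y - pscale (Poly_Mapping.lookup y x) e) \<in> ideal_below S x"
              using step ideal_below_closed(2,5) by blast
            moreover have "Poly_Mapping.lookup e' x = 1" using top[OF step(1)] by (simp add: monic_at_iff)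
            ultimately show ?case
              by (simp add: lookup_add ncpoly.scale_left_distrib ncpoly.scale_right_diff_distrib algebra_simps)
          qed (simp add: ideal_below_closed)
          moreover have "Poly_Mapping.lookup h x = 0"
          proof -
            have "g \<in> below x"
              using g unfolding ideal_below_def
            proof (rule below_span)
              show "ideal_gens S (\<lambda>v. v < x) \<subseteq> below x"
              proof
                fix e assume "e \<in> ideal_gens S (\<lambda>v. v < x)"
                then obtain a s b where "e = mon a * s * mon b" "s \<in> S" "a @ lead s @ b < x"
                  unfolding ideal_gens_def by blast
                moreover have "monic_at (a @ lead s @ b) (mon a * s * mon b)"
                  using S \<open>s \<in> S\<close> monic_at_mult[OF monic_at_mult[OF monic_at_mon] monic_at_mon] unfolding confluent_def by fastforce
                ultimately show "e \<in> below x" using monic_at_below by blast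
              qed
            qed
            moreover have "f \<in> below x" using assms(3) False below_mono not_less by blast
            ultimately show ?thesis by (simp add: f below_iff lookup_add)
          qed
          ultimately show ?thesis by simp
        qed
        then have "f \<in> ideal_below S x" using f g ideal_below_closed by blast
        then show ?thesis using less.IH x(1) by blast
      qed
    qed (simp add: ideal_below_closed)
  qed
  have "\<exists>v. f \<in> ideal_below S v"
    using assms(2) unfolding assoc_ideal_def
  proof (induction rule: ncpoly.span_induct_alt)
    case (step c g y)
    then obtain v where v: "y \<in> ideal_below S v" by blast
    obtain a s b where g: "g = mon a * s * mon b" "s \<in> S" using step(1) unfolding ideal_gens_def by blast
    let ?m = "replicate (Suc (length (a @ lead s @ b))) undefined"
    have "g \<in> ideal_below S ?m"
      unfolding ideal_below_def g(1)
      by (intro ncpoly.span_base ideal_gensI g(2) shorter_imp_less) simp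
    then have "pscale c g + y \<in> ideal_below S (max v ?m)"
      using v ideal_below_mono[of v "max v ?m" S S] ideal_below_mono[of ?m "max v ?m" S S]
      by (intro ideal_below_closed(2,5)) auto
    then show ?case by blast
  qed (use ideal_below_closed in blast)
  then show ?thesis using lower by blast
qed

text \<open>
  Take the least word \<open>v\<close> above \<open>lead f\<close>.  If no term with leading word \<open>lead f\<close> were available, a
  representation of \<open>f\<close> below \<open>v\<close> would stay strictly below \<open>lead f\<close>.
\<close>

corollary diamond_lemma_lead:
  assumes S: "confluent S" and f: "f \<in> assoc_ideal S" "f \<noteq> 0"
  shows "\<exists>s\<in>S. \<exists>a b. lead f = a @ lead s @ b"
proof (rule ccontr)
  assume no: "\<not> ?thesis"
  define v where "v = (LEAST v. lead f < v)"
  have less: "lead f < v"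
    unfolding v_def by (rule LeastI[of _ "lead f @ [undefined]"]) (simp add: shorter_imp_less)
  have v: "x \<le> lead f" if "x < v" for x
    using not_less_Least[of x "\<lambda>v. lead f < v"] that unfolding v_def by auto
  have "f \<in> ideal_below S v"
    using lead_less_below[OF less] diamond_lemma[OF S f(1)] by blast
  then have "f \<in> below (lead f)"
    unfolding ideal_below_def
  proof (rule below_span)
    show "ideal_gens S (\<lambda>x. x < v) \<subseteq> below (lead f)"
    proof
      fix e assume "e \<in> ideal_gens S (\<lambda>x. x < v)"
      then obtain a s b where e: "e = mon a * s * mon b" "s \<in> S" "a @ lead s @ b < v"
        unfolding ideal_gens_def by blast
      then have "a @ lead s @ b < lead f" using v[OF e(3)] no by (metis order_le_less)
      moreover have "monic_at (a @ lead s @ b) e"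
        using S e monic_at_mult[OF monic_at_mult[OF monic_at_mon] monic_at_mon] unfolding confluent_def by fastforce
      ultimately show "e \<in> below (lead f)" using monic_at_below by blast
    qed
  qed
  then show False using nonzero_lead[OF f(2)] by (auto simp: below_def)
qed

section \<open>Leading words of bracketings\<close>

lemma alsw_rotate_less: "alsw (u @ v) \<Longrightarrow> u \<noteq> [] \<Longrightarrow> v \<noteq> [] \<Longrightarrow> v @ u < u @ v"
  by (simp add: alsw_def same_length_less_iff)

lemma comm_monic_at:
  assumes "monic_at u p" "monic_at v q" "alsw (u @ v)" "u \<noteq> []" "v \<noteq> []"
  shows "monic_at (u @ v) (comm p q)"
proof -
  have "v @ u < u @ v" using assms(3-5) by (rule alsw_rotate_less)
  then have "q * p \<in> below (u @ v)" using monic_at_mult[OF assms(2,1)] monic_at_below by blast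
  then show ?thesis unfolding comm_def by (intro monic_at_diff monic_at_mult assms)
qed

lemma lie_eval_monic_at: "nlsw t \<Longrightarrow> monic_at (word t) (lie_eval t)"
  by (induction t) (auto simp: letter_mon intro: comm_monic_at)

text \<open>
  The tree around the hole has the leading word expected from its shape if all its subtrees that
  contain the hole, filled by \<open>v\<close>, are Lyndon-Shirshov words.
\<close>

primrec lyndon_ctx :: "'x::wellorder list \<Rightarrow> 'x nactx \<Rightarrow> bool" where
  "lyndon_ctx v Hole \<longleftrightarrow> True"
| "lyndon_ctx v (HoleL C t) \<longleftrightarrow> lyndon_ctx v C \<and> nlsw t \<and> alsw (left_word C @ v @ right_word C @ word t)"
| "lyndon_ctx v (HoleR t C) \<longleftrightarrow> lyndon_ctx v C \<and> nlsw t \<and> alsw (word t @ left_word C @ v @ right_word C)"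

lemma context_mult:
  fixes p :: "('x::wellorder, 'k::field) ncpoly"
  assumes P: "P - mon a * p * mon b \<in> hole_span v (a @ v @ b) p" and T: "monic_at t T"
  shows context_mult_right: "P * T - mon a * p * mon (b @ t) \<in> hole_span v ((a @ v @ b) @ t) p"
    and context_mult_left: "T * P - mon (t @ a) * p * mon b \<in> hole_span v (t @ a @ v @ b) p"
proof -
  define x where "x = P - mon a * p * mon b"
  define y where "y = T - mon t"
  have P_eq: "P = mon a * p * mon b + x" and T_eq: "T = mon t + y" by (simp_all add: x_def y_def)
  have y: "k < t" if "k \<in> Poly_Mapping.keys y" for k
    using T that by (auto simp: y_def monic_at_def below_def)
  note kt = monic_at_keys[OF T]
  have "1 * x * T \<in> hole_span v ((a @ v @ b) @ t) p"
    by (rule hole_span_context[OF P[folded x_def]])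
      (use append_le_le[OF order_refl kt, of _ "a @ v @ b"] in \<open>auto simp: zero_list_def\<close>)
  moreover have "mon a * p * (mon b * y) \<in> hole_span v ((a @ v @ b) @ t) p"
  proof (rule hole_span_mult)
    fix j k assume "j \<in> Poly_Mapping.keys (mon a :: ('x, 'k) ncpoly)" "k \<in> Poly_Mapping.keys (mon b * y)"
    then obtain k' where "j = a" "k = b @ k'" "k' \<in> Poly_Mapping.keys y"
      using keys_mult[of "mon b" y] by (auto simp: plus_list_def)
    then show "j @ v @ k < (a @ v @ b) @ t" using less_append_left[OF y, of k' "a @ v @ b"] by simp
  qed
  ultimately have "1 * x * T + mon a * p * (mon b * y) \<in> hole_span v ((a @ v @ b) @ t) p"
    by (rule hole_span_closed)
  also have "1 * x * T + mon a * p * (mon b * y) = P * T - mon a * p * mon (b @ t)"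
    by (simp only: P_eq) (simp add: T_eq algebra_simps mon_mult mon_mult_left)
  finally show "P * T - mon a * p * mon (b @ t) \<in> hole_span v ((a @ v @ b) @ t) p" .
  have "T * x * 1 \<in> hole_span v (t @ a @ v @ b) p"
    by (rule hole_span_context[OF P[folded x_def]])
      (use append_le_le[OF kt order_refl, of _ "a @ v @ b"] in \<open>auto simp: zero_list_def\<close>)
  moreover have "(y * mon a) * p * mon b \<in> hole_span v (t @ a @ v @ b) p"
  proof (rule hole_span_mult)
    fix j k assume "k \<in> Poly_Mapping.keys (mon b :: ('x, 'k) ncpoly)" "j \<in> Poly_Mapping.keys (y * mon a)"
    then obtain j' where "k = b" "j = j' @ a" "j' \<in> Poly_Mapping.keys y"
      using keys_mult[of y "mon a"] by (auto simp: plus_list_def)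
    then show "j @ v @ k < t @ a @ v @ b" using less_append_right[OF y, of j' "a @ v @ b"] by simp
  qed
  ultimately have "T * x * 1 + (y * mon a) * p * mon b \<in> hole_span v (t @ a @ v @ b) p"
    by (rule hole_span_closed)
  also have "T * x * 1 + (y * mon a) * p * mon b = T * P - mon (t @ a) * p * mon b"
    by (simp only: P_eq) (simp add: T_eq algebra_simps mon_mult mon_mult_left)
  finally show "T * P - mon (t @ a) * p * mon b \<in> hole_span v (t @ a @ v @ b) p" .
qed

lemma hole_span_base: "a @ v @ b < w \<Longrightarrow> mon a * p * mon b \<in> hole_span v w p"
  unfolding hole_span_def by (rule ncpoly.span_base) blast

text \<open>
  In each commutator the product in the order of the tree has the leading term \<open>a p b\<close>; the other
  product starts from a rotation of the Lyndon-Shirshov word \<open>avb\<close>, which is smaller.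
\<close>

lemma plug_top:
  fixes p :: "('x::wellorder, 'k::field) ncpoly"
  assumes "lyndon_ctx v C" "v \<noteq> []"
  shows "plug C p - mon (left_word C) * p * mon (right_word C) \<in> hole_span v (left_word C @ v @ right_word C) p"
  using assms(1)
proof (induction C)
  case Hole
  then show ?case by (simp add: hole_span_closed)
next
  case (HoleL C t)
  let ?a = "left_word C" and ?b = "right_word C" and ?T = "lie_eval t :: ('x, 'k) ncpoly"
  let ?w = "?a @ v @ ?b" and ?Q = "mon (word t @ left_word C) * p * mon (right_word C)"
  have P: "plug C p - mon ?a * p * mon ?b \<in> hole_span v ?w p" and T: "monic_at (word t) ?T"
    using HoleL lie_eval_monic_at by auto
  have rot: "word t @ ?w < ?w @ word t"
    using HoleL.prems assms(2) alsw_rotate_less[of ?w "word t"] by simp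
  have "?T * plug C p - ?Q \<in> hole_span v (?w @ word t) p" "?Q \<in> hole_span v (?w @ word t) p"
    using context_mult_left[OF P T] hole_span_mono[OF less_imp_le[OF rot], of v p] rot
    by (auto intro: hole_span_base)
  from hole_span_closed(3)[OF hole_span_closed(3)[OF context_mult_right[OF P T] this(1)] this(2)]
  show ?case by (simp add: comm_def algebra_simps)
next
  case (HoleR t C)
  let ?a = "left_word C" and ?b = "right_word C" and ?T = "lie_eval t :: ('x, 'k) ncpoly"
  let ?w = "?a @ v @ ?b" and ?Q = "mon (left_word C) * p * mon (right_word C @ word t)"
  have P: "plug C p - mon ?a * p * mon ?b \<in> hole_span v ?w p" and T: "monic_at (word t) ?T"
    using HoleR lie_eval_monic_at by auto
  have rot: "?w @ word t < word t @ ?w"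
    using HoleR.prems assms(2) alsw_rotate_less[of "word t" ?w] by simp
  have "plug C p * ?T - ?Q \<in> hole_span v (word t @ ?w) p" "?Q \<in> hole_span v (word t @ ?w) p"
    using context_mult_right[OF P T] hole_span_mono[OF less_imp_le[OF rot], of v p] rot
    by (auto intro: hole_span_base)
  from hole_span_closed(3)[OF hole_span_closed(3)[OF context_mult_left[OF P T] this(1)] this(2)]
  show ?case by (simp add: comm_def algebra_simps)
qed

lemma word_fill: "word (fill C s) = left_word C @ word s @ right_word C"
  by (induction C) auto

lemma lyndon_ctx_fill: "nlsw (fill C s) \<Longrightarrow> lyndon_ctx (word s) C"
  by (induction C) (auto simp: word_fill)

lemma left_word_ctx_comp [simp]: "left_word (ctx_comp C D) = left_word C @ left_word D"
  by (induction C) auto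

lemma right_word_ctx_comp [simp]: "right_word (ctx_comp C D) = right_word D @ right_word C"
  by (induction C) auto

lemma lyndon_ctx_comp:
  "lyndon_ctx (left_word D @ v @ right_word D) C \<Longrightarrow> lyndon_ctx v D \<Longrightarrow> lyndon_ctx v (ctx_comp C D)"
  by (induction C) auto

lemma sorted_alsws_snoc: "sorted_alsws (cs @ ds) \<Longrightarrow> sorted_alsws cs"
  by (auto simp: sorted_alsws_def sorted_wrt_append)

lemma alsw_chain_words:
  "\<forall>u\<in>set cs. alsw u \<Longrightarrow> left_word (alsw_chain cs) = [] \<and> right_word (alsw_chain cs) = concat cs"
  by (induction cs rule: rev_induct) (auto simp: alsw_chain_def bracketing)

text \<open>
  Here the order of the factors matters: \<open>c\<^sub>j\<close> is at most the last factor, a suffix of \<open>v c\<close>, and so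
  below \<open>v c\<close> and its prefix \<open>v c\<^sub>1 \<dots> c\<^sub>j\<^sub>-\<^sub>1\<close>.
\<close>

lemma alsw_chain_prefix:
  assumes "alsw v"
  shows "sorted_alsws (cs @ ds) \<Longrightarrow> alsw (v @ concat (cs @ ds)) \<Longrightarrow> alsw (v @ concat cs)"
proof (induction cs arbitrary: ds rule: rev_induct)
  case Nil
  then show ?case using assms by simp
next
  case (snoc c cs)
  let ?w = "v @ concat (cs @ c # ds)"
  obtain es l where l: "c # ds = es @ [l]" by (metis list.distinct(1) rev_exhaust)
  have pre: "alsw (v @ concat cs)" using snoc.IH[of "c # ds"] snoc.prems by simp
  have "sorted_alsws (c # ds)"
    using snoc.prems(1) by (auto simp: sorted_alsws_def sorted_wrt_append)
  moreover from this l have "sorted_alsws (es @ [l])" by simp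
  moreover have "c = l \<or> c \<in> set es" using l by (cases es) auto
  ultimately have c: "alsw c" "alsw l" "c \<preceq> l"
    by (auto simp: sorted_alsws_def sorted_wrt_append)
  have w: "?w = (v @ concat cs @ concat es) @ l"
    using arg_cong[OF l, of concat] by simp
  have "alsw ?w" using snoc.prems(2) by simp
  then have "?w \<succ> l"
    unfolding w using alsw_nonempty[OF assms] alsw_nonempty[OF c(2)] by (intro alsw_suffix) auto
  moreover have "v @ concat cs \<succ> ?w"
    using lex_greater_prefix[of "concat (c # ds)" "v @ concat cs"] alsw_nonempty[OF c(1)] by simp
  ultimately have "v @ concat cs \<succ> c" using c(3) lex_greater_trans unfolding lex_le_def by blast
  then show ?case using alsw_append[OF pre c(1)] by simp
qed

lemma lyndon_ctx_alsw_chain: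
  "alsw v \<Longrightarrow> sorted_alsws cs \<Longrightarrow> alsw (v @ concat cs) \<Longrightarrow> lyndon_ctx v (alsw_chain cs)"
proof (induction cs rule: rev_induct)
  case Nil
  then show ?case by (simp add: alsw_chain_def)
next
  case (snoc c cs)
  have "alsw (v @ concat cs)" using alsw_chain_prefix[of v cs "[c]"] snoc.prems by simp
  then have "lyndon_ctx v (alsw_chain cs)" using snoc sorted_alsws_snoc by blast
  moreover have "alsw c" "\<forall>u\<in>set cs. alsw u" using snoc.prems by (auto simp: sorted_alsws_def)
  moreover have "alsw_chain (cs @ [c]) = HoleL (alsw_chain cs) (bracketing c)" by (simp add: alsw_chain_def)
  ultimately show ?case using snoc.prems alsw_chain_words[of cs] bracketing[of c] by simp
qed

lemma special_ctx_words:
  assumes "alsw (a @ v @ b)" "alsw v"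
  shows "left_word (special_ctx a v b) = a" "right_word (special_ctx a v b) = b" "lyndon_ctx v (special_ctx a v b)"
proof -
  obtain C c d cs where D: "b = c @ d" "alsw (v @ c)" "bracketing (a @ v @ b) = fill C (bracketing (v @ c))"
    "left_word C = a" "right_word C = d" "c = concat cs" "sorted_alsws cs"
    "special_ctx a v b = ctx_comp C (alsw_chain cs)"
    by (rule special_ctx_decompose[OF assms])
  have "\<forall>u\<in>set cs. alsw u" using D(7) by (auto simp: sorted_alsws_def)
  from alsw_chain_words[OF this] D show "left_word (special_ctx a v b) = a" "right_word (special_ctx a v b) = b" by auto
  have "lyndon_ctx (v @ c) C"
    using lyndon_ctx_fill[of C "bracketing (v @ c)"] bracketing[OF assms(1)] bracketing[OF D(2)] D(3) by simp
  then show "lyndon_ctx v (special_ctx a v b)"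
    unfolding D(8) using lyndon_ctx_alsw_chain[OF assms(2) D(7)] D(2,6) alsw_chain_words[OF \<open>\<forall>u\<in>set cs. alsw u\<close>]
    by (intro lyndon_ctx_comp) auto
qed

text \<open>
  This is how Lie compositions are compared with associative ones.  It holds for arbitrary \<open>p\<close>, because
  only the tree around the hole matters.
\<close>

theorem special_top:
  assumes "alsw (a @ v @ b)" "alsw v"
  shows "special a v b p - mon a * p * mon b \<in> hole_span v (a @ v @ b) p"
  using plug_top[of v "special_ctx a v b" p] special_ctx_words[OF assms] alsw_nonempty[OF assms(2)]
  by (simp add: special_def)


section \<open>Lie algebras\<close>

lemma scalars_simps [simp]:
  "carrier scalars = UNIV" "\<one>\<^bsub>scalars\<^esub> = 1" "\<zero>\<^bsub>scalars\<^esub> = 0"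
  "x \<otimes>\<^bsub>scalars\<^esub> y = x * y" "x \<oplus>\<^bsub>scalars\<^esub> y = x + y"
  by (simp_all add: scalars_def)

lemma cring_scalars: "cring (scalars :: 'k::field ring)"
proof (rule cringI)
  show "abelian_group (scalars :: 'k ring)"
    by (rule abelian_groupI) (auto simp: algebra_simps intro: exI[of _ "- x" for x])
  show "Group.comm_monoid (scalars :: 'k ring)"
    by (rule comm_monoidI) (auto simp: algebra_simps)
qed (auto simp: algebra_simps)

lemma lie_algebraI:
  fixes L :: "('k::field, 'v) module" (structure)
  assumes "abelian_group L"
    and "\<And>\<alpha> x. x \<in> carrier L \<Longrightarrow> \<alpha> \<odot> x \<in> carrier L"
    and "\<And>\<alpha> \<beta> x. x \<in> carrier L \<Longrightarrow> (\<alpha> + \<beta>) \<odot> x = \<alpha> \<odot> x \<oplus> \<beta> \<odot> x"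
    and "\<And>\<alpha> x y. x \<in> carrier L \<Longrightarrow> y \<in> carrier L \<Longrightarrow> \<alpha> \<odot> (x \<oplus> y) = \<alpha> \<odot> x \<oplus> \<alpha> \<odot> y"
    and "\<And>\<alpha> \<beta> x. x \<in> carrier L \<Longrightarrow> (\<alpha> * \<beta>) \<odot> x = \<alpha> \<odot> (\<beta> \<odot> x)"
    and "\<And>x. x \<in> carrier L \<Longrightarrow> 1 \<odot> x = x"
    and "lie_algebra_axioms L"
  shows "lie_algebra L"
  by (intro lie_algebra.intro moduleI cring_scalars) (use assms in auto)

context lie_algebra
begin

lemmas smult_laws = smult_closed[simplified] smult_l_distr[simplified] smult_r_distr[simplified]
  smult_assoc1[simplified] smult_one[simplified]

declare bracket_closed [simp, intro]
declare smult_closed [simplified, simp, intro]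

lemma zero_smult [simp]: "x \<in> carrier L \<Longrightarrow> 0 \<odot> x = \<zero>"
  using smult_l_null[of x] by simp

lemma smult_zero [simp]: "\<alpha> \<odot> \<zero> = \<zero>"
  using smult_r_null[of \<alpha>] by simp

lemma minus_smult: "x \<in> carrier L \<Longrightarrow> (- 1) \<odot> x = \<ominus> x"
proof -
  assume x: "x \<in> carrier L"
  have "(- 1) \<odot> x \<oplus> x = (- 1 + 1) \<odot> x"
    using smult_laws(2)[of x "-1" 1] smult_laws(5)[of x] x by simp
  then show ?thesis using x minus_equality[of "(-1) \<odot> x" x] by simp
qed

lemma bracket_zero_left [simp]: "x \<in> carrier L \<Longrightarrow> \<zero> \<otimes> x = \<zero>"
  using bracket_smult_left[of \<zero> x 0] by simp

lemma bracket_zero_right [simp]: "x \<in> carrier L \<Longrightarrow> x \<otimes> \<zero> = \<zero>"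
  using bracket_smult_right[of x \<zero> 0] by simp

lemma bracket_antisym:
  assumes "x \<in> carrier L" "y \<in> carrier L"
  shows "x \<otimes> y = \<ominus> (y \<otimes> x)"
proof -
  have "(x \<oplus> y) \<otimes> (x \<oplus> y) = x \<otimes> y \<oplus> y \<otimes> x"
    using assms by (simp add: bracket_add_left bracket_add_right bracket_self[OF assms(1)] bracket_self[OF assms(2)] a_comm)
  then have "x \<otimes> y \<oplus> y \<otimes> x = \<zero>" using assms bracket_self[of "x \<oplus> y"] by (metis add.m_closed)
  then show ?thesis using assms minus_equality[of "x \<otimes> y" "y \<otimes> x"] by simp
qed

lemma bracket_minus_left: "x \<in> carrier L \<Longrightarrow> y \<in> carrier L \<Longrightarrow> (\<ominus> x) \<otimes> y = \<ominus> (x \<otimes> y)"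
  using bracket_smult_left[of x y "-1"] by (simp add: minus_smult)

lemma bracket_leibniz:
  assumes "x \<in> carrier L" "y \<in> carrier L" "z \<in> carrier L"
  shows "(x \<otimes> y) \<otimes> z = (x \<otimes> z) \<otimes> y \<oplus> x \<otimes> (y \<otimes> z)"
proof -
  have 1: "z \<otimes> (x \<otimes> y) = \<ominus> ((x \<otimes> y) \<otimes> z)" and 2: "y \<otimes> (z \<otimes> x) = (x \<otimes> z) \<otimes> y"
    using assms bracket_antisym[of z "x \<otimes> y"] bracket_antisym[of y "z \<otimes> x"] bracket_antisym[of z x]
    by (simp_all add: bracket_minus_left)
  have "(x \<otimes> (y \<otimes> z) \<oplus> (x \<otimes> z) \<otimes> y) \<oplus> \<ominus> ((x \<otimes> y) \<otimes> z) = \<zero>"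
    using jacobi[of x y z] assms by (simp add: 1 2)
  then have "\<ominus> (\<ominus> ((x \<otimes> y) \<otimes> z)) = x \<otimes> (y \<otimes> z) \<oplus> (x \<otimes> z) \<otimes> y"
    using assms by (intro minus_equality) auto
  then show ?thesis using assms by (simp add: a_comm)
qed

end

text \<open>
  The linear span, without the restriction that the generators lie in the carrier; this keeps the
  rules free of side conditions.
\<close>

inductive_set lspan :: "('k::field, 'v) module \<Rightarrow> 'v set \<Rightarrow> 'v set" for L (structure) and S where
  zero: "\<zero> \<in> lspan L S"
| base: "x \<in> S \<Longrightarrow> x \<in> lspan L S"
| add: "x \<in> lspan L S \<Longrightarrow> y \<in> lspan L S \<Longrightarrow> x \<oplus> y \<in> lspan L S"
| smult: "x \<in> lspan L S \<Longrightarrow> \<alpha> \<odot> x \<in> lspan L S"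

lemma lspan_mono: "x \<in> lspan L S \<Longrightarrow> S \<subseteq> T \<Longrightarrow> x \<in> lspan L T"
  by (induction rule: lspan.induct) (auto intro: lspan.intros)

context lie_algebra
begin

lemma lspan_closed: "x \<in> lspan L S \<Longrightarrow> S \<subseteq> carrier L \<Longrightarrow> x \<in> carrier L"
  by (induction rule: lspan.induct) auto

lemma lspan_minus: "x \<in> lspan L S \<Longrightarrow> S \<subseteq> carrier L \<Longrightarrow> \<ominus> x \<in> lspan L S"
  using lspan.smult[of x L S "-1"] lspan_closed[of x S] by (simp add: minus_smult)

lemma lspan_bracket:
  assumes "x \<in> lspan L S" "y \<in> lspan L T" "S \<subseteq> carrier L" "T \<subseteq> carrier L"
    and ST: "\<And>s t. s \<in> S \<Longrightarrow> t \<in> T \<Longrightarrow> s \<otimes> t \<in> lspan L U"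
  shows "x \<otimes> y \<in> lspan L U"
  using assms(1)
proof (induction rule: lspan.induct)
  case (base s)
  then have s: "s \<in> carrier L" using assms(3) by blast
  show ?case using assms(2)
  proof (induction rule: lspan.induct)
    case zero
    then show ?case using s by (simp add: lspan.zero)
  next
    case (add x y)
    then show ?case
      using s lspan_closed[OF _ assms(4), of x] lspan_closed[OF _ assms(4), of y]
      by (simp add: bracket_add_right lspan.add)
  next
    case (smult x \<alpha>)
    then show ?case
      using s lspan_closed[OF _ assms(4), of x] by (simp add: bracket_smult_right lspan.smult)
  qed (use base ST in blast)
next
  case zero
  then show ?case using lspan_closed[OF assms(2,4)] by (simp add: lspan.zero)
next
  case (add x x')
  then show ?case
    using lspan_closed[OF assms(2,4)] lspan_closed[OF _ assms(3), of x] lspan_closed[OF _ assms(3), of x']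
    by (simp add: bracket_add_left lspan.add)
next
  case (smult x \<alpha>)
  then show ?case
    using lspan_closed[OF assms(2,4)] lspan_closed[OF _ assms(3), of x] by (simp add: bracket_smult_left lspan.smult)
qed

end

section \<open>Linear combinations\<close>

lemma lookup_scaled: "Poly_Mapping.lookup (Poly_Mapping.map ((*) \<alpha>) c) x = \<alpha> * Poly_Mapping.lookup c x" for \<alpha> :: "'k::field"
  by (simp add: Poly_Mapping.map.rep_eq when_def)

lemma keys_scaled: "Poly_Mapping.keys (Poly_Mapping.map ((*) \<alpha>) c) \<subseteq> Poly_Mapping.keys c" for \<alpha> :: "'k::field"
  by (auto simp: in_keys_iff lookup_scaled)

context lie_algebra
begin

lemma minus_eq_zero: "x \<in> carrier L \<Longrightarrow> y \<in> carrier L \<Longrightarrow> x \<ominus> y = \<zero> \<longleftrightarrow> x = y"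
  using minus_equality[of x "\<ominus> y"] by (auto simp: a_minus_def r_neg)

lemma lin_comb_superset:
  assumes "finite K" "Poly_Mapping.keys c \<subseteq> K" "f \<in> K \<rightarrow> carrier L"
  shows "lin_comb L f c = (\<Oplus>x\<in>K. Poly_Mapping.lookup c x \<odot> f x)"
  unfolding lin_comb_def
  by (rule add.finprod_mono_neutral_cong_left) (use assms in \<open>auto simp: in_keys_iff Pi_iff\<close>)

lemma lin_comb_zero [simp]: "lin_comb L f 0 = \<zero>"
  by (simp add: lin_comb_def)

lemma lin_comb_add:
  assumes "f \<in> A \<rightarrow> carrier L" "Poly_Mapping.keys c \<subseteq> A" "Poly_Mapping.keys d \<subseteq> A"
  shows "lin_comb L f (c + d) = lin_comb L f c \<oplus> lin_comb L f d"
proof -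
  let ?K = "Poly_Mapping.keys c \<union> Poly_Mapping.keys d"
  have f: "f \<in> ?K \<rightarrow> carrier L" using assms by blast
  have "lin_comb L f (c + d) = (\<Oplus>x\<in>?K. Poly_Mapping.lookup (c + d) x \<odot> f x)"
    using keys_add[of c d] f by (intro lin_comb_superset) auto
  also have "\<dots> = (\<Oplus>x\<in>?K. Poly_Mapping.lookup c x \<odot> f x \<oplus> Poly_Mapping.lookup d x \<odot> f x)"
    by (rule finsum_cong') (use f in \<open>auto simp: lookup_add smult_laws(2) Pi_iff\<close>)
  also have "\<dots> = (\<Oplus>x\<in>?K. Poly_Mapping.lookup c x \<odot> f x) \<oplus> (\<Oplus>x\<in>?K. Poly_Mapping.lookup d x \<odot> f x)"
    by (rule finsum_addf) (use f in auto)
  finally show ?thesis using f lin_comb_superset[of ?K c f] lin_comb_superset[of ?K d f] by simp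
qed

lemma lin_comb_smult:
  assumes "f \<in> A \<rightarrow> carrier L" "Poly_Mapping.keys c \<subseteq> A"
  shows "lin_comb L f (Poly_Mapping.map ((*) \<alpha>) c) = \<alpha> \<odot> lin_comb L f c"
proof -
  have f: "f \<in> Poly_Mapping.keys c \<rightarrow> carrier L" using assms by blast
  have "lin_comb L f (Poly_Mapping.map ((*) \<alpha>) c) =
      (\<Oplus>x\<in>Poly_Mapping.keys c. Poly_Mapping.lookup (Poly_Mapping.map ((*) \<alpha>) c) x \<odot> f x)"
    using keys_scaled[of \<alpha> c] f by (intro lin_comb_superset) auto
  also have "\<dots> = (\<Oplus>x\<in>Poly_Mapping.keys c. \<alpha> \<odot> (Poly_Mapping.lookup c x \<odot> f x))"
    by (rule finsum_cong') (use f in \<open>auto simp: lookup_scaled smult_laws(4) Pi_iff\<close>)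
  also have "\<dots> = \<alpha> \<odot> lin_comb L f c"
    unfolding lin_comb_def by (rule finsum_smult_ldistr[symmetric]) (use f in auto)
  finally show ?thesis .
qed

lemma lin_comb_single: "f x \<in> carrier L \<Longrightarrow> lin_comb L f (Poly_Mapping.single x \<alpha>) = \<alpha> \<odot> f x"
  using lin_comb_superset[of "{x}" "Poly_Mapping.single x \<alpha>" f] by simp

lemma lin_comb_closed: "f \<in> A \<rightarrow> carrier L \<Longrightarrow> Poly_Mapping.keys c \<subseteq> A \<Longrightarrow> lin_comb L f c \<in> carrier L"
  unfolding lin_comb_def by (rule finsum_closed) auto

end

subsection \<open>Free Lie algebras and products\<close>

lemma free_lie_simps [simp]:
  "carrier (free_lie X) = Lie X" "\<zero>\<^bsub>free_lie X\<^esub> = 0" "x \<otimes>\<^bsub>free_lie X\<^esub> y = comm x y"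
  "x \<oplus>\<^bsub>free_lie X\<^esub> y = x + y" "\<alpha> \<odot>\<^bsub>free_lie X\<^esub> x = pscale \<alpha> x"
  by (simp_all add: free_lie_def)

lemma pscale_minus_one: "pscale (- 1) p = - p"
  using ncpoly.scale_minus_left[of 1 p] by simp

lemma Lie_minus: "p \<in> Lie X \<Longrightarrow> - p \<in> Lie X"
  using Lie.scale[of p X "-1"] by (simp add: pscale_minus_one)

lemma Lie_diff: "p \<in> Lie X \<Longrightarrow> q \<in> Lie X \<Longrightarrow> p - q \<in> Lie X"
  using Lie.add[OF _ Lie_minus] by fastforce

lemma Lie_mono: "p \<in> Lie X \<Longrightarrow> X \<subseteq> Y \<Longrightarrow> p \<in> Lie Y"
  by (induction rule: Lie.induct) (auto intro: Lie.intros)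

lemma lie_eval_Lie: "set (word t) \<subseteq> X \<Longrightarrow> lie_eval t \<in> Lie X"
  by (induction t) (auto intro: Lie.intros)

lemma comm_simps:
  "comm (p + q) r = comm p r + comm q r" "comm r (p + q) = comm r p + comm r q"
  "comm (p - q) r = comm p r - comm q r" "comm r (p - q) = comm r p - comm r q"
  "comm (pscale \<alpha> p) r = pscale \<alpha> (comm p r)" "comm r (pscale \<alpha> p) = pscale \<alpha> (comm r p)"
  "comm p p = 0" "comm 0 p = 0" "comm p 0 = 0" "comm (- p) q = - comm p q" "comm p (- q) = - comm p q"
  by (simp_all add: comm_def algebra_simps pscale_mult_left pscale_mult_right ncpoly.scale_right_diff_distrib)

lemma comm_antisym: "comm p q = - comm q p"
  by (simp add: comm_def)

lemma lie_algebra_free: "lie_algebra (free_lie X :: ('k::field, ('x, 'k) ncpoly) module)"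
proof (rule lie_algebraI)
  show "abelian_group (free_lie X :: ('k::field, ('x, 'k) ncpoly) module)"
    by (rule abelian_groupI) (auto simp: algebra_simps intro: Lie.intros bexI[of _ "- x" for x] Lie_minus)
  show "lie_algebra_axioms (free_lie X :: ('k::field, ('x, 'k) ncpoly) module)"
    by (unfold_locales) (auto simp: comm_simps intro: Lie.intros, simp add: comm_def algebra_simps)
qed (auto simp: ncpoly.scale_left_distrib ncpoly.scale_right_distrib intro: Lie.intros)

definition lie_prod :: "('k::field, 'v) module \<Rightarrow> ('k, 'w) module \<Rightarrow> ('k, 'v \<times> 'w) module" where
  "lie_prod L M = \<lparr>carrier = carrier L \<times> carrier M,
     mult = (\<lambda>x y. (fst x \<otimes>\<^bsub>L\<^esub> fst y, snd x \<otimes>\<^bsub>M\<^esub> snd y)), one = undefined, zero = (\<zero>\<^bsub>L\<^esub>, \<zero>\<^bsub>M\<^esub>),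
     add = (\<lambda>x y. (fst x \<oplus>\<^bsub>L\<^esub> fst y, snd x \<oplus>\<^bsub>M\<^esub> snd y)),
     smult = (\<lambda>\<alpha> x. (\<alpha> \<odot>\<^bsub>L\<^esub> fst x, \<alpha> \<odot>\<^bsub>M\<^esub> snd x))\<rparr>"

lemma lie_prod_simps [simp]:
  "carrier (lie_prod L M) = carrier L \<times> carrier M" "\<zero>\<^bsub>lie_prod L M\<^esub> = (\<zero>\<^bsub>L\<^esub>, \<zero>\<^bsub>M\<^esub>)"
  "x \<otimes>\<^bsub>lie_prod L M\<^esub> y = (fst x \<otimes>\<^bsub>L\<^esub> fst y, snd x \<otimes>\<^bsub>M\<^esub> snd y)"
  "x \<oplus>\<^bsub>lie_prod L M\<^esub> y = (fst x \<oplus>\<^bsub>L\<^esub> fst y, snd x \<oplus>\<^bsub>M\<^esub> snd y)"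
  "\<alpha> \<odot>\<^bsub>lie_prod L M\<^esub> x = (\<alpha> \<odot>\<^bsub>L\<^esub> fst x, \<alpha> \<odot>\<^bsub>M\<^esub> snd x)"
  by (simp_all add: lie_prod_def)

lemma lie_algebra_prod:
  assumes "lie_algebra L" "lie_algebra M"
  shows "lie_algebra (lie_prod L M)"
proof -
  interpret L: lie_algebra L by fact
  interpret M: lie_algebra M by fact
  show ?thesis
  proof (rule lie_algebraI)
    show "abelian_group (lie_prod L M)"
    proof (rule abelian_groupI)
      fix x assume "x \<in> carrier (lie_prod L M)"
      then show "\<exists>y\<in>carrier (lie_prod L M). y \<oplus>\<^bsub>lie_prod L M\<^esub> x = \<zero>\<^bsub>lie_prod L M\<^esub>"
        by (intro bexI[of _ "(\<ominus>\<^bsub>L\<^esub> fst x, \<ominus>\<^bsub>M\<^esub> snd x)"]) (auto simp: L.l_neg M.l_neg)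
    qed (auto simp: L.a_ac M.a_ac)
    show "lie_algebra_axioms (lie_prod L M)"
      by unfold_locales
        (auto simp: L.bracket_add_left M.bracket_add_left L.bracket_add_right M.bracket_add_right
          L.bracket_smult_left M.bracket_smult_left L.bracket_smult_right M.bracket_smult_right
          L.bracket_self M.bracket_self L.jacobi M.jacobi)
  qed (auto simp: L.smult_laws M.smult_laws)
qed


section \<open>The Lyndon-Shirshov basis and the universal property\<close>

primrec eval_in :: "('k::field, 'v) module \<Rightarrow> ('x \<Rightarrow> 'v) \<Rightarrow> 'x naword \<Rightarrow> 'v" where
  "eval_in L f (Single x) = f x"
| "eval_in L f (Bracket s t) = eval_in L f s \<otimes>\<^bsub>L\<^esub> eval_in L f t"

definition nlsws :: "'x::wellorder set \<Rightarrow> 'x naword set" where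
  "nlsws X = {t. nlsw t \<and> set (word t) \<subseteq> X}"

definition nlsws_above :: "'x::wellorder set \<Rightarrow> nat \<Rightarrow> 'x list \<Rightarrow> 'x naword set" where
  "nlsws_above X n z = {t \<in> nlsws X. length (word t) = n \<and> word t \<succ> z}"

context lie_algebra
begin

lemma eval_in_closed: "f \<in> X \<rightarrow> carrier L \<Longrightarrow> set (word t) \<subseteq> X \<Longrightarrow> eval_in L f t \<in> carrier L"
  by (induction t) auto

text \<open>
  If \<open>[st]\<close> with \<open>s = [s\<^sub>1s\<^sub>2]\<close> violates the last condition on bracketings, it is rewritten by the
  Jacobi identity to \<open>[[s\<^sub>1t]s\<^sub>2] + [s\<^sub>1[s\<^sub>2t]]\<close>.  The inner brackets are shorter, and the smaller factor of
  the outer ones has grown; there are only finitely many words of bounded length.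
\<close>

lemma nlsw_bracket:
  assumes X: "finite X" and f: "f \<in> X \<rightarrow> carrier L"
  shows "s \<in> nlsws X \<Longrightarrow> t \<in> nlsws X \<Longrightarrow> word s \<succ> word t \<Longrightarrow> length (word s) + length (word t) = n \<Longrightarrow>
    eval_in L f s \<otimes> eval_in L f t \<in> lspan L (eval_in L f ` nlsws_above X n (word t))"
proof (induction n arbitrary: s t rule: less_induct)
  case (less n)
  note IH_n = less.IH
  have ev: "eval_in L f t \<in> carrier L" if "t \<in> nlsws X" for t
    using that eval_in_closed[OF f] by (simp add: nlsws_def)
  have sub: "eval_in L f ` nlsws_above X m z \<subseteq> carrier L" for m z
    using ev by (auto simp: nlsws_above_def)
  show ?case
    using less.prems
  proof (induction "card {w. set w \<subseteq> X \<and> length w \<le> n \<and> w \<succ> word t}" arbitrary: s t rule: less_induct)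
    case less
    note st = less.prems
    show ?case
    proof (cases "nlsw (Bracket s t)")
      case True
      then have "Bracket s t \<in> nlsws_above X n (word t)"
        using st alsw_suffix[of "word s" "word t"] by (auto simp: nlsws_above_def nlsws_def)
      then show ?thesis by (intro lspan.base) force
    next
      case False
      moreover have "alsw (word s @ word t)"
        using st nlsw_alsw by (auto simp: nlsws_def intro: alsw_append)
      ultimately obtain s1 s2 where s: "s = Bracket s1 s2" and s2: "word s2 \<succ> word t"
        using st by (cases s) (auto simp: nlsws_def lex_le_iff)
      have s12: "s1 \<in> nlsws X" "s2 \<in> nlsws X" and alsw_s: "alsw (word s1 @ word s2)"
        using st s by (auto simp: nlsws_def)
      have s1: "word s1 \<succ> word t"
        using lex_greater_prefix[of "word s2" "word s1"] alsw_suffix[OF alsw_s] s2 lex_greater_trans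
        by (metis word_nonempty)
      have outer: "eval_in L f r1 \<otimes> eval_in L f r2 \<in> lspan L (eval_in L f ` nlsws_above X n (word t))"
        if r: "r1 \<in> nlsws X" "r2 \<in> nlsws X" "length (word r1) + length (word r2) = n" "word r1 \<succ> word t" "word r2 \<succ> word t" for r1 r2
      proof -
        have *: "eval_in L f r1 \<otimes> eval_in L f r2 \<in> lspan L (eval_in L f ` nlsws_above X n (word t))"
          if r: "r1 \<in> nlsws X" "r2 \<in> nlsws X" "length (word r1) + length (word r2) = n" "word r2 \<succ> word t" "word r1 \<succ> word r2" for r1 r2
        proof -
          have "finite {w. set w \<subseteq> X \<and> length w \<le> n \<and> w \<succ> word t}"
            by (rule finite_subset[OF _ finite_lists_length_le[OF X, of n]]) auto
          moreover have "{w. set w \<subseteq> X \<and> length w \<le> n \<and> w \<succ> word r2} \<subset> {w. set w \<subseteq> X \<and> length w \<le> n \<and> w \<succ> word t}"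
          proof (rule psubsetI)
            show "{w. set w \<subseteq> X \<and> length w \<le> n \<and> w \<succ> word r2} \<subseteq> {w. set w \<subseteq> X \<and> length w \<le> n \<and> w \<succ> word t}"
              using lex_greater_trans[OF _ r(4)] by blast
            have "word r2 \<in> {w. set w \<subseteq> X \<and> length w \<le> n \<and> w \<succ> word t}"
              using r by (auto simp: nlsws_def)
            then show "{w. set w \<subseteq> X \<and> length w \<le> n \<and> w \<succ> word r2} \<noteq> {w. set w \<subseteq> X \<and> length w \<le> n \<and> w \<succ> word t}"
              by force
          qed
          ultimately have "eval_in L f r1 \<otimes> eval_in L f r2 \<in> lspan L (eval_in L f ` nlsws_above X n (word r2))"
            using less.hyps[of r2 r1] r psubset_card_mono by blast
          then show ?thesis
            by (rule lspan_mono) (use lex_greater_trans[OF _ r(4)] in \<open>auto simp: nlsws_above_def\<close>)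
        qed
        consider "r1 = r2" | "word r1 \<succ> word r2" | "word r2 \<succ> word r1"
          using lex_greater_total nlsw_unique r(1,2) by (auto simp: nlsws_def)
        then show ?thesis
        proof cases
          case 1
          then show ?thesis using bracket_self ev r by (simp add: lspan.zero)
        next
          case 2
          then show ?thesis using *[of r1 r2] r by blast
        next
          case 3
          then have "\<ominus> (eval_in L f r2 \<otimes> eval_in L f r1) \<in> lspan L (eval_in L f ` nlsws_above X n (word t))"
            using *[of r2 r1] r by (intro lspan_minus sub) auto
          then show ?thesis using bracket_antisym[of "eval_in L f r1" "eval_in L f r2"] ev r by simp
        qed
      qed
      have len: "length (word s1) + length (word t) < n" "length (word s2) + length (word t) < n"
        using st s by (auto simp: length_greater_0_conv)
      have "(eval_in L f s1 \<otimes> eval_in L f t) \<otimes> eval_in L f s2 \<in> lspan L (eval_in L f ` nlsws_above X n (word t))"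
      proof (rule lspan_bracket[OF IH_n[OF len(1) s12(1) _ s1] lspan.base[of "eval_in L f s2" "{eval_in L f s2}"]])
        fix a b assume "a \<in> eval_in L f ` nlsws_above X (length (word s1) + length (word t)) (word t)" "b \<in> {eval_in L f s2}"
        then show "a \<otimes> b \<in> lspan L (eval_in L f ` nlsws_above X n (word t))"
          using s12 s2 st s outer by (auto simp: nlsws_above_def)
      qed (use st s12 ev sub in auto)
      moreover have "eval_in L f s1 \<otimes> (eval_in L f s2 \<otimes> eval_in L f t) \<in> lspan L (eval_in L f ` nlsws_above X n (word t))"
      proof (rule lspan_bracket[OF lspan.base[of "eval_in L f s1" "{eval_in L f s1}"] IH_n[OF len(2) s12(2) _ s2]])
        fix a b assume "a \<in> {eval_in L f s1}" "b \<in> eval_in L f ` nlsws_above X (length (word s2) + length (word t)) (word t)"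
        then show "a \<otimes> b \<in> lspan L (eval_in L f ` nlsws_above X n (word t))"
          using s12 s1 st s outer by (auto simp: nlsws_above_def)
      qed (use st s12 ev sub in auto)
      ultimately show ?thesis
        using bracket_leibniz[of "eval_in L f s1" "eval_in L f s2" "eval_in L f t"] s12 ev st
        by (simp add: s lspan.add)
    qed
  qed
qed

lemma nlsw_span_bracket:
  assumes f: "f \<in> X \<rightarrow> carrier L"
    and x: "x \<in> lspan L (eval_in L f ` nlsws X)" and y: "y \<in> lspan L (eval_in L f ` nlsws X)"
  shows "x \<otimes> y \<in> lspan L (eval_in L f ` nlsws X)"
proof (rule lspan_bracket[OF x y])
  have ev: "eval_in L f t \<in> carrier L" if "t \<in> nlsws X" for t
    using that eval_in_closed[OF f] by (simp add: nlsws_def)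
  then show "eval_in L f ` nlsws X \<subseteq> carrier L" "eval_in L f ` nlsws X \<subseteq> carrier L" by auto
  have *: "eval_in L f s \<otimes> eval_in L f t \<in> lspan L (eval_in L f ` nlsws X)"
    if st: "s \<in> nlsws X" "t \<in> nlsws X" "word s \<succ> word t" for s t
  proof -
    let ?Y = "set (word s) \<union> set (word t)"
    have "eval_in L f s \<otimes> eval_in L f t \<in>
        lspan L (eval_in L f ` nlsws_above ?Y (length (word s) + length (word t)) (word t))"
      by (rule nlsw_bracket) (use st f in \<open>auto simp: nlsws_def\<close>)
    then show ?thesis
      by (rule lspan_mono) (use st in \<open>auto simp: nlsws_above_def nlsws_def\<close>)
  qed
  fix a b assume "a \<in> eval_in L f ` nlsws X" "b \<in> eval_in L f ` nlsws X"
  then obtain s t where st: "s \<in> nlsws X" "t \<in> nlsws X" "a = eval_in L f s" "b = eval_in L f t" by blast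
  consider "s = t" | "word s \<succ> word t" | "word t \<succ> word s"
    using lex_greater_total nlsw_unique st(1,2) by (auto simp: nlsws_def)
  then show "a \<otimes> b \<in> lspan L (eval_in L f ` nlsws X)"
  proof cases
    case 1
    then show ?thesis using bracket_self ev st by (simp add: lspan.zero)
  next
    case 2
    then show ?thesis using * st by blast
  next
    case 3
    then have "\<ominus> (b \<otimes> a) \<in> lspan L (eval_in L f ` nlsws X)"
      using * st ev by (intro lspan_minus) auto
    then show ?thesis using bracket_antisym[of a b] ev st by simp
  qed
qed

end

lemma lin_comb_free:
  fixes f :: "'a \<Rightarrow> ('x, 'k::field) ncpoly"
  assumes "Poly_Mapping.keys c \<subseteq> A" "f \<in> A \<rightarrow> Lie X"
  shows "lin_comb (free_lie X) f c = (\<Sum>x\<in>Poly_Mapping.keys c. pscale (Poly_Mapping.lookup c x) (f x))"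
proof -
  interpret lie_algebra "free_lie X :: ('k, ('x, 'k) ncpoly) module" by (rule lie_algebra_free)
  have "finsum (free_lie X) g K = sum g K" if "finite K" "g \<in> K \<rightarrow> Lie X" for g :: "'a \<Rightarrow> ('x, 'k) ncpoly" and K
    using that by (induction K) (auto simp: Pi_def)
  moreover have "(\<lambda>x. pscale (Poly_Mapping.lookup c x) (f x)) \<in> Poly_Mapping.keys c \<rightarrow> Lie X"
    using assms by (auto intro!: Lie.scale)
  ultimately have "finsum (free_lie X) (\<lambda>x. pscale (Poly_Mapping.lookup c x) (f x)) (Poly_Mapping.keys c) =
      (\<Sum>x\<in>Poly_Mapping.keys c. pscale (Poly_Mapping.lookup c x) (f x))"
    by (metis finite_keys)
  then show ?thesis by (simp add: lin_comb_def)
qed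

text \<open>
  The leading words of the bracketings are distinct, so the largest word of a linear combination
  cannot cancel.
\<close>

lemma nlsw_comb_lead:
  assumes "\<forall>t\<in>Poly_Mapping.keys c. nlsw t" "c \<noteq> 0"
  defines "p \<equiv> \<Sum>t\<in>Poly_Mapping.keys c. pscale (Poly_Mapping.lookup c t) (lie_eval t)"
  shows "p \<noteq> 0 \<and> (\<exists>t\<in>Poly_Mapping.keys c. lead p = word t)"
proof -
  let ?K = "Poly_Mapping.keys c"
  have "word ` ?K \<noteq> {}" using assms(2) by simp
  then obtain t where t: "t \<in> ?K" "word t = Max (word ` ?K)"
    using Max_in[of "word ` ?K"] by (metis finite_imageI finite_keys imageE)
  have less: "word s < word t" if "s \<in> ?K" "s \<noteq> t" for s
    using that t assms(1) nlsw_unique Max_ge[of "word ` ?K" "word s"] by (metis finite_imageI finite_keys imageI order_le_less)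
  have lk: "Poly_Mapping.lookup (lie_eval s :: ('a, 'b) ncpoly) w = 0" if "s \<in> ?K" "word s < w" for s w
    using lie_eval_monic_at[of s] assms(1) that by (auto simp: monic_at_iff)
  have "Poly_Mapping.lookup p (word t) = (\<Sum>s\<in>?K. if s = t then Poly_Mapping.lookup c t else 0)"
    unfolding p_def lookup_sum lookup_pscale
    by (rule sum.cong) (use lk less t lie_eval_monic_at[of t] assms(1) in \<open>auto simp: monic_at_iff\<close>)
  then have nz: "Poly_Mapping.lookup p (word t) \<noteq> 0" using t by (simp add: in_keys_iff)
  have high: "Poly_Mapping.lookup p w = 0" if "word t < w" for w
    unfolding p_def lookup_sum lookup_pscale
    by (rule sum.neutral) (use lk less t that order_less_trans in \<open>metis mult_zero_right\<close>)
  have "lead p = word t"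
    unfolding lead_def
    by (rule Max_eqI) (use nz high in \<open>auto simp: in_keys_iff not_less[symmetric]\<close>)
  then show ?thesis using nz t(1) by (metis lookup_zero)
qed

text \<open>
  The span of the bracketings evaluated at the pairs \<open>(x, \<phi> x)\<close>.  By the rewriting above it is closed under
  brackets, so it is the subalgebra of \<open>Lie X \<times> L\<close> generated by these pairs, which is to be the graph of the
  homomorphism extending \<open>\<phi>\<close>.
\<close>

definition lie_graph :: "'x::wellorder set \<Rightarrow> ('k::field, 'v) module \<Rightarrow> ('x \<Rightarrow> 'v) \<Rightarrow> (('x, 'k) ncpoly \<times> 'v) set" where
  "lie_graph X L \<phi> = lspan (lie_prod (free_lie X) L) (eval_in (lie_prod (free_lie X) L) (\<lambda>x. (letter x, \<phi> x)) ` nlsws X)"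

lemma eval_in_prod:
  "eval_in (lie_prod (free_lie X) L) (\<lambda>x. (letter x, \<phi> x)) t = (lie_eval t, eval_in L \<phi> t)"
  by (induction t) auto

context lie_algebra
begin

context
  fixes X :: "'x::wellorder set" and \<phi> :: "'x \<Rightarrow> 'v"
  assumes \<phi>: "\<phi> \<in> X \<rightarrow> carrier L"
begin

interpretation P: lie_algebra "lie_prod (free_lie X) L"
  by (rule lie_algebra_prod[OF lie_algebra_free lie_algebra_axioms])

lemma lie_graph_carrier: "(p, q) \<in> lie_graph X L \<phi> \<Longrightarrow> p \<in> Lie X \<and> q \<in> carrier L"
proof -
  have "eval_in (lie_prod (free_lie X) L) (\<lambda>x. (letter x, \<phi> x)) ` nlsws X \<subseteq> carrier (lie_prod (free_lie X) L)"
    using eval_in_closed[OF \<phi>] by (auto simp: nlsws_def eval_in_prod intro: lie_eval_Lie)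
  moreover assume "(p, q) \<in> lie_graph X L \<phi>"
  ultimately show ?thesis unfolding lie_graph_def using P.lspan_closed by fastforce
qed

lemma lie_graph_total: "p \<in> Lie X \<Longrightarrow> \<exists>q. (p, q) \<in> lie_graph X L \<phi>"
proof (induction rule: Lie.induct)
  case zero
  then show ?case using lspan.zero[of "lie_prod (free_lie X) L"] unfolding lie_graph_def by auto
next
  case (letter x)
  then have "Single x \<in> nlsws X" by (simp add: nlsws_def)
  then have "(letter x, \<phi> x) \<in> lie_graph X L \<phi>"
    unfolding lie_graph_def by (intro lspan.base image_eqI[of _ _ "Single x"]) auto
  then show ?case by blast
next
  case (add p q)
  then show ?case unfolding lie_graph_def using lspan.add[of _ "lie_prod (free_lie X) L"] by fastforce
next
  case (scale p \<alpha>)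
  then show ?case unfolding lie_graph_def using lspan.smult[of _ "lie_prod (free_lie X) L"] by fastforce
next
  case (comm p q)
  then obtain p' q' where "(p, p') \<in> lie_graph X L \<phi>" "(q, q') \<in> lie_graph X L \<phi>" by blast
  then have "(p, p') \<otimes>\<^bsub>lie_prod (free_lie X) L\<^esub> (q, q') \<in> lie_graph X L \<phi>"
    unfolding lie_graph_def using \<phi>
    by (intro P.nlsw_span_bracket) (auto simp: Pi_def intro: Lie.letter)
  then show ?case by auto
qed

lemma lie_graph_lin_comb:
  assumes "(p, q) \<in> lie_graph X L \<phi>"
  shows "\<exists>c. Poly_Mapping.keys c \<subseteq> nlsws X \<and> p = lin_comb (free_lie X) lie_eval c \<and> q = lin_comb L (eval_in L \<phi>) c"
proof -
  interpret F: lie_algebra "free_lie X :: ('k, ('x, 'k) ncpoly) module" by (rule lie_algebra_free)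
  have ev: "(lie_eval :: _ \<Rightarrow> ('x, 'k) ncpoly) \<in> nlsws X \<rightarrow> carrier (free_lie X)" "eval_in L \<phi> \<in> nlsws X \<rightarrow> carrier L"
    using eval_in_closed[OF \<phi>] by (auto simp: nlsws_def intro: lie_eval_Lie)
  have "x \<in> lie_graph X L \<phi> \<Longrightarrow> \<exists>c. Poly_Mapping.keys c \<subseteq> nlsws X \<and> fst x = lin_comb (free_lie X) lie_eval c \<and>
      snd x = lin_comb L (eval_in L \<phi>) c" for x
    unfolding lie_graph_def
  proof (induction rule: lspan.induct)
    case zero
    then show ?case by (intro exI[of _ 0]) (simp add: F.lin_comb_zero[simplified])
  next
    case (base x)
    then obtain t where t: "t \<in> nlsws X" "x = (lie_eval t, eval_in L \<phi> t)" by (auto simp: eval_in_prod)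
    then have "(lie_eval t :: ('x, 'k) ncpoly) \<in> Lie X" by (auto simp: nlsws_def intro: lie_eval_Lie)
    then show ?case using t ev F.lin_comb_single[of lie_eval t 1] lin_comb_single[of "eval_in L \<phi>" t 1] smult_laws(5)
      by (intro exI[of _ "Poly_Mapping.single t 1"]) (auto simp: Pi_def)
  next
    case (add x y)
    then obtain c d where "Poly_Mapping.keys c \<subseteq> nlsws X" "fst x = lin_comb (free_lie X) lie_eval c" "snd x = lin_comb L (eval_in L \<phi>) c"
      "Poly_Mapping.keys d \<subseteq> nlsws X" "fst y = lin_comb (free_lie X) lie_eval d" "snd y = lin_comb L (eval_in L \<phi>) d"
      by blast
    then show ?case using F.lin_comb_add[OF ev(1)] lin_comb_add[OF ev(2)] keys_add[of c d]
      by (intro exI[of _ "c + d"]) auto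
  next
    case (smult x \<alpha>)
    then obtain c where "Poly_Mapping.keys c \<subseteq> nlsws X" "fst x = lin_comb (free_lie X) lie_eval c" "snd x = lin_comb L (eval_in L \<phi>) c"
      by blast
    then show ?case using F.lin_comb_smult[OF ev(1)] lin_comb_smult[OF ev(2)] keys_scaled[of \<alpha> c]
      by (intro exI[of _ "Poly_Mapping.map ((*) \<alpha>) c"]) auto
  qed
  from this[OF assms] show ?thesis by simp
qed

lemma lie_graph_zero:
  assumes "(0, q) \<in> lie_graph X L \<phi>"
  shows "q = \<zero>"
proof -
  obtain c where c: "Poly_Mapping.keys c \<subseteq> nlsws X" "0 = lin_comb (free_lie X) (lie_eval :: _ \<Rightarrow> ('x, 'k) ncpoly) c" "q = lin_comb L (eval_in L \<phi>) c"
    using lie_graph_lin_comb[OF assms] by blast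
  interpret F: lie_algebra "free_lie X :: ('k, ('x, 'k) ncpoly) module" by (rule lie_algebra_free)
  have ev: "(lie_eval :: _ \<Rightarrow> ('x, 'k) ncpoly) \<in> nlsws X \<rightarrow> Lie X"
    by (auto simp: nlsws_def intro: lie_eval_Lie)
  have "c = 0"
    using nlsw_comb_lead[of c] c(1,2) unfolding lin_comb_free[OF c(1) ev] by (auto simp: nlsws_def)
  then show ?thesis using c by simp
qed

text \<open>
  The graph is single-valued: if the first component of a linear combination of evaluated bracketings
  vanishes, all its coefficients do, and so does the second component.
\<close>

theorem free_lie_universal:
  "\<exists>\<sigma>\<in>lie_hom (free_lie X) L. \<forall>x\<in>X. \<sigma> (letter x) = \<phi> x"
proof -
  let ?P = "lie_prod (free_lie X) L"
  have unique: "q = q'" if "(p, q) \<in> lie_graph X L \<phi>" "(p, q') \<in> lie_graph X L \<phi>" for p q q'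
  proof -
    have "(p, q) \<oplus>\<^bsub>?P\<^esub> ((-1) \<odot>\<^bsub>?P\<^esub> (p, q')) \<in> lie_graph X L \<phi>"
      using that unfolding lie_graph_def by (intro lspan.add lspan.smult)
    then have "(0, q \<ominus> q') \<in> lie_graph X L \<phi>"
      using lie_graph_carrier[OF that(2)] by (simp add: pscale_minus_one minus_smult a_minus_def)
    from lie_graph_zero[OF this] show ?thesis
      using lie_graph_carrier[OF that(1)] lie_graph_carrier[OF that(2)] minus_eq_zero by blast
  qed
  define \<sigma> where "\<sigma> p = (SOME q. (p, q) \<in> lie_graph X L \<phi>)" for p
  have graph: "(p, \<sigma> p) \<in> lie_graph X L \<phi>" if "p \<in> Lie X" for p
    unfolding \<sigma>_def using lie_graph_total[OF that] by (rule someI_ex)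
  have "\<sigma> \<in> lie_hom (free_lie X) L"
    unfolding lie_hom_def
  proof (intro CollectI conjI ballI allI)
    show "\<sigma> \<in> carrier (free_lie X) \<rightarrow> carrier L" using graph lie_graph_carrier by fastforce
  next
    fix p q :: "('x, 'k) ncpoly" assume "p \<in> carrier (free_lie X)" "q \<in> carrier (free_lie X)"
    then have pq: "p \<in> Lie X" "q \<in> Lie X" by simp_all
    have "(p, \<sigma> p) \<oplus>\<^bsub>?P\<^esub> (q, \<sigma> q) \<in> lie_graph X L \<phi>"
      using graph pq unfolding lie_graph_def by (intro lspan.add)
    then show "\<sigma> (p \<oplus>\<^bsub>free_lie X\<^esub> q) = \<sigma> p \<oplus> \<sigma> q"
      using unique graph[OF Lie.add[OF pq]] by simp
    have "(p, \<sigma> p) \<otimes>\<^bsub>?P\<^esub> (q, \<sigma> q) \<in> lie_graph X L \<phi>"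
      using graph pq \<phi> unfolding lie_graph_def
      by (intro P.nlsw_span_bracket) (auto simp: Pi_def intro: Lie.letter)
    then show "\<sigma> (p \<otimes>\<^bsub>free_lie X\<^esub> q) = \<sigma> p \<otimes> \<sigma> q"
      using unique graph[OF Lie.comm[OF pq]] by simp
  next
    fix \<alpha> :: 'k and p :: "('x, 'k) ncpoly" assume "p \<in> carrier (free_lie X)"
    then have p: "p \<in> Lie X" by simp
    have "\<alpha> \<odot>\<^bsub>?P\<^esub> (p, \<sigma> p) \<in> lie_graph X L \<phi>"
      using graph p unfolding lie_graph_def by (intro lspan.smult)
    then have "(pscale \<alpha> p, \<alpha> \<odot> \<sigma> p) \<in> lie_graph X L \<phi>" by simp
    from unique[OF graph[OF Lie.scale[OF p]] this]
    show "\<sigma> (\<alpha> \<odot>\<^bsub>free_lie X\<^esub> p) = \<alpha> \<odot> \<sigma> p" by simp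
  qed
  moreover have "\<sigma> (letter x) = \<phi> x" if "x \<in> X" for x
  proof -
    have "Single x \<in> nlsws X" using that by (simp add: nlsws_def)
    then have "(letter x, \<phi> x) \<in> lie_graph X L \<phi>"
      unfolding lie_graph_def by (intro lspan.base image_eqI[of _ _ "Single x"]) auto
    then show ?thesis using unique graph[OF Lie.letter[OF that]] by blast
  qed
  ultimately show ?thesis by blast
qed

end

end

theorem Lie_nlsw_comb:
  fixes p :: "('x::wellorder, 'k::field) ncpoly"
  assumes "p \<in> Lie X"
  obtains c where "Poly_Mapping.keys c \<subseteq> nlsws X"
    "p = (\<Sum>t\<in>Poly_Mapping.keys c. pscale (Poly_Mapping.lookup c t) (lie_eval t))"
proof -
  interpret F: lie_algebra "free_lie X :: ('k, ('x, 'k) ncpoly) module" by (rule lie_algebra_free)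
  have "letter \<in> X \<rightarrow> carrier (free_lie X)" by (auto intro: Lie.letter)
  from F.lie_graph_total[OF this assms] F.lie_graph_lin_comb[OF this]
  obtain c where c: "Poly_Mapping.keys c \<subseteq> nlsws X" "p = lin_comb (free_lie X) lie_eval c" by blast
  have "(lie_eval :: _ \<Rightarrow> ('x, 'k) ncpoly) \<in> nlsws X \<rightarrow> Lie X"
    by (auto simp: nlsws_def intro: lie_eval_Lie)
  from lin_comb_free[OF c(1) this] c that show ?thesis by metis
qed

corollary Lie_lead_ALSW:
  assumes "p \<in> Lie X" "p \<noteq> 0"
  shows "lead p \<in> ALSW X"
proof -
  obtain c where c: "Poly_Mapping.keys c \<subseteq> nlsws X"
    "p = (\<Sum>t\<in>Poly_Mapping.keys c. pscale (Poly_Mapping.lookup c t) (lie_eval t))"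
    using Lie_nlsw_comb[OF assms(1)] .
  then have "c \<noteq> 0" using assms(2) by auto
  then obtain t where "t \<in> Poly_Mapping.keys c" "lead p = word t"
    using nlsw_comb_lead[of c] c by (auto simp: nlsws_def)
  then show ?thesis using c(1) nlsw_alsw by (auto simp: nlsws_def ALSW_def lists_eq_set)
qed

section \<open>Homomorphisms and presentations\<close>

lemma lie_homI:
  assumes "\<And>x. x \<in> carrier L \<Longrightarrow> h x \<in> carrier M"
    and "\<And>x y. x \<in> carrier L \<Longrightarrow> y \<in> carrier L \<Longrightarrow> h (x \<oplus>\<^bsub>L\<^esub> y) = h x \<oplus>\<^bsub>M\<^esub> h y"
    and "\<And>\<alpha> x. x \<in> carrier L \<Longrightarrow> h (\<alpha> \<odot>\<^bsub>L\<^esub> x) = \<alpha> \<odot>\<^bsub>M\<^esub> h x"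
    and "\<And>x y. x \<in> carrier L \<Longrightarrow> y \<in> carrier L \<Longrightarrow> h (x \<otimes>\<^bsub>L\<^esub> y) = h x \<otimes>\<^bsub>M\<^esub> h y"
  shows "h \<in> lie_hom L M"
  using assms unfolding lie_hom_def by auto

lemma lie_homD:
  assumes "h \<in> lie_hom L M"
  shows "\<And>x. x \<in> carrier L \<Longrightarrow> h x \<in> carrier M"
    and "\<And>x y. x \<in> carrier L \<Longrightarrow> y \<in> carrier L \<Longrightarrow> h (x \<oplus>\<^bsub>L\<^esub> y) = h x \<oplus>\<^bsub>M\<^esub> h y"
    and "\<And>\<alpha> x. x \<in> carrier L \<Longrightarrow> h (\<alpha> \<odot>\<^bsub>L\<^esub> x) = \<alpha> \<odot>\<^bsub>M\<^esub> h x"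
    and "\<And>x y. x \<in> carrier L \<Longrightarrow> y \<in> carrier L \<Longrightarrow> h (x \<otimes>\<^bsub>L\<^esub> y) = h x \<otimes>\<^bsub>M\<^esub> h y"
  using assms unfolding lie_hom_def by auto

lemma lie_hom_comp: "g \<in> lie_hom L M \<Longrightarrow> h \<in> lie_hom M N \<Longrightarrow> (\<lambda>x. h (g x)) \<in> lie_hom L N"
  by (rule lie_homI) (auto simp: lie_homD)

lemma lie_hom_zero:
  assumes "h \<in> lie_hom L M" "lie_algebra L" "lie_algebra M"
  shows "h \<zero>\<^bsub>L\<^esub> = \<zero>\<^bsub>M\<^esub>"
proof -
  interpret L: lie_algebra L by fact
  interpret M: lie_algebra M by fact
  show ?thesis using lie_homD(3)[OF assms(1), of "\<zero>\<^bsub>L\<^esub>" 0] lie_homD(1)[OF assms(1), of "\<zero>\<^bsub>L\<^esub>"] by simp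
qed

lemma lie_hom_minus:
  assumes "h \<in> lie_hom L M" "lie_algebra L" "lie_algebra M" "x \<in> carrier L" "y \<in> carrier L"
  shows "h (x \<ominus>\<^bsub>L\<^esub> y) = h x \<ominus>\<^bsub>M\<^esub> h y"
proof -
  interpret L: lie_algebra L by fact
  interpret M: lie_algebra M by fact
  have "h (\<ominus>\<^bsub>L\<^esub> y) = \<ominus>\<^bsub>M\<^esub> h y"
    using lie_homD(3)[OF assms(1,5), of "-1"] lie_homD(1)[OF assms(1,5)] L.minus_smult[OF assms(5)] M.minus_smult by simp
  then show ?thesis using lie_homD(2)[OF assms(1)] assms(4,5) by (simp add: a_minus_def)
qed

lemma lie_hom_inj_on:
  assumes "h \<in> lie_hom L M" "lie_algebra L" "lie_algebra M"
    and "\<And>x. x \<in> carrier L \<Longrightarrow> h x = \<zero>\<^bsub>M\<^esub> \<Longrightarrow> x = \<zero>\<^bsub>L\<^esub>"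
  shows "inj_on h (carrier L)"
proof (rule inj_onI)
  interpret L: lie_algebra L by fact
  interpret M: lie_algebra M by fact
  fix x y assume xy: "x \<in> carrier L" "y \<in> carrier L" "h x = h y"
  then have "h (x \<ominus>\<^bsub>L\<^esub> y) = \<zero>\<^bsub>M\<^esub>"
    using lie_hom_minus[OF assms(1-3)] lie_homD(1)[OF assms(1)] M.minus_eq_zero by metis
  then have "x \<ominus>\<^bsub>L\<^esub> y = \<zero>\<^bsub>L\<^esub>" using assms(4) xy by simp
  then show "x = y" using L.minus_eq_zero xy by blast
qed

lemma lie_hom_inverse:
  assumes h: "h \<in> lie_hom L M" and L: "lie_algebra L" and bij: "bij_betw h (carrier L) (carrier M)"
  shows "inv_into (carrier L) h \<in> lie_hom M L"
proof (rule lie_homI)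
  interpret L: lie_algebra L by fact
  let ?g = "inv_into (carrier L) h"
  show g: "?g x \<in> carrier L" if "x \<in> carrier M" for x
    using bij that bij_betw_imp_surj_on inv_into_into by metis
  have hg: "h (?g x) = x" if "x \<in> carrier M" for x using bij that by (simp add: bij_betw_inv_into_right)
  have eq: "?g x = y" if "y \<in> carrier L" "h y = x" for x y using bij that bij_betw_inv_into_left by metis
  show "?g (x \<oplus>\<^bsub>M\<^esub> y) = ?g x \<oplus>\<^bsub>L\<^esub> ?g y" if "x \<in> carrier M" "y \<in> carrier M" for x y
    using that by (intro eq) (auto simp: g hg lie_homD[OF h])
  show "?g (\<alpha> \<odot>\<^bsub>M\<^esub> x) = \<alpha> \<odot>\<^bsub>L\<^esub> ?g x" if "x \<in> carrier M" for \<alpha> x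
    using that by (intro eq) (auto simp: g hg lie_homD[OF h])
  show "?g (x \<otimes>\<^bsub>M\<^esub> y) = ?g x \<otimes>\<^bsub>L\<^esub> ?g y" if "x \<in> carrier M" "y \<in> carrier M" for x y
    using that by (intro eq) (auto simp: g hg lie_homD[OF h])
qed

lemma lie_hom_free_eq:
  assumes "g \<in> lie_hom (free_lie X) L" "h \<in> lie_hom (free_lie X) L" "lie_algebra L"
    and "\<And>x. x \<in> X \<Longrightarrow> g (letter x) = h (letter x)" and "p \<in> Lie X"
  shows "g p = h p"
  using assms(5)
proof (induction rule: Lie.induct)
  case zero
  then show ?case using lie_hom_zero[OF assms(1) lie_algebra_free assms(3)] lie_hom_zero[OF assms(2) lie_algebra_free assms(3)] by simp
qed (use assms(4) lie_homD[OF assms(1)] lie_homD[OF assms(2)] in auto)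


subsection \<open>Quotients of free Lie algebras\<close>

definition rel_coset :: "'x set \<Rightarrow> ('x, 'k::field) ncpoly set \<Rightarrow> ('x, 'k) ncpoly \<Rightarrow> ('x, 'k) ncpoly set" where
  "rel_coset X S p = lie_ideal X S +>\<^bsub>free_lie X\<^esub> p"

lemma lie_ideal_minus: "p \<in> lie_ideal X S \<Longrightarrow> - p \<in> lie_ideal X S"
  using lie_ideal.scale[of p X S "-1"] by (simp add: pscale_minus_one)

lemma lie_ideal_diff: "p \<in> lie_ideal X S \<Longrightarrow> q \<in> lie_ideal X S \<Longrightarrow> p - q \<in> lie_ideal X S"
  using lie_ideal.add[OF _ lie_ideal_minus] by fastforce

lemma lie_ideal_comm: "p \<in> lie_ideal X S \<Longrightarrow> q \<in> Lie X \<Longrightarrow> comm q p \<in> lie_ideal X S"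
  using lie_ideal_minus[OF lie_ideal.comm[of p X S q]] comm_antisym[of q p] by simp

lemma lie_ideal_mono: "p \<in> lie_ideal X S \<Longrightarrow> X \<subseteq> Y \<Longrightarrow> S \<subseteq> T \<Longrightarrow> p \<in> lie_ideal Y T"
  by (induction rule: lie_ideal.induct) (auto intro: lie_ideal.intros Lie_mono)

lemma lie_ideal_Lie: "p \<in> lie_ideal X S \<Longrightarrow> S \<subseteq> Lie X \<Longrightarrow> p \<in> Lie X"
  by (induction rule: lie_ideal.induct) (auto intro: Lie.intros)

lemma rel_coset_eq_image: "rel_coset X S p = (\<lambda>h. h + p) ` lie_ideal X S"
  by (auto simp: rel_coset_def a_r_coset_def r_coset_def free_lie_def)

lemma mem_rel_coset: "q \<in> rel_coset X S p \<longleftrightarrow> q - p \<in> lie_ideal X S"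
  by (auto simp: rel_coset_eq_image image_iff) (metis diff_add_cancel)

lemma rel_coset_self: "p \<in> rel_coset X S p"
  by (simp add: mem_rel_coset lie_ideal.zero)

lemma rel_coset_eq: "rel_coset X S p = rel_coset X S q \<longleftrightarrow> p - q \<in> lie_ideal X S"
proof
  assume "rel_coset X S p = rel_coset X S q"
  then show "p - q \<in> lie_ideal X S" using rel_coset_self mem_rel_coset by metis
next
  assume d: "p - q \<in> lie_ideal X S"
  have "r - p \<in> lie_ideal X S \<longleftrightarrow> r - q \<in> lie_ideal X S" for r
    using lie_ideal.add[OF _ d, of "r - p"] lie_ideal_diff[OF _ d, of "r - q"] by auto
  then show "rel_coset X S p = rel_coset X S q" by (auto simp: mem_rel_coset)
qed

lemma presented_lie_carrier: "carrier (presented_lie X S) = rel_coset X S ` Lie X"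
  by (auto simp: presented_lie_def lie_quotient_def A_RCOSETS_def RCOSETS_def rel_coset_def a_r_coset_def free_lie_def)

lemma presented_lie_zero: "\<zero>\<^bsub>presented_lie X S\<^esub> = rel_coset X S 0"
  by (simp add: presented_lie_def lie_quotient_def rel_coset_eq_image)

lemma presented_lie_add: "rel_coset X S p \<oplus>\<^bsub>presented_lie X S\<^esub> rel_coset X S q = rel_coset X S (p + q)"
proof -
  have "r - (p + q) \<in> lie_ideal X S \<longleftrightarrow> (\<exists>h\<in>rel_coset X S p. \<exists>k\<in>rel_coset X S q. r = h + k)" for r
  proof
    assume "r - (p + q) \<in> lie_ideal X S"
    then show "\<exists>h\<in>rel_coset X S p. \<exists>k\<in>rel_coset X S q. r = h + k"
      by (intro bexI[of _ "r - q"] bexI[of _ q]) (auto simp: mem_rel_coset algebra_simps lie_ideal.zero)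
  next
    assume "\<exists>h\<in>rel_coset X S p. \<exists>k\<in>rel_coset X S q. r = h + k"
    then obtain h k where "h - p \<in> lie_ideal X S" "k - q \<in> lie_ideal X S" "r = h + k" by (auto simp: mem_rel_coset)
    then show "r - (p + q) \<in> lie_ideal X S"
      using lie_ideal.add[of "h - p" X S "k - q"] by (simp add: algebra_simps)
  qed
  then have "rel_coset X S (p + q) = (\<Union>h\<in>rel_coset X S p. \<Union>k\<in>rel_coset X S q. {h + k})"
    unfolding set_eq_iff mem_rel_coset[of _ X S "p + q"] by simp
  then show ?thesis
    by (simp add: presented_lie_def lie_quotient_def set_add_def set_mult_def free_lie_def)
qed

lemma presented_lie_smult: "\<alpha> \<odot>\<^bsub>presented_lie X S\<^esub> rel_coset X S p = rel_coset X S (pscale \<alpha> p)"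
proof -
  have *: "rel_coset X S (pscale \<alpha> q) = rel_coset X S (pscale \<alpha> p)" if "q \<in> rel_coset X S p" for q
    using that lie_ideal.scale[of "q - p" X S \<alpha>] by (simp add: rel_coset_eq mem_rel_coset ncpoly.scale_right_diff_distrib)
  have "(\<Union>q\<in>rel_coset X S p. rel_coset X S (pscale \<alpha> q)) = rel_coset X S (pscale \<alpha> p)"
    by (rule SUP_eq_const[OF _ *]) (use rel_coset_self in blast)
  moreover have "\<alpha> \<odot>\<^bsub>presented_lie X S\<^esub> C = (\<Union>q\<in>C. rel_coset X S (pscale \<alpha> q))" for C
    by (simp add: presented_lie_def lie_quotient_def rel_coset_def)
  ultimately show ?thesis by simp
qed

lemma presented_lie_mult:
  assumes "S \<subseteq> Lie X" "p \<in> Lie X" "q \<in> Lie X"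
  shows "rel_coset X S p \<otimes>\<^bsub>presented_lie X S\<^esub> rel_coset X S q = rel_coset X S (comm p q)"
proof -
  have *: "rel_coset X S (comm p' q') = rel_coset X S (comm p q)" if "p' \<in> rel_coset X S p" "q' \<in> rel_coset X S q" for p' q'
  proof -
    have "p' - p \<in> lie_ideal X S" "q' - q \<in> lie_ideal X S" using that by (auto simp: mem_rel_coset)
    moreover from this have "p' \<in> Lie X"
      using lie_ideal_Lie[OF _ assms(1)] Lie.add[of "p' - p" X p] assms(2) by fastforce
    ultimately have "comm p' (q' - q) + comm (p' - p) q \<in> lie_ideal X S"
      using assms(3) by (intro lie_ideal.add lie_ideal_comm lie_ideal.comm) auto
    then show ?thesis by (simp add: rel_coset_eq comm_simps)
  qed
  have "(\<Union>p'\<in>rel_coset X S p. \<Union>q'\<in>rel_coset X S q. rel_coset X S (comm p' q')) = rel_coset X S (comm p q)"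
    by (rule SUP_eq_const[OF _ SUP_eq_const[OF _ *]]) (use rel_coset_self in blast)+
  moreover have "C \<otimes>\<^bsub>presented_lie X S\<^esub> D = (\<Union>p'\<in>C. \<Union>q'\<in>D. rel_coset X S (comm p' q'))" for C D
    by (simp add: presented_lie_def lie_quotient_def rcoset_mult_def rel_coset_def)
  ultimately show ?thesis by simp
qed

lemmas presented_lie_simps = presented_lie_carrier presented_lie_zero presented_lie_add presented_lie_smult

lemma lie_algebra_presented:
  assumes S: "S \<subseteq> Lie X"
  shows "lie_algebra (presented_lie X S)"
proof (rule lie_algebraI)
  show "abelian_group (presented_lie X S)"
  proof (rule abelian_groupI)
    fix x assume "x \<in> carrier (presented_lie X S)"
    then obtain p where "x = rel_coset X S p" "p \<in> Lie X" by (auto simp: presented_lie_simps)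
    then show "\<exists>y\<in>carrier (presented_lie X S). y \<oplus>\<^bsub>presented_lie X S\<^esub> x = \<zero>\<^bsub>presented_lie X S\<^esub>"
      by (intro bexI[of _ "rel_coset X S (- p)"]) (auto simp: presented_lie_simps intro: Lie_minus)
  qed (auto simp: presented_lie_simps add_ac intro: Lie.intros)
  show "lie_algebra_axioms (presented_lie X S)"
  proof unfold_locales
    fix x y z
    assume "x \<in> carrier (presented_lie X S)" "y \<in> carrier (presented_lie X S)" "z \<in> carrier (presented_lie X S)"
    then obtain p q r where "x = rel_coset X S p" "y = rel_coset X S q" "z = rel_coset X S r" "p \<in> Lie X" "q \<in> Lie X" "r \<in> Lie X"
      by (auto simp: presented_lie_simps)
    moreover have "comm p (comm q r) + comm q (comm r p) + comm r (comm p q) = 0"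
      by (simp add: comm_def algebra_simps)
    ultimately show "x \<otimes>\<^bsub>presented_lie X S\<^esub> (y \<otimes>\<^bsub>presented_lie X S\<^esub> z) \<oplus>\<^bsub>presented_lie X S\<^esub>
        y \<otimes>\<^bsub>presented_lie X S\<^esub> (z \<otimes>\<^bsub>presented_lie X S\<^esub> x) \<oplus>\<^bsub>presented_lie X S\<^esub>
        z \<otimes>\<^bsub>presented_lie X S\<^esub> (x \<otimes>\<^bsub>presented_lie X S\<^esub> y) = \<zero>\<^bsub>presented_lie X S\<^esub>"
      by (simp add: presented_lie_simps presented_lie_mult[OF S] Lie.comm)
  qed (auto simp: presented_lie_simps presented_lie_mult[OF S] comm_simps Lie.intros)
qed (auto simp: presented_lie_simps ncpoly.scale_left_distrib ncpoly.scale_right_distrib intro: Lie.intros)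

lemma rel_coset_hom: "S \<subseteq> Lie X \<Longrightarrow> rel_coset X S \<in> lie_hom (free_lie X) (presented_lie X S)"
  by (rule lie_homI) (auto simp: presented_lie_simps presented_lie_mult)

lemma lie_hom_kills_ideal:
  assumes h: "h \<in> lie_hom (free_lie X) M" and M: "lie_algebra M" and S: "S \<subseteq> Lie X"
    and kills: "\<And>s. s \<in> S \<Longrightarrow> h s = \<zero>\<^bsub>M\<^esub>" and "p \<in> lie_ideal X S"
  shows "h p = \<zero>\<^bsub>M\<^esub>"
proof -
  interpret M: lie_algebra M by fact
  show ?thesis
    using assms(5)
  proof (induction rule: lie_ideal.induct)
    case zero
    then show ?case using lie_hom_zero[OF h lie_algebra_free M] by simp
  next
    case (comm p q)
    then show ?case using lie_homD(4)[OF h, of p q] lie_homD(1)[OF h] lie_ideal_Lie[OF _ S] by simp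
  next
    case (add p q)
    then show ?case using lie_homD(2)[OF h, of p q] lie_ideal_Lie[OF _ S] by simp
  next
    case (scale p \<alpha>)
    then show ?case using lie_homD(3)[OF h, of p \<alpha>] lie_ideal_Lie[OF _ S] by simp
  qed (use kills in blast)
qed

lemma lie_hom_free_minus:
  assumes "h \<in> lie_hom (free_lie X) M" "lie_algebra M" "p \<in> Lie X" "q \<in> Lie X"
  shows "h (p - q) = h p \<ominus>\<^bsub>M\<^esub> h q"
proof -
  interpret F: lie_algebra "free_lie X" by (rule lie_algebra_free)
  have "p \<ominus>\<^bsub>free_lie X\<^esub> q = p - q"
    using F.minus_smult[of q] assms(4) by (simp add: a_minus_def pscale_minus_one)
  then show ?thesis using lie_hom_minus[OF assms(1) lie_algebra_free assms(2), of p q] assms(3,4) by simp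
qed

lemma presented_lie_lift:
  assumes h: "h \<in> lie_hom (free_lie X) M" and M: "lie_algebra M" and S: "S \<subseteq> Lie X"
    and kills: "\<And>s. s \<in> S \<Longrightarrow> h s = \<zero>\<^bsub>M\<^esub>"
  obtains g where "g \<in> lie_hom (presented_lie X S) M" "\<And>p. p \<in> Lie X \<Longrightarrow> g (rel_coset X S p) = h p"
proof -
  interpret M: lie_algebra M by fact
  define g where "g C = h (SOME p. p \<in> Lie X \<and> C = rel_coset X S p)" for C
  have g: "g (rel_coset X S p) = h p" if p: "p \<in> Lie X" for p
  proof -
    define q where "q = (SOME q. q \<in> Lie X \<and> rel_coset X S p = rel_coset X S q)"
    have "q \<in> Lie X \<and> rel_coset X S p = rel_coset X S q"
      unfolding q_def by (rule someI[of _ p]) (use p in simp)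
    then have q: "q \<in> Lie X" "p - q \<in> lie_ideal X S" by (simp_all add: rel_coset_eq)
    have "h (p - q) = h p \<ominus>\<^bsub>M\<^esub> h q"
      by (rule lie_hom_free_minus[OF h M p q(1)])
    moreover have "h (p - q) = \<zero>\<^bsub>M\<^esub>" by (rule lie_hom_kills_ideal[OF h M S kills q(2)])
    ultimately have "h p = h q"
      using lie_homD(1)[OF h] p q M.minus_eq_zero[of "h p" "h q"] by simp
    then show ?thesis by (simp add: g_def q_def)
  qed
  have "g \<in> lie_hom (presented_lie X S) M"
    by (rule lie_homI)
      (use lie_homD[OF h] in \<open>auto simp: presented_lie_simps presented_lie_mult[OF S] g Lie.intros\<close>)
  with g that show ?thesis by blast
qed

subsection \<open>Substitution homomorphisms\<close>

lemma ncpoly_induct [case_names zero add scale mon]: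
  assumes "P 0" "\<And>p q. P p \<Longrightarrow> P q \<Longrightarrow> P (p + q)" "\<And>\<alpha> p. P p \<Longrightarrow> P (pscale \<alpha> p)" "\<And>w. P (mon w)"
  shows "P p"
proof -
  have "P (\<Sum>w\<in>K. pscale (c w) (mon w))" if "finite K" for K and c :: "'a list \<Rightarrow> 'b"
    using that by (induction K) (auto intro: assms)
  then show ?thesis using ncpoly_eq_sum[of p] by (metis finite_keys)
qed

lemma free_hom_superset:
  "finite K \<Longrightarrow> Poly_Mapping.keys p \<subseteq> K \<Longrightarrow>
    free_hom \<phi> p = (\<Sum>w\<in>K. pscale (Poly_Mapping.lookup p w) (prod_list (map \<phi> w)))"
  unfolding free_hom_def by (rule sum.mono_neutral_left) (auto simp: in_keys_iff)

lemma free_hom_zero [simp]: "free_hom \<phi> 0 = 0"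
  by (simp add: free_hom_def)

lemma free_hom_add: "free_hom \<phi> (p + q) = free_hom \<phi> p + free_hom \<phi> q"
  using keys_add[of p q]
  by (simp add: free_hom_superset[of "Poly_Mapping.keys p \<union> Poly_Mapping.keys q"] lookup_add
      ncpoly.scale_left_distrib sum.distrib)

lemma free_hom_pscale: "free_hom \<phi> (pscale \<alpha> p) = pscale \<alpha> (free_hom \<phi> p)"
proof -
  have "Poly_Mapping.keys (pscale \<alpha> p) \<subseteq> Poly_Mapping.keys p" by (auto simp: in_keys_iff)
  then show ?thesis
    by (simp add: free_hom_superset[of "Poly_Mapping.keys p"] ncpoly.scale_sum_right)
qed

lemma free_hom_mon: "free_hom \<phi> (mon w) = prod_list (map \<phi> w)"
  by (simp add: free_hom_def lookup_mon)

lemma free_hom_letter [simp]: "free_hom \<phi> (letter x) = \<phi> x"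
  by (simp add: letter_mon free_hom_mon)

lemma free_hom_mult: "free_hom \<phi> (p * q) = free_hom \<phi> p * free_hom \<phi> q"
proof (induction p rule: ncpoly_induct)
  case (mon u)
  show ?case
    by (induction q rule: ncpoly_induct)
      (simp_all add: distrib_left free_hom_add free_hom_pscale pscale_mult_right mon_mult free_hom_mon)
qed (simp_all add: distrib_right free_hom_add free_hom_pscale pscale_mult_left)

lemma free_hom_minus: "free_hom \<phi> (p - q) = free_hom \<phi> p - free_hom \<phi> q"
proof -
  have "free_hom \<phi> (p - q) = free_hom \<phi> (p + pscale (-1) q)" by (simp add: pscale_minus_one)
  then show ?thesis by (simp only: free_hom_add free_hom_pscale) (simp add: pscale_minus_one)
qed

lemma free_hom_comm: "free_hom \<phi> (comm p q) = comm (free_hom \<phi> p) (free_hom \<phi> q)"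
  by (simp add: comm_def free_hom_minus free_hom_mult)

lemma free_hom_Lie: "p \<in> Lie X \<Longrightarrow> (\<And>x. x \<in> X \<Longrightarrow> \<phi> x \<in> Lie Y) \<Longrightarrow> free_hom \<phi> p \<in> Lie Y"
  by (induction rule: Lie.induct) (auto simp: free_hom_add free_hom_pscale free_hom_comm intro: Lie.intros)

lemma free_hom_lie_hom: "(\<And>x. x \<in> X \<Longrightarrow> \<phi> x \<in> Lie Y) \<Longrightarrow> free_hom \<phi> \<in> lie_hom (free_lie X) (free_lie Y)"
  by (rule lie_homI) (auto simp: free_hom_add free_hom_pscale free_hom_comm intro: free_hom_Lie)


subsection \<open>Normal forms\<close>

text \<open>
  A linear combination of irreducible bracketings has an irreducible leading word, so by the diamond
  lemma it lies in the ideal only if it is zero.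
\<close>

lemma Irr_independent:
  assumes S: "confluent S" "S \<subseteq> Lie X" and g: "g \<in> ncpoly.span (Irr X S)" "g \<in> lie_ideal X S"
  shows "g = 0"
proof -
  define T where "T = {t \<in> nlsws X. \<not> (\<exists>s\<in>S. \<exists>a\<in>lists X. \<exists>b\<in>lists X. word t = a @ lead s @ b)}"
  interpret F: lie_algebra "free_lie X :: ('b, ('a, 'b) ncpoly) module" by (rule lie_algebra_free)
  have ev: "(lie_eval :: _ \<Rightarrow> ('a, 'b) ncpoly) \<in> T \<rightarrow> Lie X"
    by (auto simp: T_def nlsws_def intro: lie_eval_Lie)
  have "\<exists>c. Poly_Mapping.keys c \<subseteq> T \<and> g = lin_comb (free_lie X) lie_eval c"
    using g(1)
  proof (induction rule: ncpoly.span_induct_alt)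
    case base
    then show ?case using F.lin_comb_zero by (intro exI[of _ 0]) simp
  next
    case (step \<alpha> x y)
    then obtain c where c: "Poly_Mapping.keys c \<subseteq> T" "y = lin_comb (free_lie X) lie_eval c" by blast
    obtain w where w: "w \<in> ALSW X" "x = lie_eval (bracketing w)" "\<not> (\<exists>s\<in>S. \<exists>a\<in>lists X. \<exists>b\<in>lists X. w = a @ lead s @ b)"
      using step(1) unfolding Irr_def by blast
    then have t: "bracketing w \<in> T"
      using bracketing[of w] by (auto simp: T_def nlsws_def ALSW_def)
    let ?d = "Poly_Mapping.single (bracketing w) \<alpha>"
    have "lin_comb (free_lie X) lie_eval ?d = pscale \<alpha> x"
      using F.lin_comb_single[of lie_eval "bracketing w" \<alpha>] ev t w by auto
    moreover have "lin_comb (free_lie X) lie_eval (?d + c) = lin_comb (free_lie X) lie_eval ?d + lin_comb (free_lie X) lie_eval c"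
      using F.lin_comb_add[of lie_eval T ?d c] ev c t by (auto split: if_splits)
    moreover have "Poly_Mapping.keys (?d + c) \<subseteq> T" using keys_add[of ?d c] c t by (auto split: if_splits)
    ultimately show ?case using c by (intro exI[of _ "?d + c"]) simp
  qed
  then obtain c where c: "Poly_Mapping.keys c \<subseteq> T" "g = lin_comb (free_lie X) lie_eval c" by blast
  show ?thesis
  proof (rule ccontr)
    assume "g \<noteq> 0"
    then have "c \<noteq> 0" using c F.lin_comb_zero by force
    moreover have "\<forall>t\<in>Poly_Mapping.keys c. nlsw t" using c(1) by (auto simp: T_def nlsws_def)
    ultimately obtain t where "t \<in> Poly_Mapping.keys c" "lead g = word t"
      using nlsw_comb_lead[of c] unfolding c(2) lin_comb_free[OF c(1) ev] by blast
    then have t: "t \<in> T" "lead g = word t" using c(1) by blast+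
    obtain s a b where s: "s \<in> S" "lead g = a @ lead s @ b"
      using diamond_lemma_lead[OF S(1) lie_ideal_assoc_ideal[OF g(2)] \<open>g \<noteq> 0\<close>] by blast
    from s t have "a \<in> lists X" "b \<in> lists X" by (auto simp: T_def nlsws_def in_lists_conv_set)
    moreover from t(1) have "\<not> (\<exists>s\<in>S. \<exists>a\<in>lists X. \<exists>b\<in>lists X. word t = a @ lead s @ b)"
      unfolding T_def by blast
    ultimately show False using s t(2) by metis
  qed
qed

lemma Red_eqI:
  assumes "confluent S" "S \<subseteq> Lie X" "g \<in> ncpoly.span (Irr X S)" "f - g \<in> lie_ideal X S"
  shows "Red X S f = g"
  unfolding Red_def
proof (rule the_equality)
  fix h assume h: "h \<in> ncpoly.span (Irr X S) \<and> f - h \<in> lie_ideal X S"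
  then have "h - g \<in> lie_ideal X S"
    using lie_ideal_diff[OF assms(4), of "f - h"] by simp
  then have "h - g = 0"
    using h assms(3) by (intro Irr_independent[OF assms(1,2)] ncpoly.span_diff) auto
  then show "h = g" by simp
qed (use assms in blast)

section \<open>Elements of the coefficient algebra as linear combinations of letters\<close>

locale lie_setting = lie_algebra \<aa> for \<aa> :: "('k::field, 'v) module" (structure) +
  fixes A B :: "'x::wellorder set" and \<epsilon> :: "'x \<Rightarrow> 'v" and R :: "('x, 'k) ncpoly set"
  assumes basis: "linear_basis \<aa> A \<epsilon>" and A_less_B: "\<And>a b. a \<in> A \<Longrightarrow> b \<in> B \<Longrightarrow> a < b"
    and R: "minimal_GS_basis B R"
begin

abbreviation \<kappa> :: "'v \<Rightarrow> ('x, 'k) ncpoly" where "\<kappa> \<equiv> as_letters \<aa> A \<epsilon>"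

lemma A_B_disjoint: "x \<in> A \<Longrightarrow> x \<in> B \<Longrightarrow> False"
  using A_less_B by fastforce

lemma \<epsilon>_closed: "\<epsilon> \<in> A \<rightarrow> carrier \<aa>"
  using basis by (simp add: linear_basis_def)

lemma \<epsilon>_carrier [simp]: "a \<in> A \<Longrightarrow> \<epsilon> a \<in> carrier \<aa>"
  using \<epsilon>_closed by blast

text \<open>
  The coefficients that \<^const>\<open>as_letters\<close> transfers from the basis to the letters.
\<close>

definition coords :: "'v \<Rightarrow> 'x \<Rightarrow>\<^sub>0 'k" where
  "coords = inv_into {c. Poly_Mapping.keys c \<subseteq> A} (lin_comb \<aa> \<epsilon>)"

lemma lin_comb_bij: "bij_betw (lin_comb \<aa> \<epsilon>) {c. Poly_Mapping.keys c \<subseteq> A} (carrier \<aa>)"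
  using basis by (simp add: linear_basis_def)

lemma coords_keys: "v \<in> carrier \<aa> \<Longrightarrow> Poly_Mapping.keys (coords v) \<subseteq> A"
  unfolding coords_def using lin_comb_bij by (metis (no_types, lifting) bij_betw_def inv_into_into mem_Collect_eq)

lemma lin_comb_coords: "v \<in> carrier \<aa> \<Longrightarrow> lin_comb \<aa> \<epsilon> (coords v) = v"
  unfolding coords_def using lin_comb_bij by (simp add: bij_betw_inv_into_right)

lemma coords_lin_comb: "Poly_Mapping.keys c \<subseteq> A \<Longrightarrow> coords (lin_comb \<aa> \<epsilon> c) = c"
  unfolding coords_def using lin_comb_bij by (simp add: bij_betw_inv_into_left)

lemma letter_closed: "(letter :: _ \<Rightarrow> ('x, 'k) ncpoly) \<in> A \<rightarrow> carrier (free_lie A)"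
  by (auto intro: Lie.letter)

lemma \<kappa>_eq: "v \<in> carrier \<aa> \<Longrightarrow> \<kappa> v = lin_comb (free_lie A) letter (coords v)"
  using lin_comb_free[OF coords_keys, of v "letter :: _ \<Rightarrow> ('x, 'k) ncpoly" A] letter_closed
  by (simp add: as_letters_def coords_def Let_def)

lemma \<kappa>_Lie: "v \<in> carrier \<aa> \<Longrightarrow> \<kappa> v \<in> Lie A"
proof -
  interpret F: lie_algebra "free_lie A :: ('k, ('x, 'k) ncpoly) module" by (rule lie_algebra_free)
  assume "v \<in> carrier \<aa>"
  then show ?thesis using \<kappa>_eq F.lin_comb_closed[OF letter_closed coords_keys] by simp
qed

lemma \<kappa>_add: "v \<in> carrier \<aa> \<Longrightarrow> w \<in> carrier \<aa> \<Longrightarrow> \<kappa> (v \<oplus> w) = \<kappa> v + \<kappa> w"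
proof -
  interpret F: lie_algebra "free_lie A :: ('k, ('x, 'k) ncpoly) module" by (rule lie_algebra_free)
  assume vw: "v \<in> carrier \<aa>" "w \<in> carrier \<aa>"
  have "coords (v \<oplus> w) = coords (lin_comb \<aa> \<epsilon> (coords v + coords w))"
    using vw coords_keys by (simp add: lin_comb_add[OF \<epsilon>_closed] lin_comb_coords)
  also have "\<dots> = coords v + coords w"
    using vw coords_keys[of v] coords_keys[of w] keys_add[of "coords v" "coords w"] by (intro coords_lin_comb) blast
  finally show ?thesis
    using vw F.lin_comb_add[OF letter_closed coords_keys coords_keys, of v w] by (simp add: \<kappa>_eq)
qed

lemma \<kappa>_smult: "v \<in> carrier \<aa> \<Longrightarrow> \<kappa> (\<alpha> \<odot> v) = pscale \<alpha> (\<kappa> v)"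
proof -
  interpret F: lie_algebra "free_lie A :: ('k, ('x, 'k) ncpoly) module" by (rule lie_algebra_free)
  assume v: "v \<in> carrier \<aa>"
  have "coords (\<alpha> \<odot> v) = coords (lin_comb \<aa> \<epsilon> (Poly_Mapping.map ((*) \<alpha>) (coords v)))"
    using v coords_keys by (simp add: lin_comb_smult[OF \<epsilon>_closed] lin_comb_coords)
  also have "\<dots> = Poly_Mapping.map ((*) \<alpha>) (coords v)"
    using v coords_keys[of v] keys_scaled[of \<alpha> "coords v"] by (intro coords_lin_comb) blast
  finally show ?thesis
    using v F.lin_comb_smult[OF letter_closed coords_keys, of v] by (simp add: \<kappa>_eq)
qed

lemma \<kappa>_\<epsilon>: "a \<in> A \<Longrightarrow> \<kappa> (\<epsilon> a) = letter a"
proof -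
  interpret F: lie_algebra "free_lie A :: ('k, ('x, 'k) ncpoly) module" by (rule lie_algebra_free)
  assume a: "a \<in> A"
  have "coords (lin_comb \<aa> \<epsilon> (Poly_Mapping.single a 1)) = Poly_Mapping.single a 1"
    using a by (intro coords_lin_comb) simp
  then have "coords (\<epsilon> a) = Poly_Mapping.single a 1"
    using a lin_comb_single[of \<epsilon> a 1] smult_laws(5) by simp
  then show ?thesis using a F.lin_comb_single[of letter a 1] by (simp add: \<kappa>_eq Lie.letter)
qed

lemma \<kappa>_zero [simp]: "\<kappa> \<zero> = 0"
  using \<kappa>_smult[of \<zero> 0] by simp

lemma \<kappa>_minus: "v \<in> carrier \<aa> \<Longrightarrow> \<kappa> (\<ominus> v) = - \<kappa> v"
  using \<kappa>_smult[of v "-1"] by (simp add: minus_smult pscale_minus_one)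

lemma \<kappa>_diff: "v \<in> carrier \<aa> \<Longrightarrow> w \<in> carrier \<aa> \<Longrightarrow> \<kappa> (v \<ominus> w) = \<kappa> v - \<kappa> w"
  by (simp add: a_minus_def \<kappa>_add \<kappa>_minus)

lemma \<kappa>_sum: "v \<in> carrier \<aa> \<Longrightarrow> \<kappa> v = (\<Sum>x\<in>Poly_Mapping.keys (coords v). pscale (Poly_Mapping.lookup (coords v) x) (mon [x]))"
  by (simp add: as_letters_def coords_def[symmetric] letter_mon Let_def)

lemma \<kappa>_keys: "v \<in> carrier \<aa> \<Longrightarrow> k \<in> Poly_Mapping.keys (\<kappa> v) \<Longrightarrow> \<exists>a\<in>A. k = [a]"
proof -
  assume v: "v \<in> carrier \<aa>" "k \<in> Poly_Mapping.keys (\<kappa> v)"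
  then have "Poly_Mapping.lookup (\<kappa> v) k \<noteq> 0" by (simp add: in_keys_iff)
  then obtain x where "x \<in> Poly_Mapping.keys (coords v)" "Poly_Mapping.lookup (coords v) x * Poly_Mapping.lookup (mon [x] :: ('x, 'k) ncpoly) k \<noteq> 0"
    unfolding \<kappa>_sum[OF v(1)] lookup_sum lookup_pscale by (metis (no_types, lifting) sum.neutral)
  then show ?thesis using coords_keys[OF v(1)] by (auto simp: lookup_mon split: if_splits)
qed

lemma \<kappa>_inj: "v \<in> carrier \<aa> \<Longrightarrow> \<kappa> v = 0 \<Longrightarrow> v = \<zero>"
proof -
  assume v: "v \<in> carrier \<aa>" "\<kappa> v = 0"
  have "Poly_Mapping.lookup (coords v) x = Poly_Mapping.lookup (\<kappa> v) [x]" for x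
    unfolding \<kappa>_sum[OF v(1)] lookup_sum lookup_pscale lookup_mon
    by (simp add: if_distrib in_keys_iff cong: if_cong)
  then have "coords v = 0" using v by (intro poly_mapping_eqI) simp
  then show ?thesis using lin_comb_coords[OF v(1)] by simp
qed

lemma carrier_induct [consumes 1, case_names zero basis add smult]:
  assumes "v \<in> carrier \<aa>" "P \<zero>" "\<And>a. a \<in> A \<Longrightarrow> P (\<epsilon> a)"
    "\<And>v w. v \<in> carrier \<aa> \<Longrightarrow> w \<in> carrier \<aa> \<Longrightarrow> P v \<Longrightarrow> P w \<Longrightarrow> P (v \<oplus> w)"
    "\<And>\<alpha> v. v \<in> carrier \<aa> \<Longrightarrow> P v \<Longrightarrow> P (\<alpha> \<odot> v)"
  shows "P v"
proof -
  have "(\<Oplus>x\<in>K. c x \<odot> \<epsilon> x) \<in> carrier \<aa> \<and> P (\<Oplus>x\<in>K. c x \<odot> \<epsilon> x)" if "finite K" "K \<subseteq> A" for K c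
    using that
  proof (induction K)
    case (insert x K)
    then have "(\<Oplus>y\<in>insert x K. c y \<odot> \<epsilon> y) = c x \<odot> \<epsilon> x \<oplus> (\<Oplus>y\<in>K. c y \<odot> \<epsilon> y)"
      by (intro finsum_insert) auto
    then show ?case using insert by (auto intro!: assms)
  qed (use assms in simp)
  then show ?thesis
    using lin_comb_coords[OF assms(1)] coords_keys[OF assms(1)] unfolding lin_comb_def by (metis finite_keys)
qed

lemma \<kappa>_below: "v \<in> carrier \<aa> \<Longrightarrow> (\<And>a. a \<in> A \<Longrightarrow> [a] < w) \<Longrightarrow> \<kappa> v \<in> below w"
  using \<kappa>_keys by (fastforce simp: below_def)

lemma \<kappa>_Lie_Un: "v \<in> carrier \<aa> \<Longrightarrow> \<kappa> v \<in> Lie (A \<union> B)"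
  by (rule Lie_mono[OF \<kappa>_Lie]) auto

lemma R_Lie: "R \<subseteq> Lie B"
  and R_monic_at: "f \<in> R \<Longrightarrow> monic_at (lead f) f"
  and R_lead_ALSW: "f \<in> R \<Longrightarrow> lead f \<in> ALSW B"
  and R_reduced: "f \<in> R \<Longrightarrow> g \<in> R \<Longrightarrow> lead f = a @ lead g @ b \<Longrightarrow> f = g"
proof -
  show RB: "R \<subseteq> Lie B" and m: "f \<in> R \<Longrightarrow> monic_at (lead f) f" for f
    using R monic_monic_at by (auto simp: minimal_GS_basis_def GS_basis_def)
  show l: "f \<in> R \<Longrightarrow> lead f \<in> ALSW B" for f
    using RB R Lie_lead_ALSW[of f B] by (auto simp: minimal_GS_basis_def GS_basis_def monic_def)
  assume fg: "f \<in> R" "g \<in> R" "lead f = a @ lead g @ b"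
  have "lead f \<in> lists B" using l[OF fg(1)] by (simp add: ALSW_def)
  then have "a \<in> lists B" "b \<in> lists B" by (simp_all add: fg(3))
  then show "f = g" using R fg unfolding minimal_GS_basis_def by blast
qed

lemma lead_R_B: "f \<in> R \<Longrightarrow> set (lead f) \<subseteq> B"
  using R_lead_ALSW[of f] by (auto simp: ALSW_def)

lemma lead_R_nonempty: "f \<in> R \<Longrightarrow> lead f \<noteq> []"
  using R_lead_ALSW[of f] alsw_nonempty by (auto simp: ALSW_def)

lemma letter_less_B_word: "a \<in> A \<Longrightarrow> set w \<subseteq> B \<Longrightarrow> w \<noteq> [] \<Longrightarrow> [a] < w"
  using A_less_B by (cases w) (auto simp: Cons_less_Cons)

text \<open>
  Modulo an ideal, the polynomials congruent to elements of \<open>\<aa>\<close> form the candidate for the image of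
  \<open>\<aa>\<close> in the quotient.
\<close>

definition in_\<aa> :: "('x, 'k) ncpoly set \<Rightarrow> ('x, 'k) ncpoly \<Rightarrow> bool" where
  "in_\<aa> S p \<longleftrightarrow> (\<exists>v\<in>carrier \<aa>. p - \<kappa> v \<in> lie_ideal (A \<union> B) S)"

lemma in_\<aa>_\<kappa>: "v \<in> carrier \<aa> \<Longrightarrow> in_\<aa> S (\<kappa> v)"
  unfolding in_\<aa>_def by (rule bexI[of _ v]) (auto intro: lie_ideal.zero)

lemma in_\<aa>_ideal: "p \<in> lie_ideal (A \<union> B) S \<Longrightarrow> in_\<aa> S p"
  unfolding in_\<aa>_def by (rule bexI[of _ \<zero>]) auto

lemma in_\<aa>_add:
  assumes "in_\<aa> S p" "in_\<aa> S q"
  shows "in_\<aa> S (p + q)"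
proof -
  obtain v w where v: "v \<in> carrier \<aa>" "w \<in> carrier \<aa>" "p - \<kappa> v \<in> lie_ideal (A \<union> B) S" "q - \<kappa> w \<in> lie_ideal (A \<union> B) S"
    using assms unfolding in_\<aa>_def by blast
  have "(p - \<kappa> v) + (q - \<kappa> w) \<in> lie_ideal (A \<union> B) S" using v lie_ideal.add by blast
  then have "p + q - \<kappa> (v \<oplus> w) \<in> lie_ideal (A \<union> B) S" using v by (simp add: \<kappa>_add algebra_simps)
  then show ?thesis unfolding in_\<aa>_def using v by blast
qed

lemma in_\<aa>_pscale:
  assumes "in_\<aa> S p"
  shows "in_\<aa> S (pscale \<alpha> p)"
proof -
  obtain v where v: "v \<in> carrier \<aa>" "p - \<kappa> v \<in> lie_ideal (A \<union> B) S"
    using assms unfolding in_\<aa>_def by blast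
  have "pscale \<alpha> p - \<kappa> (\<alpha> \<odot> v) = pscale \<alpha> (p - \<kappa> v)" using v by (simp add: \<kappa>_smult ncpoly.scale_right_diff_distrib)
  then have "pscale \<alpha> p - \<kappa> (\<alpha> \<odot> v) \<in> lie_ideal (A \<union> B) S" using v lie_ideal.scale by metis
  then show ?thesis unfolding in_\<aa>_def using v by blast
qed

lemma in_\<aa>_minus: "in_\<aa> S p \<Longrightarrow> in_\<aa> S (- p)"
  using in_\<aa>_pscale[of S p "-1"] by (simp add: pscale_minus_one)

lemma in_\<aa>_diff: "in_\<aa> S p \<Longrightarrow> in_\<aa> S q \<Longrightarrow> in_\<aa> S (p - q)"
  using in_\<aa>_add[OF _ in_\<aa>_minus] by fastforce

text \<open>
  For relations of this kind the elements of \<open>\<aa>\<close> are their own normal forms; both the action relations and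
  the relations of the extension are of this kind.
\<close>

definition letters_irreducible :: "('x, 'k) ncpoly set \<Rightarrow> bool" where
  "letters_irreducible S \<longleftrightarrow> confluent S \<and> S \<subseteq> Lie (A \<union> B) \<and> (\<forall>s\<in>S. \<forall>x\<in>A. \<forall>a b. [x] \<noteq> a @ lead s @ b)"

lemma \<kappa>_span_Irr:
  assumes "letters_irreducible S" "v \<in> carrier \<aa>"
  shows "\<kappa> v \<in> ncpoly.span (Irr (A \<union> B) S)"
proof -
  have "letter a \<in> Irr (A \<union> B) S" if "a \<in> A" for a
  proof -
    have "letter a = lie_eval (bracketing [a])" using bracketing_word[of "Single a"] by simp
    moreover have "[a] \<in> ALSW (A \<union> B)" using that by (simp add: ALSW_def)
    ultimately show ?thesis using assms(1) that unfolding Irr_def letters_irreducible_def by blast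
  qed
  then show ?thesis
    unfolding \<kappa>_sum[OF assms(2)] letter_mon[symmetric] using coords_keys[OF assms(2)]
    by (intro ncpoly.span_sum ncpoly.span_scale ncpoly.span_base) auto
qed

lemma Red_\<kappa>:
  assumes "letters_irreducible S" "v \<in> carrier \<aa>" "p - \<kappa> v \<in> lie_ideal (A \<union> B) S"
  shows "Red (A \<union> B) S p = \<kappa> v"
  using assms \<kappa>_span_Irr[OF assms(1,2)] by (intro Red_eqI) (auto simp: letters_irreducible_def)

lemma Red_cong:
  assumes "letters_irreducible S" "in_\<aa> S p"
  shows "p - Red (A \<union> B) S p \<in> lie_ideal (A \<union> B) S"
  using assms Red_\<kappa>[OF assms(1)] unfolding in_\<aa>_def by metis

lemma ideal_\<kappa>_zero:
  assumes "letters_irreducible S" "v \<in> carrier \<aa>" "\<kappa> v \<in> lie_ideal (A \<union> B) S"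
  shows "v = \<zero>"
  using Irr_independent[of S "A \<union> B" "\<kappa> v"] \<kappa>_span_Irr[OF assms(1,2)] assms \<kappa>_inj
  by (simp add: letters_irreducible_def)

end


lemma self_inclusion: "lead s = x @ lead s @ y \<Longrightarrow> s - mon x * s * mon y \<in> ideal_below S (lead s)"
  by (drule arg_cong[of _ _ length]) (simp add: ideal_below_closed)

section \<open>The action of \<open>Lie(B)\<close>\<close>

locale lie_action = lie_setting \<aa> A B \<epsilon> R for \<aa> :: "('k::field, 'v) module" (structure)
    and A B :: "'x::wellorder set" and \<epsilon> R +
  fixes act :: "('x, 'k) ncpoly \<Rightarrow> 'v \<Rightarrow> 'v"
  assumes compatible: "compatible_module (free_lie B) \<aa> act"
begin

abbreviation AR :: "('x, 'k) ncpoly set" where "AR \<equiv> action_relations \<aa> A \<epsilon> B act"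

lemma act_closed [simp]: "d \<in> Lie B \<Longrightarrow> v \<in> carrier \<aa> \<Longrightarrow> act d v \<in> carrier \<aa>"
  and act_add_left: "d \<in> Lie B \<Longrightarrow> d' \<in> Lie B \<Longrightarrow> v \<in> carrier \<aa> \<Longrightarrow> act (d + d') v = act d v \<oplus> act d' v"
  and act_scale_left: "d \<in> Lie B \<Longrightarrow> v \<in> carrier \<aa> \<Longrightarrow> act (pscale \<alpha> d) v = \<alpha> \<odot> act d v"
  and act_add_right: "d \<in> Lie B \<Longrightarrow> v \<in> carrier \<aa> \<Longrightarrow> w \<in> carrier \<aa> \<Longrightarrow> act d (v \<oplus> w) = act d v \<oplus> act d w"
  and act_smult_right: "d \<in> Lie B \<Longrightarrow> v \<in> carrier \<aa> \<Longrightarrow> act d (\<alpha> \<odot> v) = \<alpha> \<odot> act d v"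
  and act_comm: "d \<in> Lie B \<Longrightarrow> d' \<in> Lie B \<Longrightarrow> v \<in> carrier \<aa> \<Longrightarrow> act (comm d d') v = act d (act d' v) \<ominus> act d' (act d v)"
  and act_bracket: "d \<in> Lie B \<Longrightarrow> v \<in> carrier \<aa> \<Longrightarrow> w \<in> carrier \<aa> \<Longrightarrow> act d (v \<otimes> w) = act d v \<otimes> w \<oplus> v \<otimes> act d w"
  using compatible unfolding compatible_module_def by simp_all

lemma act_zero_right: "d \<in> Lie B \<Longrightarrow> act d \<zero> = \<zero>"
  using act_smult_right[of d \<zero> 0] act_closed[of d \<zero>] by simp

lemma act_zero_left: "v \<in> carrier \<aa> \<Longrightarrow> act 0 v = \<zero>"
  using act_scale_left[of 0 v 0] act_closed[of 0 v] by (simp add: Lie.zero)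

lemma AR_Lie: "AR \<subseteq> Lie (A \<union> B)"
  by (auto simp: action_relations_def intro!: Lie_diff Lie.comm Lie.letter \<kappa>_Lie_Un act_closed)

lemma ARI: "a \<in> A \<Longrightarrow> b \<in> B \<Longrightarrow> comm (letter b) (letter a) - \<kappa> (act (letter b) (\<epsilon> a)) \<in> AR"
  by (auto simp: action_relations_def)

lemma act_letter_cong:
  assumes "b \<in> B" "v \<in> carrier \<aa>"
  shows "comm (letter b) (\<kappa> v) - \<kappa> (act (letter b) v) \<in> ncpoly.span AR"
  using assms(2)
proof (induction rule: carrier_induct)
  case zero
  then show ?case using assms by (simp add: act_zero_right Lie.letter comm_simps ncpoly.span_zero)
next
  case (basis a)
  then show ?case using assms ARI by (simp add: \<kappa>_\<epsilon> ncpoly.span_base)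
next
  case (add v w)
  have "comm (letter b) (\<kappa> (v \<oplus> w)) - \<kappa> (act (letter b) (v \<oplus> w)) =
      (comm (letter b) (\<kappa> v) - \<kappa> (act (letter b) v)) + (comm (letter b) (\<kappa> w) - \<kappa> (act (letter b) w))"
    using add assms by (simp add: act_add_right Lie.letter \<kappa>_add comm_simps)
  then show ?case using add by (simp only: ncpoly.span_add)
next
  case (smult \<alpha> v)
  have "comm (letter b) (\<kappa> (\<alpha> \<odot> v)) - \<kappa> (act (letter b) (\<alpha> \<odot> v)) =
      pscale \<alpha> (comm (letter b) (\<kappa> v) - \<kappa> (act (letter b) v))"
    using smult assms by (simp add: act_smult_right Lie.letter \<kappa>_smult comm_simps ncpoly.scale_right_diff_distrib)
  then show ?case using smult by (simp only: ncpoly.span_scale)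
qed

lemma span_lie_ideal: "p \<in> ncpoly.span S \<Longrightarrow> p \<in> lie_ideal X S"
  by (induction rule: ncpoly.span_induct_alt) (auto intro: lie_ideal.intros)

text \<open>
  The relations prescribe the action of the letters only; for all of \<open>Lie(B)\<close> it follows, since
  commutators act by commutators on both sides.
\<close>

lemma act_cong:
  assumes "d \<in> Lie B" "v \<in> carrier \<aa>"
  shows "comm d (\<kappa> v) - \<kappa> (act d v) \<in> lie_ideal (A \<union> B) AR"
  using assms
proof (induction arbitrary: v rule: Lie.induct)
  case zero
  then show ?case by (simp add: act_zero_left comm_simps lie_ideal.zero)
next
  case (letter b)
  then show ?case using span_lie_ideal[OF act_letter_cong] by blast
next
  case (add p q)
  have "comm (p + q) (\<kappa> v) - \<kappa> (act (p + q) v) = (comm p (\<kappa> v) - \<kappa> (act p v)) + (comm q (\<kappa> v) - \<kappa> (act q v))"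
    using add by (simp add: act_add_left \<kappa>_add comm_simps)
  then show ?case using add by (simp only: lie_ideal.add)
next
  case (scale p \<alpha>)
  have "comm (pscale \<alpha> p) (\<kappa> v) - \<kappa> (act (pscale \<alpha> p) v) = pscale \<alpha> (comm p (\<kappa> v) - \<kappa> (act p v))"
    using scale by (simp add: act_scale_left \<kappa>_smult comm_simps ncpoly.scale_right_diff_distrib)
  then show ?case using scale by (simp only: lie_ideal.scale)
next
  case (comm p q)
  have pq: "p \<in> Lie (A \<union> B)" "q \<in> Lie (A \<union> B)" by (rule Lie_mono[OF comm.hyps(1)], simp) (rule Lie_mono[OF comm.hyps(2)], simp)
  have "comm (comm p q) (\<kappa> v) - \<kappa> (act (comm p q) v) =
      comm p (comm q (\<kappa> v) - \<kappa> (act q v)) + (comm p (\<kappa> (act q v)) - \<kappa> (act p (act q v)))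
      - comm q (comm p (\<kappa> v) - \<kappa> (act p v)) - (comm q (\<kappa> (act p v)) - \<kappa> (act q (act p v)))"
  proof -
    have "\<kappa> (act (comm p q) v) = \<kappa> (act p (act q v)) - \<kappa> (act q (act p v))"
      using comm by (simp add: act_comm \<kappa>_diff)
    then show ?thesis by (simp add: comm_def algebra_simps)
  qed
  also have "\<dots> \<in> lie_ideal (A \<union> B) AR"
    by (intro lie_ideal_diff lie_ideal.add lie_ideal_comm pq comm.IH) (use comm in auto)
  finally show ?case .
qed

lemma act_cong_mono:
  assumes "d \<in> Lie B" "v \<in> carrier \<aa>" "AR \<subseteq> S"
  shows "comm d (\<kappa> v) - \<kappa> (act d v) \<in> lie_ideal (A \<union> B) S"
  using lie_ideal_mono[OF act_cong[OF assms(1,2)] order_refl assms(3)] .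

lemma in_\<aa>_comm_B:
  assumes "in_\<aa> S p" "d \<in> Lie B" "AR \<subseteq> S"
  shows "in_\<aa> S (comm d p)"
proof -
  obtain v where v: "v \<in> carrier \<aa>" "p - \<kappa> v \<in> lie_ideal (A \<union> B) S"
    using assms unfolding in_\<aa>_def by blast
  have "d \<in> Lie (A \<union> B)" by (rule Lie_mono[OF assms(2)]) simp
  then have "comm d (p - \<kappa> v) + (comm d (\<kappa> v) - \<kappa> (act d v)) \<in> lie_ideal (A \<union> B) S"
    using v act_cong_mono[OF assms(2) v(1) assms(3)] by (intro lie_ideal.add lie_ideal_comm)
  then show ?thesis unfolding in_\<aa>_def using v assms by (intro bexI[of _ "act d v"]) (auto simp: comm_simps)
qed

lemma in_\<aa>_comm_B': "in_\<aa> S p \<Longrightarrow> d \<in> Lie B \<Longrightarrow> AR \<subseteq> S \<Longrightarrow> in_\<aa> S (comm p d)"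
  using in_\<aa>_minus[OF in_\<aa>_comm_B, of S p d] comm_antisym[of p d] by simp

lemma in_\<aa>_plug:
  "set (left_word C) \<union> set (right_word C) \<subseteq> B \<Longrightarrow> in_\<aa> S p \<Longrightarrow> AR \<subseteq> S \<Longrightarrow> in_\<aa> S (plug C p)"
  by (induction C) (auto intro: in_\<aa>_comm_B in_\<aa>_comm_B' lie_eval_Lie)

lemma in_\<aa>_special:
  assumes "c @ v @ d \<in> ALSW B" "alsw v" "in_\<aa> S p" "AR \<subseteq> S"
  shows "in_\<aa> S (special c v d p)"
  using special_ctx_words[of c v d] assms unfolding special_def
  by (intro in_\<aa>_plug) (auto simp: ALSW_def)

lemma AR_monic_at:
  assumes "a \<in> A" "b \<in> B"
  shows "monic_at [b, a] (comm (letter b) (letter a) - \<kappa> (act (letter b) (\<epsilon> a)))"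
proof -
  have 1: "comm (letter b) (letter a) = mon [b, a] - mon [a, b]"
    by (simp add: comm_def letter_mon mon_mult)
  moreover have "[a, b] < [b, a]" using A_less_B[OF assms] by (simp add: Cons_less_Cons)
  moreover have "\<kappa> (act (letter b) (\<epsilon> a)) \<in> below [b, a]"
    using assms by (intro \<kappa>_below) (auto simp: Lie.letter intro: shorter_imp_less)
  ultimately show ?thesis unfolding 1 by (intro monic_at_diff) auto
qed

lemma AR_lead: "a \<in> A \<Longrightarrow> b \<in> B \<Longrightarrow> lead (comm (letter b) (letter a) - \<kappa> (act (letter b) (\<epsilon> a))) = [b, a]"
  by (rule monic_at_lead[OF AR_monic_at])

lemma ARE:
  assumes "s \<in> AR"
  obtains a b where "a \<in> A" "b \<in> B" "s = comm (letter b) (letter a) - \<kappa> (act (letter b) (\<epsilon> a))" "lead s = [b, a]"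
    "monic_at (lead s) s"
  using assms AR_lead AR_monic_at unfolding action_relations_def by (smt (verit, ccfv_threshold) mem_Collect_eq)

text \<open>The leading words \<open>ba\<close> do not overlap.\<close>

lemma confluent_AR: "confluent AR"
proof (rule confluentI)
  show "monic_at (lead s) s" if "s \<in> AR" for s using that by (rule ARE)
next
  fix s t x y assume st: "s \<in> AR" "t \<in> AR" "lead s = x @ lead t @ y"
  obtain a b where s: "s = comm (letter b) (letter a) - \<kappa> (act (letter b) (\<epsilon> a))" "lead s = [b, a]"
    using st(1) by (rule ARE)
  obtain a' b' where t: "t = comm (letter b') (letter a') - \<kappa> (act (letter b') (\<epsilon> a'))" "lead t = [b', a']"
    using st(2) by (rule ARE)
  have "b = b' \<and> a = a'" using st(3) s(2) t(2) by (cases x) (auto simp: Cons_eq_append_conv)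
  moreover from this have "s = t" using s t by simp
  ultimately show "s - mon x * t * mon y \<in> ideal_below AR (lead s)"
    using st(3) self_inclusion by simp
next
  fix s t c d assume st: "s \<in> AR" "t \<in> AR" "lead s @ c = d @ lead t" "length c < length (lead t)"
  obtain a b where s: "a \<in> A" "b \<in> B" "s = comm (letter b) (letter a) - \<kappa> (act (letter b) (\<epsilon> a))" "lead s = [b, a]"
    using st(1) by (rule ARE)
  obtain a' b' where t: "a' \<in> A" "b' \<in> B" "t = comm (letter b') (letter a') - \<kappa> (act (letter b') (\<epsilon> a'))" "lead t = [b', a']"
    using st(2) by (rule ARE)
  have "length c = length d" using arg_cong[OF st(3), of length] s t by simp
  then consider "c = []" "d = []" | x y where "c = [x]" "d = [y]"
    using st(4) t(4) by (cases c; cases d) auto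
  then show "s * mon c - mon d * t \<in> ideal_below AR (lead s @ c)"
  proof cases
    case 1
    then have "s = t" using st(3) s t by simp
    then show ?thesis using 1 by (simp add: ideal_below_closed)
  next
    case 2
    then have "a = b'" using st(3) s t by simp
    then show ?thesis using A_B_disjoint s t by blast
  qed
qed

lemma letters_irreducible_AR: "letters_irreducible AR"
  unfolding letters_irreducible_def
proof (intro conjI confluent_AR AR_Lie ballI allI)
  fix s x a b assume "s \<in> AR" "x \<in> A"
  then show "[x] \<noteq> a @ lead s @ b" by (elim ARE) (auto simp: Cons_eq_append_conv)
qed

lemma Red_AR_\<kappa>:
  assumes "in_\<aa> AR p"
  shows "\<exists>v\<in>carrier \<aa>. Red (A \<union> B) AR p = \<kappa> v \<and> p - \<kappa> v \<in> lie_ideal (A \<union> B) AR"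
  using assms Red_\<kappa>[OF letters_irreducible_AR] unfolding in_\<aa>_def by blast

end

section \<open>Confluence of the relations of the extension\<close>

text \<open>
  One identity settles all overlaps of two bracket relations; its last three terms are brackets with
  the values of the relations and cancel by the Jacobi identity in \<open>\<aa>\<close> or by the derivation property.
\<close>

lemma jacobi_overlap:
  "(comm x y - u) * z - x * (comm y z - w) =
    (comm x z - v) * y + z * (comm x y - u) - y * (comm x z - v) - (comm y z - w) * x +
    (comm v y + comm x w - comm u z)"
  by (simp add: comm_def algebra_simps)

lemma span_ideal_below: "p \<in> ncpoly.span T \<Longrightarrow> T \<subseteq> S \<Longrightarrow> (\<And>t. t \<in> T \<Longrightarrow> lead t < w) \<Longrightarrow> p \<in> ideal_below S w"
proof -
  assume "p \<in> ncpoly.span T" "T \<subseteq> S" "\<And>t. t \<in> T \<Longrightarrow> lead t < w"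
  moreover from this have "T \<subseteq> ideal_gens S (\<lambda>v. v < w)"
    using ideal_gensI[of _ S "\<lambda>v. v < w" "[]" "[]"] by auto
  ultimately show ?thesis unfolding ideal_below_def using ncpoly.span_mono by blast
qed

lemma ideal_below_mon_right: "s \<in> S \<Longrightarrow> lead s @ c < w \<Longrightarrow> s * mon c \<in> ideal_below S w"
  using ideal_gensI[of s S "\<lambda>v. v < w" "[]" c] by (simp add: ideal_below_def ncpoly.span_base)

lemma ideal_below_mon_left: "s \<in> S \<Longrightarrow> c @ lead s < w \<Longrightarrow> mon c * s \<in> ideal_below S w"
  using ideal_gensI[of s S "\<lambda>v. v < w" c "[]"] by (simp add: ideal_below_def ncpoly.span_base)

lemma ideal_below_letter_right: "s \<in> S \<Longrightarrow> lead s @ [x] < w \<Longrightarrow> s * letter x \<in> ideal_below S w"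
  unfolding letter_mon by (rule ideal_below_mon_right)

lemma ideal_below_letter_left: "s \<in> S \<Longrightarrow> x # lead s < w \<Longrightarrow> letter x * s \<in> ideal_below S w"
  unfolding letter_mon by (rule ideal_below_mon_left) simp_all

lemma plug_diff: "plug C (p - q) = plug C p - plug C q"
  by (induction C) (auto simp: comm_simps)

lemma special_diff: "special a v b (p - q) = special a v b p - special a v b q"
  by (simp add: special_def plug_diff)

text \<open>
  A linear combination of special bracketings with \<open>F g\<close> in the place of \<open>g\<close>: for the identity it is
  \<^const>\<open>special_sum\<close>, and for \<open>F g = \<lfloor>g\<rfloor>\<close> it is the combination on the right of condition (b) before
  reduction.
\<close>

definition special_comb ::
  "('k::field \<times> 'x::wellorder list \<times> ('x, 'k) ncpoly \<times> 'x list) list \<Rightarrow> (('x, 'k) ncpoly \<Rightarrow> ('x, 'k) ncpoly) \<Rightarrow> ('x, 'k) ncpoly" where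
  "special_comb ts F = (\<Sum>(\<alpha>, c, g, d)\<leftarrow>ts. pscale \<alpha> (special c (lead g) d (F g)))"

lemma special_comb_Nil [simp]: "special_comb [] F = 0"
  by (simp add: special_comb_def)

lemma special_comb_Cons [simp]: "special_comb ((\<alpha>, c, g, d) # ts) F = pscale \<alpha> (special c (lead g) d (F g)) + special_comb ts F"
  by (simp add: special_comb_def)

lemma special_comb_diff: "special_comb ts (\<lambda>g. F g - G g) = special_comb ts F - special_comb ts G"
  by (induction ts) (auto simp: special_diff ncpoly.scale_right_diff_distrib)

lemma special_sum_comb: "special_sum ts = special_comb ts (\<lambda>g. g)"
  by (simp add: special_sum_def special_comb_def)

lemma below_terms_Cons [simp]: "below_terms X S w ((\<alpha>, c, g, d) # ts) \<longleftrightarrow>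
  (c \<in> lists X \<and> d \<in> lists X \<and> g \<in> S \<and> c @ lead g @ d \<in> ALSW X \<and> c @ lead g @ d < w) \<and> below_terms X S w ts"
  by (simp add: below_terms_def)

context lie_setting
begin

text \<open>
  The two leading words overlap in a nonempty word, so their union is again a Lyndon-Shirshov word
  and the special bracketings of the composition are defined.
\<close>

lemma overlap_words:
  assumes f: "f\<^sub>1 \<in> R" "f\<^sub>2 \<in> R" and eq: "lead f\<^sub>1 @ c = d @ lead f\<^sub>2" and len: "length c < length (lead f\<^sub>2)"
  shows "lead f\<^sub>1 @ c \<in> ALSW B" "c \<in> lists B" "d \<in> lists B" "overlap f\<^sub>1 c d f\<^sub>2 (lead f\<^sub>1 @ c)"
proof -
  have "length d \<le> length (lead f\<^sub>1)"
    using arg_cong[OF eq, of length] len unfolding length_append by linarith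
  then have "take (length d) (lead f\<^sub>1) = d"
    using arg_cong[OF eq, of "take (length d)"] by simp
  then obtain y where y: "lead f\<^sub>1 = d @ y" by (metis append_take_drop_id)
  then have y2: "lead f\<^sub>2 = y @ c" "y \<noteq> []" using eq len by auto
  have al: "alsw (d @ y)" "alsw (y @ c)" using R_lead_ALSW[OF f(1)] R_lead_ALSW[OF f(2)] y y2 by (auto simp: ALSW_def)
  show "lead f\<^sub>1 @ c \<in> ALSW B" "c \<in> lists B" "d \<in> lists B"
    using alsw_overlap[OF al y2(2)] lead_R_B[OF f(1)] lead_R_B[OF f(2)] y y2 by (auto simp: ALSW_def)
  show "overlap f\<^sub>1 c d f\<^sub>2 (lead f\<^sub>1 @ c)" unfolding overlap_def using y y2 by simp
qed

end

locale lie_factor_set = lie_action \<aa> A B \<epsilon> R act for \<aa> :: "('k::field, 'v) module" (structure)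
    and A B :: "'x::wellorder set" and \<epsilon> R act +
  fixes fs :: "('x, 'k) ncpoly \<Rightarrow> 'v"
  assumes fs: "fs \<in> R \<rightarrow> carrier \<aa>"
begin

abbreviation LR :: "('x, 'k) ncpoly set" where "LR \<equiv> LieR \<aa> A \<epsilon> B R fs act"

abbreviation fl :: "('x, 'k) ncpoly \<Rightarrow> ('x, 'k) ncpoly" where "fl f \<equiv> \<kappa> (fs f)"

definition AA :: "('x, 'k) ncpoly set" where
  "AA = {comm (letter a) (letter a') - \<kappa> (\<epsilon> a \<otimes> \<epsilon> a') | a a'. a \<in> A \<and> a' \<in> A \<and> a > a'}"

lemma LR_eq: "LR = AA \<union> AR \<union> {f - fl f | f. f \<in> R}"
  by (simp add: LieR_def AA_def)

lemma fs_closed [simp]: "f \<in> R \<Longrightarrow> fs f \<in> carrier \<aa>"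
  using fs by blast

lemma AR_subset: "AR \<subseteq> LR"
  by (auto simp: LR_eq)

lemma R_Lie_Un: "f \<in> R \<Longrightarrow> f \<in> Lie (A \<union> B)"
  by (rule Lie_mono[of _ B]) (use R_Lie in auto)

lemma LR_Lie: "LR \<subseteq> Lie (A \<union> B)"
  unfolding LR_eq AA_def using AR_Lie R_Lie_Un
  by (auto intro!: Lie_diff Lie.comm Lie.letter \<kappa>_Lie_Un)

lemma AA_monic_at:
  assumes "a \<in> A" "a' \<in> A" "a > a'"
  shows "monic_at [a, a'] (comm (letter a) (letter a') - \<kappa> (\<epsilon> a \<otimes> \<epsilon> a'))"
proof -
  have 1: "comm (letter a) (letter a') = mon [a, a'] - mon [a', a]"
    by (simp add: comm_def letter_mon mon_mult)
  have "\<kappa> (\<epsilon> a \<otimes> \<epsilon> a') \<in> below [a, a']"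
    using assms by (intro \<kappa>_below) (auto intro: shorter_imp_less)
  then show ?thesis unfolding 1 using assms by (intro monic_at_diff) (auto simp: Cons_less_Cons)
qed

lemma fl_below: "f \<in> R \<Longrightarrow> fl f \<in> below (lead f)"
  by (intro \<kappa>_below letter_less_B_word lead_R_B lead_R_nonempty) auto

lemma RR_monic_at: "f \<in> R \<Longrightarrow> monic_at (lead f) (f - fl f)"
  by (intro monic_at_diff R_monic_at fl_below)

lemma RR_lead: "f \<in> R \<Longrightarrow> lead (f - fl f) = lead f"
  by (rule monic_at_lead[OF RR_monic_at])

lemma LR_cases:
  assumes "s \<in> LR"
  obtains (AA) a a' where "a \<in> A" "a' \<in> A" "a > a'" "s = comm (letter a) (letter a') - \<kappa> (\<epsilon> a \<otimes> \<epsilon> a')"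
      "lead s = [a, a']"
    | (AR) a b where "a \<in> A" "b \<in> B" "s = comm (letter b) (letter a) - \<kappa> (act (letter b) (\<epsilon> a))" "lead s = [b, a]"
    | (RR) f where "f \<in> R" "s = f - fl f" "lead s = lead f"
proof -
  consider "s \<in> AA" | "s \<in> AR" | "\<exists>f\<in>R. s = f - fl f" using assms unfolding LR_eq by blast
  then show ?thesis
  proof cases
    case 1
    then obtain a a' where s: "a \<in> A" "a' \<in> A" "a > a'" "s = comm (letter a) (letter a') - \<kappa> (\<epsilon> a \<otimes> \<epsilon> a')"
      unfolding AA_def by blast
    then have "lead s = [a, a']" using monic_at_lead[OF AA_monic_at] by blast
    with s AA show ?thesis by blast
  next
    case 2
    then show ?thesis using ARE that(2) by metis
  next
    case 3
    then show ?thesis using RR RR_lead by blast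
  qed
qed

lemma LR_monic_at: "s \<in> LR \<Longrightarrow> monic_at (lead s) s"
proof (elim LR_cases)
  fix a b assume "a \<in> A" "b \<in> B" "s = comm (letter b) (letter a) - \<kappa> (act (letter b) (\<epsilon> a))" "lead s = [b, a]"
  then show ?thesis using AR_monic_at[of a b] by simp
next
  fix a a' assume "a \<in> A" "a' \<in> A" "a > a'" "s = comm (letter a) (letter a') - \<kappa> (\<epsilon> a \<otimes> \<epsilon> a')" "lead s = [a, a']"
  then show ?thesis using AA_monic_at[of a a'] by simp
next
  fix f assume "f \<in> R" "s = f - fl f" "lead s = lead f"
  then show ?thesis using RR_monic_at[of f] by simp
qed

lemma bracket_letters_cong: "a \<in> A \<Longrightarrow> a' \<in> A \<Longrightarrow> comm (letter a) (letter a') - \<kappa> (\<epsilon> a \<otimes> \<epsilon> a') \<in> ncpoly.span AA"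
proof (cases a a' rule: linorder_cases)
  assume aa: "a \<in> A" "a' \<in> A"
  case less
  have "comm (letter a') (letter a) - \<kappa> (\<epsilon> a' \<otimes> \<epsilon> a) \<in> ncpoly.span AA"
    using aa less by (intro ncpoly.span_base) (auto simp: AA_def)
  then have "- (comm (letter a') (letter a) - \<kappa> (\<epsilon> a' \<otimes> \<epsilon> a)) \<in> ncpoly.span AA"
    by (rule ncpoly.span_neg)
  moreover have "\<kappa> (\<epsilon> a \<otimes> \<epsilon> a') = - \<kappa> (\<epsilon> a' \<otimes> \<epsilon> a)"
    using aa bracket_antisym[of "\<epsilon> a" "\<epsilon> a'"] by (simp add: \<kappa>_minus)
  ultimately show ?thesis by (simp add: comm_antisym[of "letter a" "letter a'"])
next
  assume aa: "a \<in> A" "a' \<in> A"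
  case equal
  then show ?thesis using aa by (simp add: bracket_self comm_simps ncpoly.span_zero)
next
  assume aa: "a \<in> A" "a' \<in> A"
  case greater
  then show ?thesis using aa by (intro ncpoly.span_base) (auto simp: AA_def)
qed

lemma bracket_cong:
  assumes "v \<in> carrier \<aa>" "w \<in> carrier \<aa>"
  shows "comm (\<kappa> v) (\<kappa> w) - \<kappa> (v \<otimes> w) \<in> ncpoly.span AA"
  using assms(1)
proof (induction rule: carrier_induct)
  case (basis a)
  show ?case
    using assms(2)
  proof (induction rule: carrier_induct)
    case (basis a')
    then show ?case using \<open>a \<in> A\<close> bracket_letters_cong by (simp add: \<kappa>_\<epsilon>)
  next
    case (add v w)
    have "comm (\<kappa> (\<epsilon> a)) (\<kappa> (v \<oplus> w)) - \<kappa> (\<epsilon> a \<otimes> (v \<oplus> w)) =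
        (comm (\<kappa> (\<epsilon> a)) (\<kappa> v) - \<kappa> (\<epsilon> a \<otimes> v)) + (comm (\<kappa> (\<epsilon> a)) (\<kappa> w) - \<kappa> (\<epsilon> a \<otimes> w))"
      using add \<open>a \<in> A\<close> by (simp add: \<kappa>_add bracket_add_right comm_simps)
    then show ?case using add by (simp only: ncpoly.span_add)
  next
    case (smult \<alpha> v)
    have "comm (\<kappa> (\<epsilon> a)) (\<kappa> (\<alpha> \<odot> v)) - \<kappa> (\<epsilon> a \<otimes> (\<alpha> \<odot> v)) = pscale \<alpha> (comm (\<kappa> (\<epsilon> a)) (\<kappa> v) - \<kappa> (\<epsilon> a \<otimes> v))"
      using smult \<open>a \<in> A\<close> by (simp add: \<kappa>_smult bracket_smult_right comm_simps ncpoly.scale_right_diff_distrib)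
    then show ?case using smult by (simp only: ncpoly.span_scale)
  qed (use \<open>a \<in> A\<close> in \<open>simp add: comm_simps ncpoly.span_zero\<close>)
next
  case (add v v')
  have "comm (\<kappa> (v \<oplus> v')) (\<kappa> w) - \<kappa> ((v \<oplus> v') \<otimes> w) =
      (comm (\<kappa> v) (\<kappa> w) - \<kappa> (v \<otimes> w)) + (comm (\<kappa> v') (\<kappa> w) - \<kappa> (v' \<otimes> w))"
    using add assms by (simp add: \<kappa>_add bracket_add_left comm_simps)
  then show ?case using add by (simp only: ncpoly.span_add)
next
  case (smult \<alpha> v)
  have "comm (\<kappa> (\<alpha> \<odot> v)) (\<kappa> w) - \<kappa> ((\<alpha> \<odot> v) \<otimes> w) = pscale \<alpha> (comm (\<kappa> v) (\<kappa> w) - \<kappa> (v \<otimes> w))"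
    using smult assms by (simp add: \<kappa>_smult bracket_smult_left comm_simps ncpoly.scale_right_diff_distrib)
  then show ?case using smult by (simp only: ncpoly.span_scale)
qed (use assms in \<open>simp add: comm_simps ncpoly.span_zero\<close>)

lemma bracket_cong_below:
  assumes "v \<in> carrier \<aa>" "w \<in> carrier \<aa>" "\<And>a a'. a \<in> A \<Longrightarrow> a' \<in> A \<Longrightarrow> [a, a'] < z"
  shows "comm (\<kappa> v) (\<kappa> w) - \<kappa> (v \<otimes> w) \<in> ideal_below LR z"
proof (rule span_ideal_below[OF bracket_cong[OF assms(1,2)]])
  show "lead t < z" if "t \<in> AA" for t
    using that monic_at_lead[OF AA_monic_at] assms(3) unfolding AA_def by auto
qed (auto simp: LR_eq)

lemma bracket_cong_ideal:
  assumes "v \<in> carrier \<aa>" "w \<in> carrier \<aa>"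
  shows "comm (\<kappa> v) (\<kappa> w) - \<kappa> (v \<otimes> w) \<in> lie_ideal (A \<union> B) LR"
  by (rule lie_ideal_mono[OF span_lie_ideal[OF bracket_cong[OF assms]] order_refl]) (auto simp: LR_eq)

lemma overlap_AA_AA:
  assumes x: "x \<in> A" "y \<in> A" "z \<in> A" "x > y" "y > z"
  shows "(comm (letter x) (letter y) - \<kappa> (\<epsilon> x \<otimes> \<epsilon> y)) * letter z - letter x * (comm (letter y) (letter z) - \<kappa> (\<epsilon> y \<otimes> \<epsilon> z))
    \<in> ideal_below LR [x, y, z]"
proof -
  have rel: "comm (letter u) (letter v) - \<kappa> (\<epsilon> u \<otimes> \<epsilon> v) \<in> LR"
    "lead (comm (letter u) (letter v) - \<kappa> (\<epsilon> u \<otimes> \<epsilon> v)) = [u, v]" if "u \<in> A" "v \<in> A" "u > v" for u v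
    using that monic_at_lead[OF AA_monic_at] by (auto simp: LR_eq AA_def)
  have short: "[u, v] < [x, y, z]" for u v by (rule shorter_imp_less) simp
  have "\<kappa> (\<epsilon> x \<otimes> \<epsilon> y \<otimes> \<epsilon> z) = \<kappa> (\<epsilon> x \<otimes> \<epsilon> z \<otimes> \<epsilon> y) + \<kappa> (\<epsilon> x \<otimes> (\<epsilon> y \<otimes> \<epsilon> z))"
    using x bracket_leibniz[of "\<epsilon> x" "\<epsilon> y" "\<epsilon> z"] by (simp add: \<kappa>_add)
  then have E: "comm (\<kappa> (\<epsilon> x \<otimes> \<epsilon> z)) (letter y) + comm (letter x) (\<kappa> (\<epsilon> y \<otimes> \<epsilon> z)) - comm (\<kappa> (\<epsilon> x \<otimes> \<epsilon> y)) (letter z) =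
      (comm (\<kappa> (\<epsilon> x \<otimes> \<epsilon> z)) (\<kappa> (\<epsilon> y)) - \<kappa> (\<epsilon> x \<otimes> \<epsilon> z \<otimes> \<epsilon> y)) +
      (comm (\<kappa> (\<epsilon> x)) (\<kappa> (\<epsilon> y \<otimes> \<epsilon> z)) - \<kappa> (\<epsilon> x \<otimes> (\<epsilon> y \<otimes> \<epsilon> z))) -
      (comm (\<kappa> (\<epsilon> x \<otimes> \<epsilon> y)) (\<kappa> (\<epsilon> z)) - \<kappa> (\<epsilon> x \<otimes> \<epsilon> y \<otimes> \<epsilon> z))"
    using x by (simp add: \<kappa>_\<epsilon>)
  have "x > z" using x by simp
  show ?thesis
    unfolding jacobi_overlap[of _ _ _ _ _ "\<kappa> (\<epsilon> x \<otimes> \<epsilon> z)"] E unfolding letter_mon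
    by (intro ideal_below_closed(2,3) ideal_below_mon_left ideal_below_mon_right bracket_cong_below short)
      (use x \<open>x > z\<close> rel in \<open>auto simp: Cons_less_Cons letter_mon[symmetric]\<close>)
qed

lemma overlap_AR_AA:
  assumes x: "b \<in> B" "y \<in> A" "z \<in> A" "y > z"
  shows "(comm (letter b) (letter y) - \<kappa> (act (letter b) (\<epsilon> y))) * letter z - letter b * (comm (letter y) (letter z) - \<kappa> (\<epsilon> y \<otimes> \<epsilon> z))
    \<in> ideal_below LR [b, y, z]"
proof -
  have rel: "comm (letter u) (letter v) - \<kappa> (\<epsilon> u \<otimes> \<epsilon> v) \<in> LR"
    "lead (comm (letter u) (letter v) - \<kappa> (\<epsilon> u \<otimes> \<epsilon> v)) = [u, v]" if "u \<in> A" "v \<in> A" "u > v" for u v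
    using that monic_at_lead[OF AA_monic_at] by (auto simp: LR_eq AA_def)
  have rel_b: "comm (letter b) (letter v) - \<kappa> (act (letter b) (\<epsilon> v)) \<in> LR"
    "lead (comm (letter b) (letter v) - \<kappa> (act (letter b) (\<epsilon> v))) = [b, v]" if "v \<in> A" for v
    using that x(1) AR_lead ARI by (auto simp: LR_eq)
  have short: "[u, v] < [b, y, z]" for u v by (rule shorter_imp_less) simp
  have b: "(letter b :: ('x, 'k) ncpoly) \<in> Lie B" using x by (intro Lie.letter)
  have less: "y < b" "z < b" using x A_less_B by auto
  have "act (letter b) (\<epsilon> y \<otimes> \<epsilon> z) = act (letter b) (\<epsilon> y) \<otimes> \<epsilon> z \<oplus> \<ominus> (act (letter b) (\<epsilon> z) \<otimes> \<epsilon> y)"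
    using x b bracket_antisym[of "\<epsilon> y" "act (letter b) (\<epsilon> z)"] by (simp add: act_bracket)
  then have "\<kappa> (act (letter b) (\<epsilon> y \<otimes> \<epsilon> z)) = \<kappa> (act (letter b) (\<epsilon> y) \<otimes> \<epsilon> z) - \<kappa> (act (letter b) (\<epsilon> z) \<otimes> \<epsilon> y)"
    using x b by (simp add: \<kappa>_add \<kappa>_minus)
  then have E: "comm (\<kappa> (act (letter b) (\<epsilon> z))) (letter y) + comm (letter b) (\<kappa> (\<epsilon> y \<otimes> \<epsilon> z)) - comm (\<kappa> (act (letter b) (\<epsilon> y))) (letter z) =
      (comm (\<kappa> (act (letter b) (\<epsilon> z))) (\<kappa> (\<epsilon> y)) - \<kappa> (act (letter b) (\<epsilon> z) \<otimes> \<epsilon> y)) +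
      (comm (letter b) (\<kappa> (\<epsilon> y \<otimes> \<epsilon> z)) - \<kappa> (act (letter b) (\<epsilon> y \<otimes> \<epsilon> z))) -
      (comm (\<kappa> (act (letter b) (\<epsilon> y))) (\<kappa> (\<epsilon> z)) - \<kappa> (act (letter b) (\<epsilon> y) \<otimes> \<epsilon> z))"
    using x by (simp add: \<kappa>_\<epsilon>)
  have "comm (letter b) (\<kappa> (\<epsilon> y \<otimes> \<epsilon> z)) - \<kappa> (act (letter b) (\<epsilon> y \<otimes> \<epsilon> z)) \<in> ideal_below LR [b, y, z]"
  proof (rule span_ideal_below[OF act_letter_cong])
    show "lead t < [b, y, z]" if "t \<in> AR" for t
      using that by (elim ARE) (auto intro: shorter_imp_less)
  qed (use x in \<open>auto simp: LR_eq\<close>)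
  note act = this
  show ?thesis
    unfolding jacobi_overlap[of _ _ _ _ _ "\<kappa> (act (letter b) (\<epsilon> z))"] E
  proof (intro ideal_below_closed(2)[OF ideal_below_closed(3)[OF ideal_below_closed(3)[OF ideal_below_closed(2)]]
        ideal_below_closed(3)[OF ideal_below_closed(2)[OF _ act]]])
    show "(comm (letter b) (letter z) - \<kappa> (act (letter b) (\<epsilon> z))) * letter y \<in> ideal_below LR [b, y, z]"
      using x rel_b by (intro ideal_below_letter_right) (auto simp: Cons_less_Cons)
    show "letter z * (comm (letter b) (letter y) - \<kappa> (act (letter b) (\<epsilon> y))) \<in> ideal_below LR [b, y, z]"
      using x rel_b less by (intro ideal_below_letter_left) (auto simp: Cons_less_Cons)
    show "letter y * (comm (letter b) (letter z) - \<kappa> (act (letter b) (\<epsilon> z))) \<in> ideal_below LR [b, y, z]"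
      using x rel_b less by (intro ideal_below_letter_left) (auto simp: Cons_less_Cons)
    show "(comm (letter y) (letter z) - \<kappa> (\<epsilon> y \<otimes> \<epsilon> z)) * letter b \<in> ideal_below LR [b, y, z]"
      using x rel less by (intro ideal_below_letter_right) (auto simp: Cons_less_Cons)
  qed (use x b in \<open>auto intro!: bracket_cong_below short\<close>)
qed

text \<open>
  Putting the relation \<open>g - \<lfloor>g\<rfloor>\<close> into a special bracketing gives an element of the ideal with the expected
  bound, whereas putting in \<open>\<lfloor>g\<rfloor>\<close> alone gives a strictly smaller polynomial that is congruent to an
  element of \<open>\<aa>\<close>.
\<close>

lemma special_RR:
  assumes g: "g \<in> R" and w: "c @ lead g @ d \<in> ALSW B"
  shows "special c (lead g) d (g - fl g) - mon c * (g - fl g) * mon d \<in> ideal_below LR (c @ lead g @ d)"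
    and "c @ lead g @ d < w \<Longrightarrow> special c (lead g) d (g - fl g) \<in> ideal_below LR w"
    and "c @ lead g @ d \<le> w \<Longrightarrow> special c (lead g) d (fl g) \<in> below w"
    and "in_\<aa> AR (special c (lead g) d (fl g))"
proof -
  have al: "alsw (c @ lead g @ d)" "alsw (lead g)" using R_lead_ALSW[OF g] w by (auto simp: ALSW_def)
  have LR: "g - fl g \<in> LR" using g by (auto simp: LR_eq)
  show top: "special c (lead g) d (g - fl g) - mon c * (g - fl g) * mon d \<in> ideal_below LR (c @ lead g @ d)"
    using special_top[OF al, of "g - fl g"] hole_span_ideal[OF LR] RR_lead[OF g] by auto
  show "special c (lead g) d (g - fl g) \<in> ideal_below LR w" if "c @ lead g @ d < w"
  proof -
    have "mon c * (g - fl g) * mon d \<in> ideal_below LR w"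
      unfolding ideal_below_def by (intro ncpoly.span_base ideal_gensI LR) (use RR_lead[OF g] that in simp)
    then show ?thesis
      using top ideal_below_mono[of "c @ lead g @ d" w LR LR] that ideal_below_closed(2) by fastforce
  qed
  show "special c (lead g) d (fl g) \<in> below w" if "c @ lead g @ d \<le> w"
  proof -
    have k: "k < lead g" if "k \<in> Poly_Mapping.keys (fl g)" for k
      using fl_below[OF g] that by (auto simp: below_def)
    have "special c (lead g) d (fl g) - mon c * fl g * mon d \<in> below (c @ lead g @ d)"
      by (rule hole_span_below[OF special_top[OF al]]) (use k in \<open>auto intro: less_imp_le\<close>)
    moreover have "(mon c * fl g) * mon d \<in> below (c @ lead g @ d)"
    proof (rule below_mult_keys)
      fix j k' assume "j \<in> Poly_Mapping.keys (mon c * fl g)" "k' \<in> Poly_Mapping.keys (mon d :: ('x, 'k) ncpoly)"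
      then obtain k where "k \<in> Poly_Mapping.keys (fl g)" "j = c @ k" "k' = d"
        using keys_mult[of "mon c" "fl g"] by (auto simp: plus_list_def)
      then show "j @ k' < c @ lead g @ d" using sandwich_less[OF k] by simp
    qed
    ultimately show ?thesis using below_add that below_mono by fastforce
  qed
  show "in_\<aa> AR (special c (lead g) d (fl g))"
    by (rule in_\<aa>_special) (use w al g in \<open>auto intro: in_\<aa>_\<kappa>\<close>)
qed

lemma special_comb_ideal: "below_terms B R w ts \<Longrightarrow> special_comb ts (\<lambda>g. g - fl g) \<in> ideal_below LR w"
proof (induction ts)
  case (Cons t ts)
  then show ?case
    by (cases t) (auto intro!: ideal_below_closed(2,5) special_RR(2))
qed (simp add: ideal_below_closed)

lemma special_comb_below: "below_terms B R w ts \<Longrightarrow> special_comb ts fl \<in> below w"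
proof (induction ts)
  case (Cons t ts)
  then show ?case
    by (cases t) (auto intro!: below_add below_pscale special_RR(3) simp del: append_assoc)
qed simp

lemma special_comb_Red: "below_terms B R w ts \<Longrightarrow> special_comb ts fl -
    (\<Sum>(\<alpha>, c, g, d)\<leftarrow>ts. pscale \<alpha> (Red (A \<union> B) AR (special c (lead g) d (fl g)))) \<in> lie_ideal (A \<union> B) AR"
proof (induction ts)
  case (Cons t ts)
  obtain \<alpha> c g d where t: "t = (\<alpha>, c, g, d)" by (cases t) auto
  let ?q = "special c (lead g) d (fl g)" and ?r = "(\<Sum>(\<alpha>, c, g, d)\<leftarrow>ts. pscale \<alpha> (Red (A \<union> B) AR (special c (lead g) d (fl g))))"
  have "?q - Red (A \<union> B) AR ?q \<in> lie_ideal (A \<union> B) AR"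
    using Cons.prems t by (intro Red_cong letters_irreducible_AR special_RR(4)) auto
  then have "pscale \<alpha> (?q - Red (A \<union> B) AR ?q) + (special_comb ts fl - ?r) \<in> lie_ideal (A \<union> B) AR"
    using Cons t by (intro lie_ideal.add lie_ideal.scale) auto
  then show ?case by (simp add: t ncpoly.scale_right_diff_distrib algebra_simps)
qed (simp add: lie_ideal.zero)

end

locale lie_pair = lie_factor_set \<aa> A B \<epsilon> R act fs for \<aa> :: "('k::field, 'v) module" (structure)
    and A B :: "'x::wellorder set" and \<epsilon> R act fs +
  assumes cond_a: "condition_a \<aa> A \<epsilon> R fs act"
    and cond_b: "condition_b \<aa> A \<epsilon> B R fs act"
begin

text \<open>
  Condition (a): after moving \<open>a\<close> through \<open>f\<close> by the action, what remains of the overlap is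
  \<open>f \<cdot> a - [\<lfloor>f\<rfloor> a]\<close>.
\<close>

lemma overlap_RR_AR:
  assumes f: "f \<in> R" and x: "x \<in> A" "b \<in> B" and lead: "lead f = u @ [b]"
  shows "(f - fl f) * letter x - mon u * (comm (letter b) (letter x) - \<kappa> (act (letter b) (\<epsilon> x))) \<in> ideal_below LR (lead f @ [x])"
proof -
  let ?w = "lead f @ [x]" and ?t = "comm (letter b) (letter x) - \<kappa> (act (letter b) (\<epsilon> x))"
  have fB: "f \<in> Lie B" using f R_Lie by blast
  obtain b1 r where hd: "lead f = b1 # r" "b1 \<in> B" using lead_R_nonempty[OF f] lead_R_B[OF f] by (cases "lead f") auto
  have pair: "[v, v'] < ?w" if "v \<in> A" for v v'
    using that hd A_less_B[of v b1] by (cases r) (auto simp: Cons_less_Cons)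
  have flip: "x # lead f < ?w"
    using hd x A_less_B[of x b1] by (auto simp: Cons_less_Cons)
  define h where "h = comm f (letter x) - \<kappa> (act f (\<epsilon> x)) - mon u * ?t"
  have "h \<in> ideal_below AR ?w"
  proof (rule diamond_lemma[OF confluent_AR])
    have "comm f (letter x) - \<kappa> (act f (\<epsilon> x)) \<in> assoc_ideal AR"
      using lie_ideal_assoc_ideal[OF act_cong[OF fB, of "\<epsilon> x"]] x by (simp add: \<kappa>_\<epsilon>)
    moreover have "mon u * ?t * 1 \<in> assoc_ideal AR"
      by (intro assoc_ideal_mult assoc_ideal_base ARI x)
    ultimately show "h \<in> assoc_ideal AR"
      unfolding h_def mult_1_right by (rule assoc_ideal_closed(3))
    have "f * letter x - mon ?w \<in> below ?w"
      using monic_at_mult[OF R_monic_at[OF f] monic_at_mon[of "[x]"]] by (simp add: monic_at_def letter_mon)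
    moreover have "letter x * f \<in> below ?w"
      using monic_at_below[OF monic_at_mult[OF monic_at_mon[of "[x]"] R_monic_at[OF f]]] flip by (simp add: letter_mon)
    moreover have "\<kappa> (act f (\<epsilon> x)) \<in> below ?w"
      using x fB lead_R_nonempty[OF f] by (intro \<kappa>_below) (auto intro: shorter_imp_less)
    moreover have "mon u * ?t - mon ?w \<in> below ?w"
      using monic_at_mult[OF monic_at_mon[of u] AR_monic_at[OF x]] by (simp add: monic_at_def lead)
    ultimately have "(f * letter x - mon ?w) - letter x * f - \<kappa> (act f (\<epsilon> x)) - (mon u * ?t - mon ?w) \<in> below ?w"
      by (rule below_diff[OF below_diff[OF below_diff]])
    then show "h \<in> below ?w" by (simp add: h_def comm_def algebra_simps)
  qed
  then have "h \<in> ideal_below LR ?w" using ideal_below_mono[OF order_refl AR_subset] by blast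
  moreover have "letter x * (f - fl f) \<in> ideal_below LR ?w"
    unfolding letter_mon by (rule ideal_below_mon_left) (use f flip RR_lead in \<open>auto simp: LR_eq\<close>)
  moreover have "comm (fl f) (\<kappa> (\<epsilon> x)) - \<kappa> (fs f \<otimes> \<epsilon> x) \<in> ideal_below LR ?w"
    by (rule bracket_cong_below) (use f x pair in auto)
  ultimately have "h + letter x * (f - fl f) - (comm (fl f) (\<kappa> (\<epsilon> x)) - \<kappa> (fs f \<otimes> \<epsilon> x)) \<in> ideal_below LR ?w"
    by (rule ideal_below_closed(3)[OF ideal_below_closed(2)])
  moreover have "act f (\<epsilon> x) = fs f \<otimes> \<epsilon> x" using cond_a f x by (simp add: condition_a_def)
  ultimately show ?thesis using x by (simp add: h_def comm_def \<kappa>_\<epsilon> algebra_simps)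
qed

text \<open>
  Condition (b): up to terms in smaller words the overlap is the Lie composition of \<open>f\<^sub>1\<close> and \<open>f\<^sub>2\<close>
  minus the corresponding expression in \<open>\<lfloor>f\<^sub>1\<rfloor>\<close> and \<open>\<lfloor>f\<^sub>2\<rfloor>\<close>; the condition says that the expression obtained
  by applying \<open>\<lfloor> \<rfloor>\<close> to the triviality of the composition vanishes modulo \<open>AR\<close>.
\<close>

lemma overlap_RR_RR:
  assumes f: "f\<^sub>1 \<in> R" "f\<^sub>2 \<in> R" and eq: "lead f\<^sub>1 @ c = d @ lead f\<^sub>2" and len: "length c < length (lead f\<^sub>2)"
  shows "(f\<^sub>1 - fl f\<^sub>1) * mon c - mon d * (f\<^sub>2 - fl f\<^sub>2) \<in> ideal_below LR (lead f\<^sub>1 @ c)"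
proof -
  let ?w = "lead f\<^sub>1 @ c"
  note ov = overlap_words[OF f eq len]
  then have w: "?w \<in> ALSW B" "d @ lead f\<^sub>2 \<in> ALSW B" using eq by auto
  from ov obtain ts where ts: "below_terms B R ?w ts" "intersection_composition f\<^sub>1 c d f\<^sub>2 = special_sum ts"
    using R f unfolding minimal_GS_basis_def GS_basis_def trivial_mod_def by meson
  define p1 where "p1 p = special [] (lead f\<^sub>1) c p" for p :: "('x, 'k) ncpoly"
  define p2 where "p2 p = special d (lead f\<^sub>2) [] p" for p :: "('x, 'k) ncpoly"
  let ?y = "special_comb ts fl - (p1 (fl f\<^sub>1) - p2 (fl f\<^sub>2))"
  have in1: "in_\<aa> AR (p1 (fl f\<^sub>1) - p2 (fl f\<^sub>2))"
    unfolding p1_def p2_def using special_RR(4)[of f\<^sub>1 "[]" c] special_RR(4)[of f\<^sub>2 d "[]"] f w by (intro in_\<aa>_diff) auto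
  have "Red (A \<union> B) AR (p1 (fl f\<^sub>1) - p2 (fl f\<^sub>2)) =
      (\<Sum>(\<alpha>, c, g, d)\<leftarrow>ts. pscale \<alpha> (Red (A \<union> B) AR (special c (lead g) d (fl g))))"
    using cond_b f ov ts unfolding condition_b_def Let_def p1_def p2_def by blast
  then have "special_comb ts fl - Red (A \<union> B) AR (p1 (fl f\<^sub>1) - p2 (fl f\<^sub>2)) \<in> lie_ideal (A \<union> B) AR"
    using special_comb_Red[OF ts(1)] by simp
  from lie_ideal_diff[OF this Red_cong[OF letters_irreducible_AR in1]]
  have "?y \<in> assoc_ideal AR" by (intro lie_ideal_assoc_ideal) simp
  moreover have "?y \<in> below ?w"
    unfolding p1_def p2_def using special_RR(3)[of f\<^sub>1 "[]" c ?w] special_RR(3)[of f\<^sub>2 d "[]" ?w] f w eq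
    by (intro below_diff special_comb_below ts) auto
  ultimately have "?y \<in> ideal_below LR ?w"
    using diamond_lemma[OF confluent_AR] ideal_below_mono[OF order_refl AR_subset] by blast
  moreover have "special_comb ts (\<lambda>g. g - fl g) \<in> ideal_below LR ?w" by (rule special_comb_ideal[OF ts(1)])
  moreover have "p1 (f\<^sub>1 - fl f\<^sub>1) - (f\<^sub>1 - fl f\<^sub>1) * mon c \<in> ideal_below LR ?w"
    using special_RR(1)[of f\<^sub>1 "[]" c] f w by (simp add: p1_def)
  moreover have "p2 (f\<^sub>2 - fl f\<^sub>2) - mon d * (f\<^sub>2 - fl f\<^sub>2) \<in> ideal_below LR ?w"
    using special_RR(1)[of f\<^sub>2 d "[]"] f w eq by (simp add: p2_def)
  ultimately have "?y + special_comb ts (\<lambda>g. g - fl g) - (p1 (f\<^sub>1 - fl f\<^sub>1) - (f\<^sub>1 - fl f\<^sub>1) * mon c)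
      + (p2 (f\<^sub>2 - fl f\<^sub>2) - mon d * (f\<^sub>2 - fl f\<^sub>2)) \<in> ideal_below LR ?w"
    by (rule ideal_below_closed(2)[OF ideal_below_closed(3)[OF ideal_below_closed(2)]])
  moreover have "special_comb ts (\<lambda>g. g - fl g) = p1 f\<^sub>1 - p2 f\<^sub>2 - special_comb ts fl"
    using ts(2) by (simp add: special_comb_diff special_sum_comb[symmetric] intersection_composition_def p1_def p2_def)
  moreover have "p1 (f\<^sub>1 - fl f\<^sub>1) = p1 f\<^sub>1 - p1 (fl f\<^sub>1)" "p2 (f\<^sub>2 - fl f\<^sub>2) = p2 f\<^sub>2 - p2 (fl f\<^sub>2)"
    by (simp_all add: p1_def p2_def special_diff)
  ultimately show ?thesis by (simp add: algebra_simps)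
qed

lemma same_lead:
  assumes s: "s \<in> LR" and t: "t \<in> LR" and eq: "lead s = lead t"
  shows "s = t"
  using s
proof (cases rule: LR_cases)
  case s: (AA a a')
  show ?thesis using t
  proof (cases rule: LR_cases)
    case (RR g)
    then have "set [a, a'] \<subseteq> B" using lead_R_B[OF RR(1)] s eq by metis
    then show ?thesis using A_B_disjoint s by auto
  qed (use s eq A_B_disjoint in auto)
next
  case s: (AR a b)
  show ?thesis using t
  proof (cases rule: LR_cases)
    case (RR g)
    then have "set [b, a] \<subseteq> B" using lead_R_B[OF RR(1)] s eq by metis
    then show ?thesis using A_B_disjoint s by auto
  qed (use s eq A_B_disjoint in auto)
next
  case s: (RR f)
  have f: "set (lead t) \<subseteq> B" using lead_R_B[OF s(1)] s eq by simp
  show ?thesis using t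
  proof (cases rule: LR_cases)
    case (RR g)
    then show ?thesis using R_reduced[of f g "[]" "[]"] s eq by simp
  qed (use f A_B_disjoint in auto)
qed

text \<open>
  If \<open>f\<close> has a letter \<open>b\<close> as its leading word, the leading word \<open>ba\<close> of an action relation contains it; this
  inclusion is the degenerate case of the overlap of \<open>f\<close> with that relation.
\<close>

lemma LR_inclusions:
  assumes s: "s \<in> LR" and t: "t \<in> LR" and eq: "lead s = x @ lead t @ y"
  shows "s - mon x * t * mon y \<in> ideal_below LR (lead s)"
proof (cases "x = [] \<and> y = []")
  case True
  then show ?thesis using same_lead[OF s t] eq by (simp add: ideal_below_closed)
next
  case False
  have len: "length (lead t) < length (lead s)" using False eq by auto
  show ?thesis
    using s
  proof (cases rule: LR_cases)
    case s: (RR f)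
    have "set (lead f) = set x \<union> set (lead t) \<union> set y"
      using arg_cong[OF eq, of set] unfolding s(3) by auto
    then have tB: "set (lead t) \<subseteq> B" using lead_R_B[OF s(1)] by blast
    show ?thesis using t
    proof (cases rule: LR_cases)
      case (RR g)
      then have "f = g" using R_reduced[of f g x y] s eq by simp
      then show ?thesis using RR s len by simp
    qed (use tB A_B_disjoint in auto)
  next
    case s: (AA a a')
    show ?thesis using t
    proof (cases rule: LR_cases)
      case (RR f)
      have "set (lead t) \<subseteq> set (lead s)" unfolding eq by auto
      then have "set (lead f) \<subseteq> set (lead s)" using RR(3) by simp
      then have "set (lead f) \<subseteq> A" using s by auto
      then show ?thesis using lead_R_B[OF RR(1)] lead_R_nonempty[OF RR(1)] A_B_disjoint by (cases "lead f") auto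
    qed (use s len in auto)
  next
    case s: (AR a b)
    show ?thesis using t
    proof (cases rule: LR_cases)
      case (RR f)
      obtain e r where e: "lead f = e # r" using lead_R_nonempty[OF RR(1)] by (cases "lead f") auto
      then have "r = []" using len s RR by simp
      moreover have "e \<in> B" using e lead_R_B[OF RR(1)] by simp
      then have "x = [] \<and> y = [a] \<and> e = b"
        using eq RR s e \<open>r = []\<close> A_B_disjoint by (cases x) (auto simp: Cons_eq_append_conv append_eq_Cons_conv)
      ultimately have x: "x = []" "y = [a]" "lead f = [] @ [b]" using e by auto
      from overlap_RR_AR[OF RR(1) s(1,2) x(3)] ideal_below_closed(4)
      have "- (t * letter a - mon [] * s) \<in> ideal_below LR (lead f @ [a])" unfolding RR(2)[symmetric] s(3)[symmetric] by blast
      then show ?thesis using x s by (simp add: letter_mon)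
    qed (use s len in auto)
  qed
qed

lemma overlap_letters:
  assumes "u @ c = d @ v" "length c < length v" "u \<noteq> []" "v \<noteq> []"
  shows "last u \<in> set v"
proof -
  have "length d \<le> length u"
    using arg_cong[OF assms(1), of length] assms(2) unfolding length_append by linarith
  then have "take (length d) u = d"
    using arg_cong[OF assms(1), of "take (length d)"] by simp
  then obtain y where "u = d @ y" by (metis append_take_drop_id)
  then have "v = y @ c" "y \<noteq> []" "last u = last y" using assms by auto
  then show ?thesis by simp
qed

lemma LR_overlaps:
  assumes s: "s \<in> LR" and t: "t \<in> LR" and eq: "lead s @ c = d @ lead t" and len: "length c < length (lead t)"
  shows "s * mon c - mon d * t \<in> ideal_below LR (lead s @ c)"
proof -
  have ne: "lead s \<noteq> []" "lead t \<noteq> []" using s t lead_R_nonempty by (elim LR_cases; simp)+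
  have last: "last (lead s) \<in> set (lead t)" by (rule overlap_letters[OF eq len ne])
  have trivial: ?thesis if "c = []" "d = []"
    using that eq same_lead[OF s t] by (simp add: ideal_below_closed)
  show ?thesis
    using t
  proof (cases rule: LR_cases)
    case t: (RR g)
    have "last (lead s) \<in> B" using last t lead_R_B[OF t(1)] by auto
    with s show ?thesis
    proof (cases rule: LR_cases)
      case (RR f)
      then show ?thesis using overlap_RR_RR[OF RR(1) t(1), of c d] eq len t by simp
    qed (use A_B_disjoint in auto)
  next
    case t: (AR a b)
    then consider "c = []" | z where "c = [z]" using len by (cases c) auto
    then show ?thesis
    proof cases
      case 1
      show ?thesis using s
      proof (cases rule: LR_cases)
        case (RR f)
        then have "a \<in> B" using 1 eq t lead_R_B[OF RR(1)] by auto
        then show ?thesis using t A_B_disjoint by blast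
      qed (use 1 eq t trivial in auto)
    next
      case (2 z)
      then have eq': "lead s = d @ [b]" "z = a" using eq t by (simp_all add: append_eq_append_conv2 Cons_eq_append_conv)
      show ?thesis using s
      proof (cases rule: LR_cases)
        case (RR f)
        then show ?thesis using overlap_RR_AR[OF RR(1) t(1,2), of d] eq' t 2 by (simp add: letter_mon)
      qed (use eq' t A_B_disjoint in auto)
    qed
  next
    case t: (AA y z)
    then consider "c = []" | z' where "c = [z']" using len by (cases c) auto
    then show ?thesis
    proof cases
      case 1
      show ?thesis using s
      proof (cases rule: LR_cases)
        case (RR f)
        then have "z \<in> B" using 1 eq t lead_R_B[OF RR(1)] by auto
        then show ?thesis using t A_B_disjoint by blast
      qed (use 1 eq t trivial in auto)
    next
      case (2 z')
      then have eq': "lead s = d @ [y]" "z' = z" using eq t by (simp_all add: append_eq_append_conv2 Cons_eq_append_conv)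
      show ?thesis using s
      proof (cases rule: LR_cases)
        case (RR f)
        then have "y \<in> B" using eq' lead_R_B[OF RR(1)] by auto
        then show ?thesis using t A_B_disjoint by blast
      next
        case (AA x y')
        then show ?thesis using overlap_AA_AA[of x y z] eq' t 2 by (simp add: letter_mon)
      next
        case (AR y' b)
        then show ?thesis using overlap_AR_AA[of b y z] eq' t 2 by (simp add: letter_mon)
      qed
    qed
  qed
qed

theorem confluent_LR: "confluent LR"
  by (rule confluentI[OF LR_monic_at LR_inclusions LR_overlaps])

lemma letters_irreducible_LR: "letters_irreducible LR"
  unfolding letters_irreducible_def
proof (intro conjI confluent_LR LR_Lie ballI allI)
  fix s x u v assume s: "s \<in> LR" and x: "x \<in> A"
  show "[x] \<noteq> u @ lead s @ v"
    using s
  proof (cases rule: LR_cases)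
    case (RR f)
    then obtain e r where "lead f = e # r" "e \<in> B" using lead_R_nonempty[OF RR(1)] lead_R_B[OF RR(1)] by (cases "lead f") auto
    then show ?thesis using x RR A_B_disjoint by (auto simp: Cons_eq_append_conv)
  qed (auto simp: Cons_eq_append_conv)
qed

end

section \<open>Extensions\<close>

lemma extensionD:
  assumes "extension \<aa> \<bb> \<ee> i \<pi>"
  shows "lie_algebra \<ee>" "i \<in> lie_hom \<aa> \<ee>" "\<pi> \<in> lie_hom \<ee> \<bb>" "inj_on i (carrier \<aa>)"
    "\<And>v. v \<in> carrier \<aa> \<Longrightarrow> \<pi> (i v) = \<zero>\<^bsub>\<bb>\<^esub>"
    "\<And>x. x \<in> carrier \<ee> \<Longrightarrow> \<pi> x = \<zero>\<^bsub>\<bb>\<^esub> \<Longrightarrow> \<exists>v\<in>carrier \<aa>. x = i v"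
    "\<And>y. y \<in> carrier \<bb> \<Longrightarrow> \<exists>x\<in>carrier \<ee>. \<pi> x = y"
proof -
  note ext = assms[unfolded extension_def]
  show "lie_algebra \<ee>" "i \<in> lie_hom \<aa> \<ee>" "\<pi> \<in> lie_hom \<ee> \<bb>" "inj_on i (carrier \<aa>)"
    using ext by simp_all
  have ker: "i ` carrier \<aa> = {x \<in> carrier \<ee>. \<pi> x = \<zero>\<^bsub>\<bb>\<^esub>}" and surj: "carrier \<bb> = \<pi> ` carrier \<ee>"
    using ext by simp_all
  show "\<pi> (i v) = \<zero>\<^bsub>\<bb>\<^esub>" if "v \<in> carrier \<aa>" for v using ker that by blast
  show "\<exists>v\<in>carrier \<aa>. x = i v" if "x \<in> carrier \<ee>" "\<pi> x = \<zero>\<^bsub>\<bb>\<^esub>" for x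
  proof -
    have "x \<in> i ` carrier \<aa>" unfolding ker using that by simp
    then show ?thesis by blast
  qed
  show "\<exists>x\<in>carrier \<ee>. \<pi> x = y" if "y \<in> carrier \<bb>" for y
    using that unfolding surj by blast
qed

lemma extensionI:
  assumes "lie_algebra \<ee>" "i \<in> lie_hom \<aa> \<ee>" "\<pi> \<in> lie_hom \<ee> \<bb>" "inj_on i (carrier \<aa>)"
    "\<And>v. v \<in> carrier \<aa> \<Longrightarrow> \<pi> (i v) = \<zero>\<^bsub>\<bb>\<^esub>"
    "\<And>x. x \<in> carrier \<ee> \<Longrightarrow> \<pi> x = \<zero>\<^bsub>\<bb>\<^esub> \<Longrightarrow> \<exists>v\<in>carrier \<aa>. x = i v"
    "\<And>y. y \<in> carrier \<bb> \<Longrightarrow> \<exists>x\<in>carrier \<ee>. \<pi> x = y"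
  shows "extension \<aa> \<bb> \<ee> i \<pi>"
  unfolding extension_def
proof (intro conjI assms)
  show "i ` carrier \<aa> = {x \<in> carrier \<ee>. \<pi> x = \<zero>\<^bsub>\<bb>\<^esub>}"
    using assms(5,6) lie_homD(1)[OF assms(2)] by fast
  show "\<pi> ` carrier \<ee> = carrier \<bb>"
    using assms(7) lie_homD(1)[OF assms(3)] by fast
qed

lemma short_five:
  assumes \<aa>: "lie_algebra \<aa>" and \<bb>: "lie_algebra \<bb>"
    and ext: "extension \<aa> \<bb> \<ee> i \<pi>" and ext': "extension \<aa> \<bb> \<ee>' i' \<pi>'" and \<phi>: "\<phi> \<in> lie_hom \<ee> \<ee>'"
    and i: "\<And>v. v \<in> carrier \<aa> \<Longrightarrow> \<phi> (i v) = i' v" and \<pi>: "\<And>x. x \<in> carrier \<ee> \<Longrightarrow> \<pi>' (\<phi> x) = \<pi> x"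
  shows "bij_betw \<phi> (carrier \<ee>) (carrier \<ee>')"
proof -
  note E = extensionD[OF ext] and E' = extensionD[OF ext']
  interpret \<aa>: lie_algebra \<aa> by fact
  interpret \<bb>: lie_algebra \<bb> by fact
  interpret \<ee>: lie_algebra \<ee> by (rule E)
  interpret \<ee>': lie_algebra \<ee>' by (rule E')
  have "x = \<zero>\<^bsub>\<ee>\<^esub>" if x: "x \<in> carrier \<ee>" "\<phi> x = \<zero>\<^bsub>\<ee>'\<^esub>" for x
  proof -
    have "\<pi> x = \<zero>\<^bsub>\<bb>\<^esub>" using \<pi>[OF x(1)] x(2) lie_hom_zero[OF E'(3,1) \<bb>] by simp
    then obtain v where v: "v \<in> carrier \<aa>" "x = i v" using E(6) x by blast
    then have "i' v = i' \<zero>\<^bsub>\<aa>\<^esub>" using i x lie_hom_zero[OF E'(2) \<aa> E'(1)] by simp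
    then have "v = \<zero>\<^bsub>\<aa>\<^esub>" using E'(4) v by (simp add: inj_on_def)
    then show ?thesis using v lie_hom_zero[OF E(2) \<aa> E(1)] by simp
  qed
  then have "inj_on \<phi> (carrier \<ee>)" by (rule lie_hom_inj_on[OF \<phi> E(1) E'(1)])
  moreover have "y \<in> \<phi> ` carrier \<ee>" if y: "y \<in> carrier \<ee>'" for y
  proof -
    obtain x where x: "x \<in> carrier \<ee>" "\<pi> x = \<pi>' y" using E(7) lie_homD(1)[OF E'(3) y] by metis
    have \<phi>x: "\<phi> x \<in> carrier \<ee>'" using lie_homD(1)[OF \<phi>] x by simp
    have "\<pi>' (y \<ominus>\<^bsub>\<ee>'\<^esub> \<phi> x) = \<zero>\<^bsub>\<bb>\<^esub>"
      using lie_hom_minus[OF E'(3,1) \<bb> y \<phi>x] \<pi>[OF x(1)] x(2) lie_homD(1)[OF E'(3) y] \<bb>.minus_eq_zero by simp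
    then obtain v where v: "v \<in> carrier \<aa>" "y \<ominus>\<^bsub>\<ee>'\<^esub> \<phi> x = i' v" using E'(6) y \<phi>x by blast
    have iv: "i v \<in> carrier \<ee>" using lie_homD(1)[OF E(2)] v by simp
    have "\<phi> (i v \<oplus>\<^bsub>\<ee>\<^esub> x) = (y \<ominus>\<^bsub>\<ee>'\<^esub> \<phi> x) \<oplus>\<^bsub>\<ee>'\<^esub> \<phi> x"
      using lie_homD(2)[OF \<phi> iv x(1)] i[OF v(1)] v(2) by simp
    also have "\<dots> = y" using y \<phi>x by (simp add: a_minus_def \<ee>'.a_assoc \<ee>'.l_neg)
    finally show ?thesis using iv x(1) by (metis \<ee>.add.m_closed image_eqI)
  qed
  ultimately show ?thesis using lie_homD(1)[OF \<phi>] by (auto simp: bij_betw_def)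
qed

lemma equivalent_extensions_sym:
  assumes "lie_algebra \<aa>" "lie_algebra \<bb>" "extension \<aa> \<bb> \<ee> i \<pi>" "extension \<aa> \<bb> \<ee>' i' \<pi>'"
    and "equivalent_extensions \<aa> \<ee> i \<pi> \<ee>' i' \<pi>'"
  shows "equivalent_extensions \<aa> \<ee>' i' \<pi>' \<ee> i \<pi>"
proof -
  obtain \<phi> where \<phi>: "\<phi> \<in> lie_hom \<ee> \<ee>'" "\<And>v. v \<in> carrier \<aa> \<Longrightarrow> \<phi> (i v) = i' v"
    "\<And>x. x \<in> carrier \<ee> \<Longrightarrow> \<pi>' (\<phi> x) = \<pi> x"
    using assms(5) unfolding equivalent_extensions_def by blast
  note bij = short_five[OF assms(1-4) \<phi>]
  note E = extensionD[OF assms(3)]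
  let ?\<psi> = "inv_into (carrier \<ee>) \<phi>"
  have "?\<psi> (i' v) = i v" if "v \<in> carrier \<aa>" for v
    using bij_betw_inv_into_left[OF bij, of "i v"] \<phi>(2)[OF that] lie_homD(1)[OF E(2) that] by simp
  moreover have "\<pi> (?\<psi> y) = \<pi>' y" if "y \<in> carrier \<ee>'" for y
    using \<phi>(3)[of "?\<psi> y"] bij_betw_inv_into_right[OF bij that] lie_homD(1)[OF lie_hom_inverse[OF \<phi>(1) E(1) bij] that] by simp
  ultimately show ?thesis
    unfolding equivalent_extensions_def using lie_hom_inverse[OF \<phi>(1) E(1) bij] by blast
qed

lemma equivalent_extensions_trans:
  assumes "i \<in> lie_hom \<aa> \<ee>" "equivalent_extensions \<aa> \<ee> i \<pi> \<ee>' i' \<pi>'" "equivalent_extensions \<aa> \<ee>' i' \<pi>' \<ee>'' i'' \<pi>''"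
  shows "equivalent_extensions \<aa> \<ee> i \<pi> \<ee>'' i'' \<pi>''"
proof -
  obtain \<phi> \<psi> where \<phi>: "\<phi> \<in> lie_hom \<ee> \<ee>'" "\<And>v. v \<in> carrier \<aa> \<Longrightarrow> \<phi> (i v) = i' v" "\<And>x. x \<in> carrier \<ee> \<Longrightarrow> \<pi>' (\<phi> x) = \<pi> x"
    and \<psi>: "\<psi> \<in> lie_hom \<ee>' \<ee>''" "\<And>v. v \<in> carrier \<aa> \<Longrightarrow> \<psi> (i' v) = i'' v" "\<And>x. x \<in> carrier \<ee>' \<Longrightarrow> \<pi>'' (\<psi> x) = \<pi>' x"
    using assms(2,3) unfolding equivalent_extensions_def by blast
  show ?thesis
    unfolding equivalent_extensions_def
    by (rule bexI[OF _ lie_hom_comp[OF \<phi>(1) \<psi>(1)]]) (use \<phi> \<psi> lie_homD(1)[OF \<phi>(1)] in auto)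
qed

lemma extension_transport:
  assumes ext: "extension \<aa> \<bb> \<ee>' i \<pi>" and \<ee>: "lie_algebra \<ee>" and h: "h \<in> lie_hom \<ee> \<ee>'" "bij_betw h (carrier \<ee>) (carrier \<ee>')"
  shows "extension \<aa> \<bb> \<ee> (\<lambda>v. inv_into (carrier \<ee>) h (i v)) (\<lambda>x. \<pi> (h x))"
proof -
  note E = extensionD[OF ext]
  let ?g = "inv_into (carrier \<ee>) h"
  note g = lie_hom_inverse[OF h(1) \<ee> h(2)]
  have hg: "h (?g y) = y" if "y \<in> carrier \<ee>'" for y using bij_betw_inv_into_right[OF h(2) that] .
  have gh: "?g (h x) = x" if "x \<in> carrier \<ee>" for x using bij_betw_inv_into_left[OF h(2) that] .
  note iv = lie_homD(1)[OF E(2)] and hx = lie_homD(1)[OF h(1)] and gy = lie_homD(1)[OF g]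
  show ?thesis
  proof (rule extensionI[OF \<ee> lie_hom_comp[OF E(2) g] lie_hom_comp[OF h(1) E(3)]])
    show "inj_on (\<lambda>v. ?g (i v)) (carrier \<aa>)"
    proof (rule inj_onI)
      fix v w assume vw: "v \<in> carrier \<aa>" "w \<in> carrier \<aa>" "?g (i v) = ?g (i w)"
      have "i v = h (?g (i v))" using hg[OF iv[OF vw(1)]] by (rule sym)
      also have "\<dots> = i w" unfolding vw(3) by (rule hg[OF iv[OF vw(2)]])
      finally have "i v = i w" .
      then show "v = w" using E(4) vw by (simp add: inj_on_def)
    qed
    show "\<pi> (h (?g (i v))) = \<zero>\<^bsub>\<bb>\<^esub>" if "v \<in> carrier \<aa>" for v using E(5) hg iv that by simp
    show "\<exists>v\<in>carrier \<aa>. x = ?g (i v)" if "x \<in> carrier \<ee>" "\<pi> (h x) = \<zero>\<^bsub>\<bb>\<^esub>" for x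
      using E(6)[OF hx[OF that(1)] that(2)] gh[OF that(1)] by metis
    show "\<exists>x\<in>carrier \<ee>. \<pi> (h x) = y" if "y \<in> carrier \<bb>" for y
      using E(7)[OF that] hg gy by metis
  qed
qed


subsection \<open>The extension presented by a factor set and an action\<close>

context lie_setting
begin

abbreviation \<bb> :: "('k, ('x, 'k) ncpoly set) module" where "\<bb> \<equiv> presented_lie B R"

lemma lie_algebra_\<bb>: "lie_algebra \<bb>"
  by (rule lie_algebra_presented[OF R_Lie])

definition kill :: "('x, 'k) ncpoly \<Rightarrow> ('x, 'k) ncpoly" where
  "kill = free_hom (\<lambda>x. if x \<in> A then 0 else letter x)"

lemma kill_hom: "kill \<in> lie_hom (free_lie (A \<union> B)) (free_lie B)"
  unfolding kill_def by (rule free_hom_lie_hom) (auto intro: Lie.intros)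

lemma kill_Lie: "p \<in> Lie (A \<union> B) \<Longrightarrow> kill p \<in> Lie B"
  using lie_homD(1)[OF kill_hom] by simp

lemma kill_simps: "kill (p + q) = kill p + kill q" "kill (p - q) = kill p - kill q" "kill (pscale \<alpha> p) = pscale \<alpha> (kill p)"
  "kill (comm p q) = comm (kill p) (kill q)" "kill 0 = 0"
  by (simp_all add: kill_def free_hom_add free_hom_minus free_hom_pscale free_hom_comm)

lemma kill_letter: "x \<in> A \<Longrightarrow> kill (letter x) = 0" "x \<in> B \<Longrightarrow> kill (letter x) = letter x"
  using A_B_disjoint by (auto simp: kill_def)

lemma kill_B: "p \<in> Lie B \<Longrightarrow> kill p = p"
  by (induction rule: Lie.induct) (simp_all add: kill_simps kill_letter)

lemma kill_\<kappa>: "v \<in> carrier \<aa> \<Longrightarrow> kill (\<kappa> v) = 0"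
  by (induction rule: carrier_induct) (simp_all add: kill_simps kill_letter \<kappa>_\<epsilon> \<kappa>_add \<kappa>_smult)

end

context lie_pair
begin

abbreviation E :: "('k, ('x, 'k) ncpoly set) module" where "E \<equiv> LieE \<aa> A \<epsilon> B R fs act"

abbreviation incl :: "'v \<Rightarrow> ('x, 'k) ncpoly set" where "incl \<equiv> LieE_incl \<aa> A \<epsilon> B R fs act"

abbreviation rc :: "('x, 'k) ncpoly \<Rightarrow> ('x, 'k) ncpoly set" where "rc \<equiv> rel_coset (A \<union> B) LR"

lemma LieE_incl_eq: "incl v = rc (\<kappa> v)"
  by (simp add: LieE_incl_def rel_coset_def)

lemma lie_algebra_E: "lie_algebra E"
  unfolding LieE_def by (rule lie_algebra_presented[OF LR_Lie])

lemma rc_hom: "rc \<in> lie_hom (free_lie (A \<union> B)) E"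
  unfolding LieE_def by (rule rel_coset_hom[OF LR_Lie])

lemma E_carrier: "carrier E = rc ` Lie (A \<union> B)"
  by (simp add: LieE_def presented_lie_carrier)

text \<open>
  The span of \<open>\<aa>\<close> and the ideal is stable under brackets with all letters, by the relations for \<open>aa'\<close> and
  \<open>ba\<close>, hence under brackets with all Lie polynomials.
\<close>

lemma in_\<aa>_comm:
  assumes "r \<in> Lie (A \<union> B)" "in_\<aa> LR p"
  shows "in_\<aa> LR (comm p r)"
  using assms
proof (induction arbitrary: p rule: Lie.induct)
  case zero
  then show ?case by (simp add: comm_simps in_\<aa>_ideal lie_ideal.zero)
next
  case (letter x)
  show ?case
  proof (cases "x \<in> A")
    case True
    obtain v where v: "v \<in> carrier \<aa>" "p - \<kappa> v \<in> lie_ideal (A \<union> B) LR"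
      using letter.prems unfolding in_\<aa>_def by blast
    have "in_\<aa> LR (comm (p - \<kappa> v) (letter x) + (comm (\<kappa> v) (\<kappa> (\<epsilon> x)) - \<kappa> (v \<otimes> \<epsilon> x)) + \<kappa> (v \<otimes> \<epsilon> x))"
      using v True letter.hyps
      by (intro in_\<aa>_add in_\<aa>_\<kappa> in_\<aa>_ideal lie_ideal.comm bracket_cong_ideal) (auto intro: Lie.letter)
    then show ?thesis using True by (simp add: comm_simps \<kappa>_\<epsilon>)
  next
    case False
    then show ?thesis using letter in_\<aa>_comm_B'[OF _ Lie.letter AR_subset] by blast
  qed
next
  case (add r s)
  then show ?case by (simp add: comm_simps in_\<aa>_add)
next
  case (scale r \<alpha>)
  then show ?case by (simp add: comm_simps in_\<aa>_pscale)
next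
  case (comm r s)
  have "comm p (comm r s) = comm (comm p r) s - comm (comm p s) r"
    by (simp add: comm_def algebra_simps)
  then show ?case using comm by (simp add: in_\<aa>_diff)
qed

text \<open>
  A substitution that moves each letter by an element of \<open>\<aa>\<close> moves every Lie polynomial by one.  It is
  used for the projection \<open>kill\<close> and for \<open>\<Gamma>\<close>.
\<close>

lemma in_\<aa>_subst:
  assumes h: "\<And>p q. h (p + q) = h p + h q" "\<And>\<alpha> p. h (pscale \<alpha> p) = pscale \<alpha> (h p)" "\<And>p q. h (comm p q) = comm (h p) (h q)"
    and letters: "\<And>x. x \<in> X \<Longrightarrow> h (letter x) \<in> Lie (A \<union> B)" "\<And>x. x \<in> X \<Longrightarrow> in_\<aa> LR (letter x - h (letter x))"
    and X: "X \<subseteq> A \<union> B" and p: "p \<in> Lie X"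
  shows "in_\<aa> LR (p - h p) \<and> h p \<in> Lie (A \<union> B)"
  using p
proof (induction rule: Lie.induct)
  case zero
  have "h 0 = 0" using h(2)[of 0 0] by simp
  then show ?case by (simp add: in_\<aa>_ideal lie_ideal.zero Lie.zero)
next
  case (letter x)
  then show ?case using letters by blast
next
  case (add p q)
  then have "in_\<aa> LR ((p - h p) + (q - h q))" by (intro in_\<aa>_add) auto
  then show ?case using add by (simp add: h algebra_simps Lie.add)
next
  case (scale p \<alpha>)
  then have "in_\<aa> LR (pscale \<alpha> (p - h p))" by (intro in_\<aa>_pscale) auto
  then show ?case using scale by (simp add: h ncpoly.scale_right_diff_distrib Lie.scale)
next
  case (comm p q)
  have "q \<in> Lie (A \<union> B)" using Lie_mono[OF comm.hyps(2) X] .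
  then have "in_\<aa> LR (comm (p - h p) q - comm (q - h q) (h p))"
    using comm by (intro in_\<aa>_diff[OF in_\<aa>_comm in_\<aa>_comm]) auto
  moreover have "comm (p - h p) q - comm (q - h q) (h p) = comm p q - comm (h p) (h q)"
    by (simp add: comm_def algebra_simps)
  ultimately show ?case using comm by (simp add: h Lie.comm)
qed

lemma in_\<aa>_kill: "p \<in> Lie (A \<union> B) \<Longrightarrow> in_\<aa> LR (p - kill p)"
proof -
  assume p: "p \<in> Lie (A \<union> B)"
  have "in_\<aa> LR (letter x - kill (letter x))" if "x \<in> A \<union> B" for x
    using that in_\<aa>_\<kappa>[of "\<epsilon> x"] in_\<aa>_\<kappa>[of \<zero>] by (cases "x \<in> A") (auto simp: kill_letter \<kappa>_\<epsilon>)
  moreover have "kill (letter x) \<in> Lie (A \<union> B)" if "x \<in> A \<union> B" for x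
    using that by (cases "x \<in> A") (auto simp: kill_letter intro: Lie.intros)
  ultimately show ?thesis using in_\<aa>_subst[of kill "A \<union> B" p] p by (simp add: kill_simps)
qed

lemma in_\<aa>_R_ideal: "p \<in> lie_ideal B R \<Longrightarrow> in_\<aa> LR p"
proof (induction rule: lie_ideal.induct)
  case (gen f)
  then have "f - fl f \<in> LR" by (auto simp: LR_eq)
  then have "in_\<aa> LR ((f - fl f) + fl f)"
    using gen by (intro in_\<aa>_add in_\<aa>_\<kappa> in_\<aa>_ideal lie_ideal.gen) auto
  then show ?case by simp
next
  case (comm p q)
  then show ?case by (intro in_\<aa>_comm_B' AR_subset)
qed (auto intro: in_\<aa>_add in_\<aa>_pscale in_\<aa>_ideal lie_ideal.zero)

lemma kill_ideal: "p \<in> lie_ideal (A \<union> B) LR \<Longrightarrow> kill p \<in> lie_ideal B R"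
proof (induction rule: lie_ideal.induct)
  case (gen s)
  then show ?case
  proof (cases rule: LR_cases)
    case (AR a b)
    then show ?thesis by (simp add: kill_simps kill_letter kill_\<kappa> comm_simps lie_ideal.zero Lie.letter)
  next
    case (RR f)
    then have "kill s = f" using R_Lie by (auto simp: kill_simps kill_\<kappa> kill_B)
    then show ?thesis using RR by (simp add: lie_ideal.gen)
  qed (simp add: kill_simps kill_letter kill_\<kappa> comm_simps lie_ideal.zero)
qed (auto simp: kill_simps intro: lie_ideal.intros kill_Lie)

lemma LieE_proj_eq: "LieE_proj A B R (rc p) = rel_coset B R (kill p)"
proof -
  have "rel_coset B R (kill q) = rel_coset B R (kill p)" if "q \<in> rc p" for q
    using kill_ideal[of "q - p"] that by (simp add: mem_rel_coset rel_coset_eq kill_simps)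
  then have "(\<Union>q\<in>rc p. rel_coset B R (kill q)) = rel_coset B R (kill p)"
    by (intro SUP_eq_const) (use rel_coset_self in blast)
  then show ?thesis by (simp add: LieE_proj_def kill_def rel_coset_def)
qed

text \<open>
  Injectivity is the irreducibility of the letters of \<open>A\<close>.  For exactness, a polynomial \<open>p\<close> is congruent
  modulo \<open>\<aa>\<close> to its image under \<open>kill\<close>, and if that lies in \<open>Id(R)\<close> it is itself congruent to an element of
  \<open>\<aa>\<close>.
\<close>

theorem LieE_extension: "extension \<aa> \<bb> E incl (LieE_proj A B R)"
proof (rule extensionI[OF lie_algebra_E])
  have rc_eq: "rc p = rc q \<longleftrightarrow> p - q \<in> lie_ideal (A \<union> B) LR" for p q by (rule rel_coset_eq)
  have zero: "\<zero>\<^bsub>\<bb>\<^esub> = rel_coset B R 0" by (rule presented_lie_zero)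
  show "incl \<in> lie_hom \<aa> E"
  proof (rule lie_homI)
    fix v w assume vw: "v \<in> carrier \<aa>" "w \<in> carrier \<aa>"
    have "rc (\<kappa> (v \<otimes> w)) = rc (comm (\<kappa> v) (\<kappa> w))"
      using bracket_cong_ideal[OF vw] rc_eq by metis
    then show "incl (v \<otimes> w) = incl v \<otimes>\<^bsub>E\<^esub> incl w"
      using lie_homD(4)[OF rc_hom] vw by (simp add: LieE_incl_eq \<kappa>_Lie_Un)
    show "incl (v \<oplus> w) = incl v \<oplus>\<^bsub>E\<^esub> incl w"
      using lie_homD(2)[OF rc_hom] vw by (simp add: LieE_incl_eq \<kappa>_Lie_Un \<kappa>_add)
  next
    fix \<alpha> v assume v: "v \<in> carrier \<aa>"
    show "incl v \<in> carrier E"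
      using lie_homD(1)[OF rc_hom] v by (simp add: LieE_incl_eq \<kappa>_Lie_Un)
    show "incl (\<alpha> \<odot> v) = \<alpha> \<odot>\<^bsub>E\<^esub> incl v"
      using lie_homD(3)[OF rc_hom] v by (simp add: LieE_incl_eq \<kappa>_Lie_Un \<kappa>_smult)
  qed
  note \<bb>_hom = lie_hom_comp[OF kill_hom rel_coset_hom[OF R_Lie]]
  show "LieE_proj A B R \<in> lie_hom E \<bb>"
    by (rule lie_homI)
      (use lie_homD[OF rc_hom] lie_homD[OF \<bb>_hom] in \<open>auto simp: E_carrier LieE_proj_eq Lie.intros
        simp flip: lie_homD(2,3,4)[OF rc_hom]\<close>)
  show "inj_on incl (carrier \<aa>)"
  proof (rule inj_onI)
    fix v w assume vw: "v \<in> carrier \<aa>" "w \<in> carrier \<aa>" "incl v = incl w"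
    then have "\<kappa> (v \<ominus> w) \<in> lie_ideal (A \<union> B) LR" by (simp add: LieE_incl_eq rc_eq \<kappa>_diff)
    then have "v \<ominus> w = \<zero>" using vw by (intro ideal_\<kappa>_zero[OF letters_irreducible_LR]) auto
    then show "v = w" using vw minus_eq_zero by blast
  qed
  show "LieE_proj A B R (incl v) = \<zero>\<^bsub>\<bb>\<^esub>" if "v \<in> carrier \<aa>" for v
    using that by (simp add: LieE_incl_eq LieE_proj_eq kill_\<kappa> zero)
  show "\<exists>v\<in>carrier \<aa>. x = incl v" if x: "x \<in> carrier E" "LieE_proj A B R x = \<zero>\<^bsub>\<bb>\<^esub>" for x
  proof -
    obtain p where p: "x = rc p" "p \<in> Lie (A \<union> B)" using x(1) E_carrier by blast
    then have "kill p \<in> lie_ideal B R" using x(2) by (simp add: LieE_proj_eq zero rel_coset_eq)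
    then have "in_\<aa> LR ((p - kill p) + kill p)" using p by (intro in_\<aa>_add in_\<aa>_kill in_\<aa>_R_ideal)
    then obtain v where "v \<in> carrier \<aa>" "p - \<kappa> v \<in> lie_ideal (A \<union> B) LR" unfolding in_\<aa>_def by auto
    then show ?thesis using p by (intro bexI[of _ v]) (auto simp: LieE_incl_eq rc_eq)
  qed
  show "\<exists>x\<in>carrier E. LieE_proj A B R x = y" if y: "y \<in> carrier \<bb>" for y
  proof -
    obtain p where p: "y = rel_coset B R p" "p \<in> Lie B" using y by (auto simp: presented_lie_carrier)
    then have "p \<in> Lie (A \<union> B)" by (intro Lie_mono[OF p(2)]) simp
    then show ?thesis using p by (intro bexI[of _ "rc p"]) (auto simp: LieE_proj_eq kill_B E_carrier)
  qed
qed

end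

section \<open>Every extension comes from a factor set and an action\<close>

lemma plug_Lie: "set (left_word C) \<union> set (right_word C) \<subseteq> X \<Longrightarrow> p \<in> Lie X \<Longrightarrow> plug C p \<in> Lie X"
  by (induction C) (auto intro: Lie.comm lie_eval_Lie)

lemma lie_hom_plug_cong:
  fixes p q :: "('x, 'k::field) ncpoly"
  assumes \<sigma>: "\<sigma> \<in> lie_hom (free_lie X) L" and p: "p \<in> Lie X" "q \<in> Lie X" "\<sigma> p = \<sigma> q"
  shows "set (left_word C) \<union> set (right_word C) \<subseteq> X \<Longrightarrow> \<sigma> (plug C p) = \<sigma> (plug C q)"
proof (induction C)
  case (HoleL C t)
  then have "(lie_eval t :: ('x, 'k) ncpoly) \<in> Lie X" by (intro lie_eval_Lie) simp
  with HoleL show ?case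
    using lie_homD(4)[OF \<sigma>, of "plug C p" "lie_eval t"] lie_homD(4)[OF \<sigma>, of "plug C q" "lie_eval t"] plug_Lie[of C X p] plug_Lie[of C X q] p by simp
next
  case (HoleR t C)
  then have "(lie_eval t :: ('x, 'k) ncpoly) \<in> Lie X" by (intro lie_eval_Lie) simp
  with HoleR show ?case
    using lie_homD(4)[OF \<sigma>, of "lie_eval t" "plug C p"] lie_homD(4)[OF \<sigma>, of "lie_eval t" "plug C q"] plug_Lie[of C X p] plug_Lie[of C X q] p by simp
qed (use p in simp)

context lie_factor_set
begin

lemma special_cong:
  assumes \<sigma>: "\<sigma> \<in> lie_hom (free_lie (A \<union> B)) L" and \<sigma>_fl: "\<sigma> g = \<sigma> (fl g)"
    and g: "g \<in> R" "c @ lead g @ d \<in> ALSW B"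
  shows "\<sigma> (special c (lead g) d g) = \<sigma> (special c (lead g) d (fl g))"
    "special c (lead g) d g \<in> Lie (A \<union> B)" "special c (lead g) d (fl g) \<in> Lie (A \<union> B)"
proof -
  have "alsw (c @ lead g @ d)" "alsw (lead g)" using R_lead_ALSW[OF g(1)] g(2) by (auto simp: ALSW_def)
  from special_ctx_words[OF this] g(2)
  have words: "set (left_word (special_ctx c (lead g) d)) \<union> set (right_word (special_ctx c (lead g) d)) \<subseteq> A \<union> B"
    by (auto simp: ALSW_def)
  have Lie: "g \<in> Lie (A \<union> B)" "fl g \<in> Lie (A \<union> B)" using g R_Lie_Un \<kappa>_Lie_Un by auto
  show "\<sigma> (special c (lead g) d g) = \<sigma> (special c (lead g) d (fl g))"
    unfolding special_def by (rule lie_hom_plug_cong[OF \<sigma> Lie \<sigma>_fl words])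
  show "special c (lead g) d g \<in> Lie (A \<union> B)" "special c (lead g) d (fl g) \<in> Lie (A \<union> B)"
    unfolding special_def using Lie words by (auto intro: plug_Lie)
qed

text \<open>
  Condition (b) is inherited from any Lie algebra in which \<open>f\<close> and \<open>\<lfloor>f\<rfloor>\<close> become equal while \<open>\<aa>\<close> stays
  faithful: there both sides become the two descriptions of the same composition.
\<close>

lemma condition_bI:
  assumes L: "lie_algebra L" and \<sigma>: "\<sigma> \<in> lie_hom (free_lie (A \<union> B)) L"
    and kills: "\<And>s. s \<in> AR \<Longrightarrow> \<sigma> s = \<zero>\<^bsub>L\<^esub>"
    and faithful: "\<And>v. v \<in> carrier \<aa> \<Longrightarrow> \<sigma> (\<kappa> v) = \<zero>\<^bsub>L\<^esub> \<Longrightarrow> v = \<zero>"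
    and \<sigma>_fl: "\<And>f. f \<in> R \<Longrightarrow> \<sigma> f = \<sigma> (fl f)"
  shows "condition_b \<aa> A \<epsilon> B R fs act"
  unfolding condition_b_def Let_def
proof (intro ballI allI impI)
  interpret L: lie_algebra L by (rule L)
  let ?red = "Red (A \<union> B) AR"
  have kills_ideal: "\<sigma> p = \<zero>\<^bsub>L\<^esub>" if "p \<in> lie_ideal (A \<union> B) AR" for p
    by (rule lie_hom_kills_ideal[OF \<sigma> L AR_Lie kills that])
  have \<sigma>_eq: "\<sigma> p = \<sigma> q" if "p - q \<in> lie_ideal (A \<union> B) AR" "p \<in> Lie (A \<union> B)" "q \<in> Lie (A \<union> B)" for p q
    using kills_ideal[OF that(1)] lie_hom_free_minus[OF \<sigma> L that(2,3)] lie_homD(1)[OF \<sigma>] that(2,3) L.minus_eq_zero by simp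
  fix f\<^sub>1 f\<^sub>2 c d w ts
  assume f: "f\<^sub>1 \<in> R" "f\<^sub>2 \<in> R" and "c \<in> lists B" "d \<in> lists B"
    and h: "overlap f\<^sub>1 c d f\<^sub>2 w \<and> below_terms B R w ts \<and> intersection_composition f\<^sub>1 c d f\<^sub>2 = special_sum ts"
  from h have ov: "w = lead f\<^sub>1 @ c" "w = d @ lead f\<^sub>2" "length w < length (lead f\<^sub>1) + length (lead f\<^sub>2)"
    and ts: "below_terms B R w ts"
    unfolding overlap_def by blast+
  from ov(3) have "length c < length (lead f\<^sub>2)" unfolding ov(1) by simp
  moreover have "lead f\<^sub>1 @ c = d @ lead f\<^sub>2" using ov(2) unfolding ov(1) .
  ultimately have w: "w = lead f\<^sub>1 @ c" "lead f\<^sub>1 @ c = d @ lead f\<^sub>2" "length c < length (lead f\<^sub>2)"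
    using ov(1) by blast+
  then have wB: "lead f\<^sub>1 @ c \<in> ALSW B" "d @ lead f\<^sub>2 \<in> ALSW B" using overlap_words[OF f w(2,3)] by simp_all
  let ?p = "special [] (lead f\<^sub>1) c (fl f\<^sub>1) - special d (lead f\<^sub>2) [] (fl f\<^sub>2)"
  let ?r = "\<Sum>(\<alpha>, c', g, d')\<leftarrow>ts. pscale \<alpha> (?red (special c' (lead g) d' (fl g)))"
  note s1 = special_cong[OF \<sigma> \<sigma>_fl[OF f(1)] f(1), of "[]" c, simplified, OF wB(1)]
  note s2 = special_cong[OF \<sigma> \<sigma>_fl[OF f(2)] f(2), of d "[]", simplified, OF wB(2)]
  have comb: "\<sigma> (special_comb us (\<lambda>g. g)) = \<sigma> (special_comb us fl) \<and> special_comb us (\<lambda>g. g) \<in> Lie (A \<union> B)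
      \<and> special_comb us fl \<in> Lie (A \<union> B)" if "below_terms B R w us" for us
    using that
  proof (induction us)
    case (Cons u us)
    obtain \<alpha> c g d where u: "u = (\<alpha>, c, g, d)" by (cases u) auto
    have g: "g \<in> R" "c @ lead g @ d \<in> ALSW B" using Cons.prems u by auto
    note sg = special_cong[OF \<sigma> \<sigma>_fl[OF g(1)] g]
    show ?case
      using Cons sg lie_homD(2,3)[OF \<sigma>] by (simp add: u Lie.add Lie.scale)
  qed (simp add: Lie.zero)
  have "\<exists>v\<in>carrier \<aa>. ?r = \<kappa> v"
    using ts
  proof (induction ts)
    case (Cons u us)
    obtain \<alpha> c g d where u: "u = (\<alpha>, c, g, d)" by (cases u) auto
    have g: "g \<in> R" "c @ lead g @ d \<in> ALSW B" using Cons.prems u by auto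
    obtain v where v: "v \<in> carrier \<aa>" "?red (special c (lead g) d (fl g)) = \<kappa> v"
      using Red_AR_\<kappa>[OF special_RR(4)[OF g]] by blast
    obtain v' where v': "v' \<in> carrier \<aa>" "(\<Sum>(\<alpha>, c', g, d')\<leftarrow>us. pscale \<alpha> (?red (special c' (lead g) d' (fl g)))) = \<kappa> v'"
      using Cons u by auto
    show ?case using v v' by (intro bexI[of _ "\<alpha> \<odot> v \<oplus> v'"]) (auto simp: u \<kappa>_add \<kappa>_smult)
  qed (use \<kappa>_zero in \<open>auto intro: bexI[of _ \<zero>]\<close>)
  then obtain r where r: "r \<in> carrier \<aa>" "?r = \<kappa> r" by blast
  have "in_\<aa> AR ?p"
    using special_RR(4)[OF f(1), of "[]" c] special_RR(4)[OF f(2), of d "[]"] wB by (intro in_\<aa>_diff) auto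
  then obtain v where v: "v \<in> carrier \<aa>" "?red ?p = \<kappa> v" "?p - \<kappa> v \<in> lie_ideal (A \<union> B) AR"
    using Red_AR_\<kappa> by blast
  have "\<sigma> (\<kappa> v) = \<sigma> ?p"
    using v s1 s2 by (intro \<sigma>_eq[symmetric]) (auto intro: Lie_diff \<kappa>_Lie_Un)
  also have "\<dots> = \<sigma> (intersection_composition f\<^sub>1 c d f\<^sub>2)"
    unfolding intersection_composition_def using s1 s2 by (simp add: lie_hom_free_minus[OF \<sigma> L])
  also have "\<dots> = \<sigma> (special_comb ts fl)"
    using h comb[OF ts] by (simp add: special_sum_comb)
  also have "\<dots> = \<sigma> (\<kappa> r)"
    using special_comb_Red[OF ts] comb[OF ts] r by (intro \<sigma>_eq) (auto intro: \<kappa>_Lie_Un)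
  finally have "\<sigma> (\<kappa> (v \<ominus> r)) = \<zero>\<^bsub>L\<^esub>"
    using v r lie_homD(1)[OF \<sigma>] by (simp add: \<kappa>_diff lie_hom_free_minus[OF \<sigma> L] \<kappa>_Lie_Un L.minus_eq_zero)
  then have "v = r" using faithful[of "v \<ominus> r"] v r minus_eq_zero by simp
  then show "?red ?p = ?r" using v r by simp
qed

end

context lie_setting
begin

text \<open>
  Let \<open>\<sigma>\<close> extend the inclusion of \<open>\<aa>\<close> and a lift of the letters of \<open>B\<close>.  Then \<open>[\<sigma>(d) v]\<close> for \<open>d\<close> in \<open>Lie(B)\<close>, and
  \<open>\<sigma>(f)\<close> for \<open>f \<in> R\<close>, lie in the kernel of the projection and so define an action and a factor set.  By
  construction \<open>\<sigma>\<close> respects all relations and descends to a map from \<open>LieE\<close> compatible with both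
  sequences.
\<close>

theorem extension_isomorphic_LieE:
  fixes \<ee> :: "('k, 'e) module"
  assumes ext: "extension \<aa> \<bb> \<ee> i \<pi>"
  shows "\<exists>act fs. lie_pair \<aa> A B \<epsilon> R act fs \<and> lie_isomorphic \<ee> (LieE \<aa> A \<epsilon> B R fs act)"
proof -
  note E = extensionD[OF ext]
  interpret \<ee>: lie_algebra \<ee> by (rule E(1))
  interpret \<bb>: lie_algebra \<bb> by (rule lie_algebra_\<bb>)
  note i = lie_homD[OF E(2)] and \<pi> = lie_homD[OF E(3)]
  have "\<exists>x\<in>carrier \<ee>. \<pi> x = rel_coset B R (letter b)" if "b \<in> B" for b
    using that by (intro E(7)) (auto simp: presented_lie_carrier intro: Lie.letter)
  then obtain l where l: "\<And>b. b \<in> B \<Longrightarrow> l b \<in> carrier \<ee> \<and> \<pi> (l b) = rel_coset B R (letter b)" by metis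
  \<comment> \<open>\<open>l\<close> lifts the letters of \<open>B\<close> to the extension.\<close>
  let ?\<phi> = "\<lambda>x. if x \<in> A then i (\<epsilon> x) else l x"
  have "?\<phi> \<in> A \<union> B \<rightarrow> carrier \<ee>" using l i(1) by auto
  from \<ee>.free_lie_universal[OF this]
  obtain \<sigma> where \<sigma>: "\<sigma> \<in> lie_hom (free_lie (A \<union> B)) \<ee>" "\<And>x. x \<in> A \<union> B \<Longrightarrow> \<sigma> (letter x) = ?\<phi> x" by blast
  note \<sigma>h = lie_homD[OF \<sigma>(1), simplified]
  have Lie_B: "p \<in> Lie (A \<union> B)" if "p \<in> Lie B" for p :: "('x, 'k) ncpoly" by (rule Lie_mono[OF that]) simp
  have \<sigma>_\<kappa>: "\<sigma> (\<kappa> v) = i v" if "v \<in> carrier \<aa>" for v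
    using that
  proof (induction rule: carrier_induct)
    case zero
    then show ?case using lie_hom_zero[OF \<sigma>(1) lie_algebra_free E(1)] lie_hom_zero[OF E(2) lie_algebra_axioms E(1)] by simp
  qed (use \<sigma> \<sigma>h i in \<open>simp_all add: \<kappa>_\<epsilon> \<kappa>_add \<kappa>_smult \<kappa>_Lie_Un\<close>)
  have \<pi>_\<sigma>: "\<pi> (\<sigma> p) = rel_coset B R (kill p)" if "p \<in> Lie (A \<union> B)" for p
  proof (rule lie_hom_free_eq[OF lie_hom_comp[OF \<sigma>(1) E(3)] lie_hom_comp[OF kill_hom rel_coset_hom[OF R_Lie]] lie_algebra_\<bb> _ that])
    show "\<pi> (\<sigma> (letter x)) = rel_coset B R (kill (letter x))" if "x \<in> A \<union> B" for x
      using that \<sigma>(2) l E(5) by (cases "x \<in> A") (auto simp: kill_letter presented_lie_zero)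
  qed
  have i_inj: "v = w" if "v \<in> carrier \<aa>" "w \<in> carrier \<aa>" "i v = i w" for v w
    using that E(4) by (simp add: inj_on_def)
  \<comment> \<open>\<open>j\<close> inverts the inclusion on the kernel of the projection.\<close>
  define j where "j x = (SOME v. v \<in> carrier \<aa> \<and> x = i v)" for x
  have j: "j x \<in> carrier \<aa> \<and> i (j x) = x" if "x \<in> carrier \<ee>" "\<pi> x = \<zero>\<^bsub>\<bb>\<^esub>" for x
  proof -
    have "\<exists>v. v \<in> carrier \<aa> \<and> x = i v" using E(6)[OF that] by blast
    from someI_ex[OF this] show ?thesis unfolding j_def by auto
  qed
  define act where "act d v = j (\<sigma> d \<otimes>\<^bsub>\<ee>\<^esub> i v)" for d v
  define fs where "fs f = j (\<sigma> f)" for f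
  have act: "act d v \<in> carrier \<aa> \<and> i (act d v) = \<sigma> d \<otimes>\<^bsub>\<ee>\<^esub> i v" if "d \<in> Lie B" "v \<in> carrier \<aa>" for d v
  proof -
    have "\<pi> (\<sigma> d \<otimes>\<^bsub>\<ee>\<^esub> i v) = \<zero>\<^bsub>\<bb>\<^esub>"
      using that \<pi>(4)[of "\<sigma> d" "i v"] \<pi>(1)[of "\<sigma> d"] \<sigma>h(1)[OF Lie_B] i(1) E(5) by simp
    then show ?thesis unfolding act_def using that \<sigma>h(1)[OF Lie_B] i(1) by (intro j) auto
  qed
  have fs: "fs f \<in> carrier \<aa> \<and> i (fs f) = \<sigma> f" if "f \<in> R" for f
  proof -
    have f: "f \<in> Lie B" using that R_Lie by blast
    then have "\<pi> (\<sigma> f) = \<zero>\<^bsub>\<bb>\<^esub>"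
      using \<pi>_\<sigma>[OF Lie_B[OF f]] that by (simp add: kill_B presented_lie_zero rel_coset_eq lie_ideal.gen)
    then show ?thesis unfolding fs_def using \<sigma>h(1)[OF Lie_B[OF f]] by (intro j) auto
  qed
  have compat: "compatible_module (free_lie B) \<aa> act"
    unfolding compatible_module_def
  proof (intro conjI ballI allI)
    fix d :: "('x, 'k) ncpoly" and v assume "d \<in> carrier (free_lie B)" "v \<in> carrier \<aa>"
    then have dv: "d \<in> Lie B" "v \<in> carrier \<aa>" by simp_all
    then have \<sigma>d: "\<sigma> d \<in> carrier \<ee>" and iv: "i v \<in> carrier \<ee>" using \<sigma>h(1)[OF Lie_B] i(1) by auto
    show "act d v \<in> carrier \<aa>" using act[OF dv] by blast
    show "act (\<alpha> \<odot>\<^bsub>free_lie B\<^esub> d) v = \<alpha> \<odot> act d v" for \<alpha>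
      using act[OF dv] act[OF Lie.scale[OF dv(1)] dv(2)] dv \<sigma>d iv \<sigma>h(3)[OF Lie_B] i(3)
      by (intro i_inj) (auto simp: \<ee>.bracket_smult_left)
    show "act d (\<alpha> \<odot> v) = \<alpha> \<odot> act d v" for \<alpha>
      using act[OF dv] act[OF dv(1), of "\<alpha> \<odot> v"] dv \<sigma>d iv i(3)
      by (intro i_inj) (auto simp: \<ee>.bracket_smult_right)
    fix w assume w: "w \<in> carrier \<aa>"
    then have iw: "i w \<in> carrier \<ee>" using i(1) by simp
    show "act d (v \<oplus> w) = act d v \<oplus> act d w"
      using act[OF dv] act[OF dv(1) w] act[OF dv(1), of "v \<oplus> w"] dv w \<sigma>d iv iw i(2)
      by (intro i_inj) (auto simp: \<ee>.bracket_add_right)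
    show "act d (v \<otimes> w) = act d v \<otimes> w \<oplus> v \<otimes> act d w"
    proof (rule i_inj)
      have "i (act d (v \<otimes> w)) = \<sigma> d \<otimes>\<^bsub>\<ee>\<^esub> (i v \<otimes>\<^bsub>\<ee>\<^esub> i w)" using act[OF dv(1), of "v \<otimes> w"] dv w i(4) by simp
      also have "\<dots> = (\<sigma> d \<otimes>\<^bsub>\<ee>\<^esub> i v) \<otimes>\<^bsub>\<ee>\<^esub> i w \<oplus>\<^bsub>\<ee>\<^esub> i v \<otimes>\<^bsub>\<ee>\<^esub> (\<sigma> d \<otimes>\<^bsub>\<ee>\<^esub> i w)"
      proof -
        have "(\<sigma> d \<otimes>\<^bsub>\<ee>\<^esub> i w) \<otimes>\<^bsub>\<ee>\<^esub> i v = \<ominus>\<^bsub>\<ee>\<^esub> (i v \<otimes>\<^bsub>\<ee>\<^esub> (\<sigma> d \<otimes>\<^bsub>\<ee>\<^esub> i w))"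
          using \<sigma>d iv iw by (intro \<ee>.bracket_antisym) auto
        moreover have "(\<sigma> d \<otimes>\<^bsub>\<ee>\<^esub> i v) \<otimes>\<^bsub>\<ee>\<^esub> i w = (\<sigma> d \<otimes>\<^bsub>\<ee>\<^esub> i w) \<otimes>\<^bsub>\<ee>\<^esub> i v \<oplus>\<^bsub>\<ee>\<^esub> \<sigma> d \<otimes>\<^bsub>\<ee>\<^esub> (i v \<otimes>\<^bsub>\<ee>\<^esub> i w)"
          using \<sigma>d iv iw by (intro \<ee>.bracket_leibniz)
        ultimately show ?thesis
          using \<sigma>d iv iw by (simp add: \<ee>.a_ac \<ee>.r_neg)
      qed
      also have "\<dots> = i (act d v \<otimes> w \<oplus> v \<otimes> act d w)"
        using act[OF dv] act[OF dv(1) w] dv w i(2,4) by simp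
      finally show "i (act d (v \<otimes> w)) = i (act d v \<otimes> w \<oplus> v \<otimes> act d w)" .
    qed (use act[OF dv] act[OF dv(1) w] act[OF dv(1), of "v \<otimes> w"] dv w in auto)
  next
    fix d d' :: "('x, 'k) ncpoly" and v assume "d \<in> carrier (free_lie B)" "d' \<in> carrier (free_lie B)" "v \<in> carrier \<aa>"
    then have dv: "d \<in> Lie B" "d' \<in> Lie B" "v \<in> carrier \<aa>" by simp_all
    then have car: "\<sigma> d \<in> carrier \<ee>" "\<sigma> d' \<in> carrier \<ee>" "i v \<in> carrier \<ee>" using \<sigma>h(1)[OF Lie_B] i(1) by auto
    show "act (d \<oplus>\<^bsub>free_lie B\<^esub> d') v = act d v \<oplus> act d' v"
      using act[OF dv(1,3)] act[OF dv(2,3)] act[OF Lie.add[OF dv(1,2)] dv(3)] car \<sigma>h(2)[OF Lie_B[OF dv(1)] Lie_B[OF dv(2)]] i(2)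
      by (intro i_inj) (auto simp: \<ee>.bracket_add_left)
    have aa: "act d (act d' v) \<in> carrier \<aa>" "act d' (act d v) \<in> carrier \<aa>"
      using act[OF dv(1,3)] act[OF dv(2,3)] act[OF dv(1)] act[OF dv(2)] by auto
    show "act (d \<otimes>\<^bsub>free_lie B\<^esub> d') v = act d (act d' v) \<ominus> act d' (act d v)"
    proof (rule i_inj)
      have "i (act (comm d d') v) = (\<sigma> d \<otimes>\<^bsub>\<ee>\<^esub> \<sigma> d') \<otimes>\<^bsub>\<ee>\<^esub> i v"
        using act[OF Lie.comm[OF dv(1,2)] dv(3)] \<sigma>h(4)[OF Lie_B[OF dv(1)] Lie_B[OF dv(2)]] by simp
      also have "\<dots> = \<sigma> d \<otimes>\<^bsub>\<ee>\<^esub> (\<sigma> d' \<otimes>\<^bsub>\<ee>\<^esub> i v) \<ominus>\<^bsub>\<ee>\<^esub> \<sigma> d' \<otimes>\<^bsub>\<ee>\<^esub> (\<sigma> d \<otimes>\<^bsub>\<ee>\<^esub> i v)"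
        using \<ee>.bracket_leibniz[OF car] \<ee>.bracket_antisym[of "\<sigma> d \<otimes>\<^bsub>\<ee>\<^esub> i v" "\<sigma> d'"] car
        by (simp add: a_minus_def \<ee>.a_comm)
      also have "\<dots> = i (act d (act d' v) \<ominus> act d' (act d v))"
        using act[OF dv(1,3)] act[OF dv(2,3)] act[OF dv(1)] act[OF dv(2)] aa
          lie_hom_minus[OF E(2) lie_algebra_axioms E(1) aa] by simp
      finally show "i (act (d \<otimes>\<^bsub>free_lie B\<^esub> d') v) = i (act d (act d' v) \<ominus> act d' (act d v))" by simp
    qed (use act[OF Lie.comm[OF dv(1,2)] dv(3)] aa in auto)
  qed
  interpret F: lie_factor_set \<aa> A B \<epsilon> R act fs
    by unfold_locales (use compat fs in auto)
  have kills_AR: "\<sigma> s = \<zero>\<^bsub>\<ee>\<^esub>" if "s \<in> F.AR" for s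
    using that
  proof (rule F.ARE)
    fix a b assume s: "a \<in> A" "b \<in> B" "s = comm (letter b) (letter a) - \<kappa> (act (letter b) (\<epsilon> a))"
    have b: "(letter b :: ('x, 'k) ncpoly) \<in> Lie B" using s by (intro Lie.letter)
    have la: "(letter a :: ('x, 'k) ncpoly) \<in> Lie (A \<union> B)" using s by (intro Lie.letter) simp
    have "\<sigma> (comm (letter b) (letter a)) = \<sigma> (letter b) \<otimes>\<^bsub>\<ee>\<^esub> i (\<epsilon> a)"
      using \<sigma>h(4)[OF Lie_B[OF b] la] \<sigma>(2) s by simp
    then have "\<sigma> s = (\<sigma> (letter b) \<otimes>\<^bsub>\<ee>\<^esub> i (\<epsilon> a)) \<ominus>\<^bsub>\<ee>\<^esub> (\<sigma> (letter b) \<otimes>\<^bsub>\<ee>\<^esub> i (\<epsilon> a))"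
      using act[OF b, of "\<epsilon> a"] s lie_hom_free_minus[OF \<sigma>(1) E(1) Lie.comm[OF Lie_B[OF b] la] \<kappa>_Lie_Un[of "act (letter b) (\<epsilon> a)"]]
      by (simp add: \<sigma>_\<kappa>)
    then show ?thesis using \<ee>.minus_eq_zero \<sigma>h(1)[OF Lie_B[OF b]] i(1) s by simp
  qed
  have \<sigma>_fl: "\<sigma> f = \<sigma> (F.fl f)" if "f \<in> R" for f
    using fs[OF that] \<sigma>_\<kappa> by simp
  have faithful: "v = \<zero>" if "v \<in> carrier \<aa>" "\<sigma> (\<kappa> v) = \<zero>\<^bsub>\<ee>\<^esub>" for v
    using that \<sigma>_\<kappa> lie_hom_zero[OF E(2) lie_algebra_axioms E(1)] by (intro i_inj) auto
  have cond_a: "condition_a \<aa> A \<epsilon> R fs act"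
    unfolding condition_a_def
  proof (intro ballI)
    fix a f assume af: "a \<in> A" "f \<in> R"
    then have "f \<in> Lie B" using R_Lie by blast
    then show "act f (\<epsilon> a) = fs f \<otimes> \<epsilon> a"
      using act[of f "\<epsilon> a"] fs[OF af(2)] af i(4) by (intro i_inj) auto
  qed
  have cond_b: "condition_b \<aa> A \<epsilon> B R fs act"
    by (rule F.condition_bI[OF E(1) \<sigma>(1) kills_AR faithful \<sigma>_fl])
  interpret P: lie_pair \<aa> A B \<epsilon> R act fs
    by unfold_locales (use cond_a cond_b in auto)
  have "\<sigma> s = \<zero>\<^bsub>\<ee>\<^esub>" if "s \<in> F.LR" for s
    using that
  proof (cases rule: F.LR_cases)
    case (AA a a')
    have la: "(letter a :: ('x, 'k) ncpoly) \<in> Lie (A \<union> B)" "(letter a' :: ('x, 'k) ncpoly) \<in> Lie (A \<union> B)"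
      using AA by (auto intro: Lie.letter)
    have "\<sigma> s = i (\<epsilon> a \<otimes> \<epsilon> a') \<ominus>\<^bsub>\<ee>\<^esub> i (\<epsilon> a \<otimes> \<epsilon> a')"
      using lie_hom_free_minus[OF \<sigma>(1) E(1) Lie.comm[OF la] \<kappa>_Lie_Un[of "\<epsilon> a \<otimes> \<epsilon> a'"]] AA \<sigma>h(4)[OF la] \<sigma>(2) i(4)
      by (simp add: \<sigma>_\<kappa>)
    then show ?thesis using \<ee>.minus_eq_zero i(1) AA by simp
  next
    case (AR a b)
    then show ?thesis using kills_AR F.ARI by blast
  next
    case (RR f)
    have "f \<in> Lie (A \<union> B)" using F.R_Lie_Un RR by blast
    then show ?thesis
      using lie_hom_free_minus[OF \<sigma>(1) E(1), of f "F.fl f"] RR \<sigma>_fl[OF RR(1)] \<sigma>h(1) \<ee>.minus_eq_zero \<kappa>_Lie_Un by simp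
  qed
  from presented_lie_lift[OF \<sigma>(1) E(1) F.LR_Lie this]
  obtain g where g: "g \<in> lie_hom P.E \<ee>" "\<And>p. p \<in> Lie (A \<union> B) \<Longrightarrow> g (P.rc p) = \<sigma> p"
    unfolding LieE_def by blast
  have "bij_betw g (carrier P.E) (carrier \<ee>)"
  proof (rule short_five[OF lie_algebra_axioms lie_algebra_\<bb> P.LieE_extension ext g(1)])
    show "g (P.incl v) = i v" if "v \<in> carrier \<aa>" for v
      using that g(2) \<sigma>_\<kappa> by (simp add: P.LieE_incl_eq \<kappa>_Lie_Un)
    show "\<pi> (g x) = LieE_proj A B R x" if "x \<in> carrier P.E" for x
      using that g(2) \<pi>_\<sigma> by (auto simp: P.E_carrier P.LieE_proj_eq)
  qed
  then have "lie_isomorphic \<ee> P.E"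
    unfolding lie_isomorphic_def using lie_hom_inverse[OF g(1) P.lie_algebra_E] bij_betw_inv_into by blast
  then show ?thesis using P.lie_pair_axioms by blast
qed


section \<open>Equivalence of extensions\<close>

abbreviation \<Gamma> :: "('x \<Rightarrow> 'v) \<Rightarrow> ('x, 'k) ncpoly \<Rightarrow> ('x, 'k) ncpoly" where "\<Gamma> \<equiv> Gamma \<aa> A \<epsilon> B"

lemma \<Gamma>_simps: "\<Gamma> \<eta> (p + q) = \<Gamma> \<eta> p + \<Gamma> \<eta> q" "\<Gamma> \<eta> (p - q) = \<Gamma> \<eta> p - \<Gamma> \<eta> q" "\<Gamma> \<eta> (pscale \<alpha> p) = pscale \<alpha> (\<Gamma> \<eta> p)"
  "\<Gamma> \<eta> (comm p q) = comm (\<Gamma> \<eta> p) (\<Gamma> \<eta> q)" "\<Gamma> \<eta> 0 = 0"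
  by (simp_all add: Gamma_def free_hom_add free_hom_minus free_hom_pscale free_hom_comm)

lemma \<Gamma>_letter: "x \<in> B \<Longrightarrow> \<Gamma> \<eta> (letter x) = letter x - \<kappa> (\<eta> x)" "x \<in> A \<Longrightarrow> \<Gamma> \<eta> (letter x) = letter x"
  using A_B_disjoint by (auto simp: Gamma_def)

lemma \<Gamma>_\<kappa>: "v \<in> carrier \<aa> \<Longrightarrow> \<Gamma> \<eta> (\<kappa> v) = \<kappa> v"
  by (induction rule: carrier_induct) (simp_all add: \<Gamma>_simps \<Gamma>_letter \<kappa>_\<epsilon> \<kappa>_add \<kappa>_smult)

lemma \<Gamma>_hom: "\<eta> \<in> B \<rightarrow> carrier \<aa> \<Longrightarrow> \<Gamma> \<eta> \<in> lie_hom (free_lie (A \<union> B)) (free_lie (A \<union> B))"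
  unfolding Gamma_def by (rule free_hom_lie_hom) (auto intro: Lie.letter Lie_diff \<kappa>_Lie_Un)

text \<open>
  An equivalence must send \<open>b\<close> to \<open>b - \<eta>(b)\<close> for some \<open>\<eta>\<close>, so it is induced by \<open>\<Gamma> \<eta>\<close>; that \<open>\<Gamma> \<eta>\<close> respects
  the relations is exactly the pair of conditions on \<open>\<eta>\<close>.
\<close>

theorem LieE_equivalent_iff:
  assumes P: "lie_pair \<aa> A B \<epsilon> R act fs" and P': "lie_pair \<aa> A B \<epsilon> R act' fs'"
  shows "equivalent_extensions \<aa> (LieE \<aa> A \<epsilon> B R fs act) (LieE_incl \<aa> A \<epsilon> B R fs act) (LieE_proj A B R)
      (LieE \<aa> A \<epsilon> B R fs' act') (LieE_incl \<aa> A \<epsilon> B R fs' act') (LieE_proj A B R) \<longleftrightarrow>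
    (\<exists>\<eta>. \<eta> \<in> B \<rightarrow> carrier \<aa> \<and>
       (\<forall>a\<in>A. \<forall>b\<in>B. act' (letter b) (\<epsilon> a) \<ominus> act (letter b) (\<epsilon> a) = \<eta> b \<otimes> \<epsilon> a) \<and>
       (\<forall>f\<in>R. \<kappa> (fs' f \<ominus> fs f) = Red (A \<union> B) (LieR \<aa> A \<epsilon> B R fs' act') (f - \<Gamma> \<eta> f)))"
    (is "?L \<longleftrightarrow> ?R")
proof -
  interpret P: lie_pair \<aa> A B \<epsilon> R act fs by (rule P)
  interpret P': lie_pair \<aa> A B \<epsilon> R act' fs' by (rule P')
  let ?I' = "lie_ideal (A \<union> B) P'.LR"
  have lb: "(letter b :: ('x, 'k) ncpoly) \<in> Lie B" if "b \<in> B" for b using that by (rule Lie.letter)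
  have lx: "(letter x :: ('x, 'k) ncpoly) \<in> Lie (A \<union> B)" if "x \<in> A \<union> B" for x using that by (rule Lie.letter)
  \<comment> \<open>Modulo the relations of the second extension, \<open>\<Gamma> \<eta>\<close> maps the action relations of the first into \<open>\<aa>\<close>.\<close>
  have act_rel: "comm (letter b - \<kappa> (\<eta> b)) (letter a) - \<kappa> (act (letter b) (\<epsilon> a)) -
      \<kappa> (act' (letter b) (\<epsilon> a) \<ominus> act (letter b) (\<epsilon> a) \<ominus> \<eta> b \<otimes> \<epsilon> a) \<in> ?I'"
    if "\<eta> \<in> B \<rightarrow> carrier \<aa>" "a \<in> A" "b \<in> B" for \<eta> a b
  proof -
    have \<eta>: "\<eta> b \<in> carrier \<aa>" using that by blast
    have "comm (letter b) (letter a) - \<kappa> (act' (letter b) (\<epsilon> a)) \<in> ?I'"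
      using P'.ARI P'.AR_subset that by (intro lie_ideal.gen) blast
    moreover have "comm (\<kappa> (\<eta> b)) (\<kappa> (\<epsilon> a)) - \<kappa> (\<eta> b \<otimes> \<epsilon> a) \<in> ?I'"
      using \<eta> that by (intro P'.bracket_cong_ideal) auto
    ultimately have "(comm (letter b) (letter a) - \<kappa> (act' (letter b) (\<epsilon> a))) - (comm (\<kappa> (\<eta> b)) (\<kappa> (\<epsilon> a)) - \<kappa> (\<eta> b \<otimes> \<epsilon> a)) \<in> ?I'"
      by (rule lie_ideal_diff)
    then show ?thesis
      using \<eta> that lb by (simp add: \<kappa>_diff \<kappa>_\<epsilon> comm_simps algebra_simps)
  qed
  have in_\<aa>: "in_\<aa> P'.LR (f - \<Gamma> \<eta> f)" if "\<eta> \<in> B \<rightarrow> carrier \<aa>" "f \<in> Lie (A \<union> B)" for \<eta> f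
  proof -
    have "in_\<aa> P'.LR (letter x - \<Gamma> \<eta> (letter x))" if "x \<in> A \<union> B" for x
    proof (cases "x \<in> A")
      case True
      then show ?thesis using in_\<aa>_\<kappa>[of \<zero>] by (simp add: \<Gamma>_letter)
    next
      case False
      then show ?thesis using that \<open>\<eta> \<in> B \<rightarrow> carrier \<aa>\<close> by (auto simp: \<Gamma>_letter intro!: in_\<aa>_\<kappa>)
    qed
    then show ?thesis
      using P'.in_\<aa>_subst[of "\<Gamma> \<eta>" "A \<union> B" f] that(2) lie_homD(1)[OF \<Gamma>_hom[OF that(1)]] lx by (simp add: \<Gamma>_simps)
  qed
  have fs_rel: "f - P'.fl f \<in> ?I'" if "f \<in> R" for f
    using that by (intro lie_ideal.gen) (auto simp: P'.LR_eq)
  have R_Un: "f \<in> Lie (A \<union> B)" if "f \<in> R" for f using P.R_Lie_Un that .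
  show ?thesis
  proof
    assume ?L
    then obtain \<phi> where \<phi>: "\<phi> \<in> lie_hom P.E P'.E"
      "\<And>v. v \<in> carrier \<aa> \<Longrightarrow> \<phi> (P.rc (\<kappa> v)) = P'.rc (\<kappa> v)" "\<And>x. x \<in> carrier P.E \<Longrightarrow> LieE_proj A B R (\<phi> x) = LieE_proj A B R x"
      unfolding equivalent_extensions_def by (auto simp: P.LieE_incl_eq P'.LieE_incl_eq)
    have "\<exists>v. v \<in> carrier \<aa> \<and> \<phi> (P.rc (letter b)) = P'.rc (letter b - \<kappa> v)" if b: "b \<in> B" for b
    proof -
      have rcb: "P.rc (letter b) \<in> carrier P.E" using lx b by (auto simp: P.E_carrier)
      then obtain q where q: "q \<in> Lie (A \<union> B)" "\<phi> (P.rc (letter b)) = P'.rc q"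
        using lie_homD(1)[OF \<phi>(1)] P'.E_carrier by blast
      have "kill q - letter b \<in> lie_ideal B R"
        using \<phi>(3)[OF rcb] q b by (simp add: P.LieE_proj_eq P'.LieE_proj_eq rel_coset_eq kill_letter)
      then have "in_\<aa> P'.LR ((q - kill q) + (kill q - letter b))"
        using q by (intro in_\<aa>_add P'.in_\<aa>_kill P'.in_\<aa>_R_ideal)
      then obtain v where v: "v \<in> carrier \<aa>" "q - letter b - \<kappa> v \<in> ?I'" unfolding in_\<aa>_def by auto
      then have "P'.rc q = P'.rc (letter b - \<kappa> (\<ominus> v))" by (simp add: rel_coset_eq \<kappa>_minus algebra_simps)
      then show ?thesis using v q by (intro exI[of _ "\<ominus> v"]) auto
    qed
    then obtain \<eta> where \<eta>: "\<And>b. b \<in> B \<Longrightarrow> \<eta> b \<in> carrier \<aa> \<and> \<phi> (P.rc (letter b)) = P'.rc (letter b - \<kappa> (\<eta> b))"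
      by metis
    then have \<eta>_closed: "\<eta> \<in> B \<rightarrow> carrier \<aa>" by blast
    have \<phi>_eq: "\<phi> (P.rc p) = P'.rc (\<Gamma> \<eta> p)" if "p \<in> Lie (A \<union> B)" for p
    proof (rule lie_hom_free_eq[OF lie_hom_comp[OF P.rc_hom \<phi>(1)] lie_hom_comp[OF \<Gamma>_hom[OF \<eta>_closed] P'.rc_hom] P'.lie_algebra_E _ that])
      show "\<phi> (P.rc (letter x)) = P'.rc (\<Gamma> \<eta> (letter x))" if "x \<in> A \<union> B" for x
        using that \<eta> \<phi>(2)[of "\<epsilon> x"] by (cases "x \<in> A") (auto simp: \<Gamma>_letter \<kappa>_\<epsilon>)
    qed
    have \<Gamma>_rel: "\<Gamma> \<eta> s \<in> ?I'" if s: "s \<in> P.LR" for s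
    proof -
      have "P.rc s = P.rc 0" using s by (simp add: rel_coset_eq lie_ideal.gen)
      then have "P'.rc (\<Gamma> \<eta> s) = P'.rc (\<Gamma> \<eta> 0)"
        using \<phi>_eq[of s] \<phi>_eq[of 0] P.LR_Lie s by (auto simp: Lie.zero)
      then show ?thesis by (simp add: rel_coset_eq \<Gamma>_simps)
    qed
    have "act' (letter b) (\<epsilon> a) \<ominus> act (letter b) (\<epsilon> a) = \<eta> b \<otimes> \<epsilon> a" if ab: "a \<in> A" "b \<in> B" for a b
    proof -
      let ?u = "act' (letter b) (\<epsilon> a) \<ominus> act (letter b) (\<epsilon> a)"
      have c: "?u \<in> carrier \<aa>" "\<eta> b \<otimes> \<epsilon> a \<in> carrier \<aa>" using ab lb \<eta> by auto
      have "comm (letter b - \<kappa> (\<eta> b)) (letter a) - \<kappa> (act (letter b) (\<epsilon> a)) \<in> ?I'"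
        using \<Gamma>_rel[OF subsetD[OF P.AR_subset P.ARI[OF ab]]] ab lb by (simp add: \<Gamma>_simps \<Gamma>_letter \<Gamma>_\<kappa>)
      from lie_ideal_diff[OF this act_rel[OF \<eta>_closed ab]]
      have "\<kappa> (?u \<ominus> \<eta> b \<otimes> \<epsilon> a) \<in> ?I'" by simp
      then have "?u \<ominus> \<eta> b \<otimes> \<epsilon> a = \<zero>" using c by (intro ideal_\<kappa>_zero[OF P'.letters_irreducible_LR]) auto
      then show ?thesis using c minus_eq_zero by blast
    qed
    moreover have "\<kappa> (fs' f \<ominus> fs f) = Red (A \<union> B) P'.LR (f - \<Gamma> \<eta> f)" if f: "f \<in> R" for f
    proof (rule Red_\<kappa>[OF P'.letters_irreducible_LR, symmetric])
      have "\<Gamma> \<eta> (f - P.fl f) \<in> ?I'" using f by (intro \<Gamma>_rel) (auto simp: P.LR_eq)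
      then have "(f - P'.fl f) - \<Gamma> \<eta> (f - P.fl f) \<in> ?I'" by (rule lie_ideal_diff[OF fs_rel[OF f]])
      then show "f - \<Gamma> \<eta> f - \<kappa> (fs' f \<ominus> fs f) \<in> ?I'" using f by (simp add: \<Gamma>_simps \<Gamma>_\<kappa> \<kappa>_diff algebra_simps)
    qed (use f in simp)
    ultimately show ?R using \<eta>_closed by blast
  next
    assume ?R
    then obtain \<eta> where \<eta>: "\<eta> \<in> B \<rightarrow> carrier \<aa>"
      and act_\<eta>: "\<And>a b. a \<in> A \<Longrightarrow> b \<in> B \<Longrightarrow> act' (letter b) (\<epsilon> a) \<ominus> act (letter b) (\<epsilon> a) = \<eta> b \<otimes> \<epsilon> a"
      and fs_\<eta>: "\<And>f. f \<in> R \<Longrightarrow> \<kappa> (fs' f \<ominus> fs f) = Red (A \<union> B) P'.LR (f - \<Gamma> \<eta> f)" by blast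
    note h = lie_hom_comp[OF \<Gamma>_hom[OF \<eta>] P'.rc_hom]
    have zero: "\<zero>\<^bsub>P'.E\<^esub> = P'.rc 0" by (simp add: LieE_def presented_lie_zero)
    have "\<Gamma> \<eta> s \<in> ?I'" if "s \<in> P.LR" for s
      using that
    proof (cases rule: P.LR_cases)
      case (AA a a')
      then have "\<Gamma> \<eta> s = s" by (simp add: \<Gamma>_simps \<Gamma>_letter \<Gamma>_\<kappa>)
      moreover have "s \<in> P'.LR" using AA by (auto simp: P'.LR_eq P'.AA_def)
      ultimately show ?thesis by (simp add: lie_ideal.gen)
    next
      case (AR a b)
      have "\<eta> b \<otimes> \<epsilon> a \<in> carrier \<aa>" using AR \<eta> by auto
      then have "\<kappa> (act' (letter b) (\<epsilon> a) \<ominus> act (letter b) (\<epsilon> a) \<ominus> \<eta> b \<otimes> \<epsilon> a) = 0"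
        using act_\<eta>[OF AR(1,2)] minus_eq_zero[of "\<eta> b \<otimes> \<epsilon> a" "\<eta> b \<otimes> \<epsilon> a"] by simp
      then show ?thesis using act_rel[OF \<eta> AR(1,2)] AR lb by (simp add: \<Gamma>_simps \<Gamma>_letter \<Gamma>_\<kappa>)
    next
      case (RR f)
      have "f - \<Gamma> \<eta> f - \<kappa> (fs' f \<ominus> fs f) \<in> ?I'"
        unfolding fs_\<eta>[OF RR(1)] using R_Un RR by (intro Red_cong P'.letters_irreducible_LR in_\<aa> \<eta>) auto
      with fs_rel[OF RR(1)] have "(f - P'.fl f) - (f - \<Gamma> \<eta> f - \<kappa> (fs' f \<ominus> fs f)) \<in> ?I'" by (rule lie_ideal_diff)
      then show ?thesis unfolding RR(2) using RR(1) by (simp add: \<Gamma>_simps \<Gamma>_\<kappa> \<kappa>_diff algebra_simps)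
    qed
    then have "P'.rc (\<Gamma> \<eta> s) = \<zero>\<^bsub>P'.E\<^esub>" if "s \<in> P.LR" for s
      using that by (simp add: zero rel_coset_eq)
    from presented_lie_lift[OF h P'.lie_algebra_E P.LR_Lie this]
    obtain \<phi> where \<phi>: "\<phi> \<in> lie_hom P.E P'.E" "\<And>p. p \<in> Lie (A \<union> B) \<Longrightarrow> \<phi> (P.rc p) = P'.rc (\<Gamma> \<eta> p)"
      unfolding LieE_def by blast
    have kill_\<Gamma>: "kill (\<Gamma> \<eta> p) = kill p" if "p \<in> Lie (A \<union> B)" for p
    proof (rule lie_hom_free_eq[OF lie_hom_comp[OF \<Gamma>_hom[OF \<eta>] kill_hom] kill_hom lie_algebra_free _ that])
      show "kill (\<Gamma> \<eta> (letter x)) = kill (letter x)" if "x \<in> A \<union> B" for x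
        using that \<eta> by (cases "x \<in> A") (auto simp: \<Gamma>_letter kill_simps kill_\<kappa> Pi_iff)
    qed
    show ?L
      unfolding equivalent_extensions_def
    proof (intro bexI[OF _ \<phi>(1)] conjI ballI)
      show "\<phi> (P.incl v) = P'.incl v" if "v \<in> carrier \<aa>" for v
        using that \<phi>(2) by (simp add: P.LieE_incl_eq P'.LieE_incl_eq \<kappa>_Lie_Un \<Gamma>_\<kappa>)
      show "LieE_proj A B R (\<phi> y) = LieE_proj A B R y" if "y \<in> carrier P.E" for y
        using that \<phi>(2) by (auto simp: P.E_carrier P.LieE_proj_eq P'.LieE_proj_eq kill_\<Gamma>)
    qed
  qed
qed

end

theorem theorem3p8:
  fixes \<aa> :: "('k::field, 'v) module"
    and A B :: "'x::wellorder set"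
    and \<epsilon> :: "'x \<Rightarrow> 'v"
    and R :: "('x, 'k) ncpoly set"
    and \<ee> :: "('k, 'e) module"
    and \<ee>' :: "('k, 'f) module"
  assumes "lie_algebra \<aa>"
    and "linear_basis \<aa> A \<epsilon>"
    and "\<forall>a\<in>A. \<forall>b\<in>B. a < b"
    and "minimal_GS_basis B R"
  shows "(lie_algebra \<ee> \<longrightarrow>
            ((\<exists>i \<pi>. extension \<aa> (presented_lie B R) \<ee> i \<pi>) \<longleftrightarrow>
             (\<exists>act fs. compatible_module (free_lie B) \<aa> act \<and> fs \<in> R \<rightarrow> carrier \<aa> \<and>
                condition_a \<aa> A \<epsilon> R fs act \<and> condition_b \<aa> A \<epsilon> B R fs act \<and>
                lie_isomorphic \<ee> (LieE \<aa> A \<epsilon> B R fs act))))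
       \<and> (\<forall>i \<pi> i' \<pi>' fs act fs' act'.
            extension \<aa> (presented_lie B R) \<ee> i \<pi> \<and>
            extension \<aa> (presented_lie B R) \<ee>' i' \<pi>' \<and>
            special_extension_pair \<aa> A \<epsilon> B R \<ee> i \<pi> fs act \<and>
            special_extension_pair \<aa> A \<epsilon> B R \<ee>' i' \<pi>' fs' act' \<longrightarrow>
            (equivalent_extensions \<aa> \<ee> i \<pi> \<ee>' i' \<pi>' \<longleftrightarrow>
             (\<exists>\<eta>. \<eta> \<in> B \<rightarrow> carrier \<aa> \<and>
                (\<forall>a\<in>A. \<forall>b\<in>B.
                   act' (letter b) (\<epsilon> a) \<ominus>\<^bsub>\<aa>\<^esub> act (letter b) (\<epsilon> a) = \<eta> b \<otimes>\<^bsub>\<aa>\<^esub> \<epsilon> a) \<and>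
                (\<forall>f\<in>R. as_letters \<aa> A \<epsilon> (fs' f \<ominus>\<^bsub>\<aa>\<^esub> fs f) =
                   Red (A \<union> B) (LieR \<aa> A \<epsilon> B R fs' act') (f - Gamma \<aa> A \<epsilon> B \<eta> f)))))"
proof -
  interpret lie_setting \<aa> A B \<epsilon> R
    by (intro lie_setting.intro lie_setting_axioms.intro) (use assms in auto)
  have pair_iff: "lie_pair \<aa> A B \<epsilon> R act fs \<longleftrightarrow> compatible_module (free_lie B) \<aa> act \<and> fs \<in> R \<rightarrow> carrier \<aa> \<and>
      condition_a \<aa> A \<epsilon> R fs act \<and> condition_b \<aa> A \<epsilon> B R fs act" for act fs
    by (simp add: lie_pair_def lie_factor_set_def lie_action_def lie_pair_axioms_def lie_factor_set_axioms_def
        lie_action_axioms_def lie_setting_axioms)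
  have I: "(\<exists>i \<pi>. extension \<aa> \<bb> \<ee> i \<pi>) \<longleftrightarrow> (\<exists>act fs. lie_pair \<aa> A B \<epsilon> R act fs \<and> lie_isomorphic \<ee> (LieE \<aa> A \<epsilon> B R fs act))"
    if \<ee>: "lie_algebra \<ee>"
  proof
    assume "\<exists>i \<pi>. extension \<aa> \<bb> \<ee> i \<pi>"
    then show "\<exists>act fs. lie_pair \<aa> A B \<epsilon> R act fs \<and> lie_isomorphic \<ee> (LieE \<aa> A \<epsilon> B R fs act)"
      using extension_isomorphic_LieE by blast
  next
    assume "\<exists>act fs. lie_pair \<aa> A B \<epsilon> R act fs \<and> lie_isomorphic \<ee> (LieE \<aa> A \<epsilon> B R fs act)"
    then obtain act fs h where "lie_pair \<aa> A B \<epsilon> R act fs" "h \<in> lie_hom \<ee> (LieE \<aa> A \<epsilon> B R fs act)"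
      "bij_betw h (carrier \<ee>) (carrier (LieE \<aa> A \<epsilon> B R fs act))"
      unfolding lie_isomorphic_def by blast
    then show "\<exists>i \<pi>. extension \<aa> \<bb> \<ee> i \<pi>"
      using extension_transport[OF lie_pair.LieE_extension \<ee>] by blast
  qed
  have II: "equivalent_extensions \<aa> \<ee> i \<pi> \<ee>' i' \<pi>' \<longleftrightarrow>
      equivalent_extensions \<aa> (LieE \<aa> A \<epsilon> B R fs act) (LieE_incl \<aa> A \<epsilon> B R fs act) (LieE_proj A B R)
        (LieE \<aa> A \<epsilon> B R fs' act') (LieE_incl \<aa> A \<epsilon> B R fs' act') (LieE_proj A B R)"
    and II_pairs: "lie_pair \<aa> A B \<epsilon> R act fs" "lie_pair \<aa> A B \<epsilon> R act' fs'"
    if ext: "extension \<aa> \<bb> \<ee> i \<pi>" "extension \<aa> \<bb> \<ee>' i' \<pi>'"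
      and pairs: "special_extension_pair \<aa> A \<epsilon> B R \<ee> i \<pi> fs act" "special_extension_pair \<aa> A \<epsilon> B R \<ee>' i' \<pi>' fs' act'"
    for i \<pi> i' \<pi>' fs act fs' act'
  proof -
    show P: "lie_pair \<aa> A B \<epsilon> R act fs" and P': "lie_pair \<aa> A B \<epsilon> R act' fs'"
      using pairs by (auto simp: special_extension_pair_def extension_pair_def pair_iff)
    have eq: "equivalent_extensions \<aa> \<ee> i \<pi> (LieE \<aa> A \<epsilon> B R fs act) (LieE_incl \<aa> A \<epsilon> B R fs act) (LieE_proj A B R)"
      "equivalent_extensions \<aa> \<ee>' i' \<pi>' (LieE \<aa> A \<epsilon> B R fs' act') (LieE_incl \<aa> A \<epsilon> B R fs' act') (LieE_proj A B R)"
      using pairs by (auto simp: special_extension_pair_def)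
    note LE = lie_pair.LieE_extension[OF P] and LE' = lie_pair.LieE_extension[OF P']
    note sym = equivalent_extensions_sym[OF assms(1) lie_algebra_\<bb>]
    note trans = equivalent_extensions_trans[OF extensionD(2)]
    show "equivalent_extensions \<aa> \<ee> i \<pi> \<ee>' i' \<pi>' \<longleftrightarrow>
      equivalent_extensions \<aa> (LieE \<aa> A \<epsilon> B R fs act) (LieE_incl \<aa> A \<epsilon> B R fs act) (LieE_proj A B R)
        (LieE \<aa> A \<epsilon> B R fs' act') (LieE_incl \<aa> A \<epsilon> B R fs' act') (LieE_proj A B R)"
    proof
      assume "equivalent_extensions \<aa> \<ee> i \<pi> \<ee>' i' \<pi>'"
      from trans[OF LE sym[OF ext(1) LE eq(1)] trans[OF ext(1) this eq(2)]]
      show "equivalent_extensions \<aa> (LieE \<aa> A \<epsilon> B R fs act) (LieE_incl \<aa> A \<epsilon> B R fs act) (LieE_proj A B R)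
        (LieE \<aa> A \<epsilon> B R fs' act') (LieE_incl \<aa> A \<epsilon> B R fs' act') (LieE_proj A B R)" .
    next
      assume "equivalent_extensions \<aa> (LieE \<aa> A \<epsilon> B R fs act) (LieE_incl \<aa> A \<epsilon> B R fs act) (LieE_proj A B R)
        (LieE \<aa> A \<epsilon> B R fs' act') (LieE_incl \<aa> A \<epsilon> B R fs' act') (LieE_proj A B R)"
      from trans[OF ext(1) eq(1) trans[OF LE this sym[OF ext(2) LE' eq(2)]]]
      show "equivalent_extensions \<aa> \<ee> i \<pi> \<ee>' i' \<pi>'" .
    qed
  qed
  show ?thesis
  proof (intro conjI impI allI)
    assume "lie_algebra \<ee>"
    from I[OF this] show "(\<exists>i \<pi>. extension \<aa> \<bb> \<ee> i \<pi>) \<longleftrightarrow>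
      (\<exists>act fs. compatible_module (free_lie B) \<aa> act \<and> fs \<in> R \<rightarrow> carrier \<aa> \<and>
        condition_a \<aa> A \<epsilon> R fs act \<and> condition_b \<aa> A \<epsilon> B R fs act \<and> lie_isomorphic \<ee> (LieE \<aa> A \<epsilon> B R fs act))"
      by (simp add: pair_iff conj_assoc)
  next
    fix i \<pi> i' \<pi>' fs act fs' act'
    assume "extension \<aa> \<bb> \<ee> i \<pi> \<and> extension \<aa> \<bb> \<ee>' i' \<pi>' \<and>
      special_extension_pair \<aa> A \<epsilon> B R \<ee> i \<pi> fs act \<and> special_extension_pair \<aa> A \<epsilon> B R \<ee>' i' \<pi>' fs' act'"
    then have ext: "extension \<aa> \<bb> \<ee> i \<pi>" "extension \<aa> \<bb> \<ee>' i' \<pi>'"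
      "special_extension_pair \<aa> A \<epsilon> B R \<ee> i \<pi> fs act" "special_extension_pair \<aa> A \<epsilon> B R \<ee>' i' \<pi>' fs' act'"
      by simp_all
    show "equivalent_extensions \<aa> \<ee> i \<pi> \<ee>' i' \<pi>' \<longleftrightarrow>
      (\<exists>\<eta>. \<eta> \<in> B \<rightarrow> carrier \<aa> \<and>
        (\<forall>a\<in>A. \<forall>b\<in>B. act' (letter b) (\<epsilon> a) \<ominus>\<^bsub>\<aa>\<^esub> act (letter b) (\<epsilon> a) = \<eta> b \<otimes>\<^bsub>\<aa>\<^esub> \<epsilon> a) \<and>
        (\<forall>f\<in>R. \<kappa> (fs' f \<ominus>\<^bsub>\<aa>\<^esub> fs f) = Red (A \<union> B) (LieR \<aa> A \<epsilon> B R fs' act') (f - \<Gamma> \<eta> f)))"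
      using II[OF ext] LieE_equivalent_iff[OF II_pairs[OF ext]] by (rule trans)
  qed
qed

end
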